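(* Let $R$ be a commutative Artinian ring and let $E$ be an injective $R$-module. The following are equivalent. (1) $E$ is Hopfian. (2) $E$ is co-Hopfian. (3) $E$ is finitely generated. (4) $E$ has finite length (has a finite composition series). (5) $E$ has the ascending chain condition on submodules (is Noetherian). (6) $E$ has the descending chain condition on submodules (is Artinian). (7) $E$ is finitely cogenerated.
   Context: All rings have $1 \neq 0$ and all modules are unital. An $R$-module $M$ is Hopfian if every surjective $R$-module endomorphism of $M$ is an isomorphism, and co-Hopfian if every injective $R$-module endomorphism of $M$ is an isomorphism. An $R$-module $M$ is finitely cogenerated if its injective envelope $E(M)$ is isomorphic to the direct sum of the injective envelopes of finitely many (possibly zero) simple $R$-modules. *)

theory Defs
  imports "HOL-Algebra.Module" "HOL-Algebra.Ideal" "HOL-Library.FuncSet"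
begin

section \<open>Homomorphisms\<close>

definition module_hom ::
    "('r, 'x) ring_scheme \<Rightarrow> ('r, 'm, 'y) module_scheme \<Rightarrow> ('r, 'n, 'z) module_scheme \<Rightarrow> ('m \<Rightarrow> 'n) set"
  where "module_hom R M N =
    {h \<in> carrier M \<rightarrow> carrier N.
       (\<forall>x\<in>carrier M. \<forall>y\<in>carrier M. h (x \<oplus>\<^bsub>M\<^esub> y) = h x \<oplus>\<^bsub>N\<^esub> h y) \<and>
       (\<forall>r\<in>carrier R. \<forall>x\<in>carrier M. h (r \<odot>\<^bsub>M\<^esub> x) = r \<odot>\<^bsub>N\<^esub> h x)}"

definition module_iso ::
    "('r, 'x) ring_scheme \<Rightarrow> ('r, 'm, 'y) module_scheme \<Rightarrow> ('r, 'n, 'z) module_scheme \<Rightarrow> ('m \<Rightarrow> 'n) set"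
  where "module_iso R M N = {h \<in> module_hom R M N. bij_betw h (carrier M) (carrier N)}"

definition hopfian :: "('r, 'x) ring_scheme \<Rightarrow> ('r, 'm, 'y) module_scheme \<Rightarrow> bool"
  where "hopfian R M \<longleftrightarrow>
    (\<forall>h \<in> module_hom R M M. h ` carrier M = carrier M \<longrightarrow> h \<in> module_iso R M M)"

definition cohopfian :: "('r, 'x) ring_scheme \<Rightarrow> ('r, 'm, 'y) module_scheme \<Rightarrow> bool"
  where "cohopfian R M \<longleftrightarrow>
    (\<forall>h \<in> module_hom R M M. inj_on h (carrier M) \<longrightarrow> h \<in> module_iso R M M)"


section \<open>Finiteness conditions\<close>

text \<open>The library has noetherian rings but not artinian ones. For a noncommutative ring the
  condition below, on two-sided ideals, would be too weak; it is meant for commutative rings.\<close>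

locale artinian_cring = cring +
  assumes descending_ideals_stabilize:
    "\<lbrakk>\<And>n. ideal (I n) R; \<And>n. I (Suc n) \<subseteq> I n\<rbrakk> \<Longrightarrow> \<exists>N. \<forall>n\<ge>N. I n = I (N::nat)"

definition submodule_span ::
    "('r, 'x) ring_scheme \<Rightarrow> ('r, 'm, 'y) module_scheme \<Rightarrow> 'm set \<Rightarrow> 'm set"
  where "submodule_span R M S = \<Inter>{H. submodule H R M \<and> S \<subseteq> H}"

definition finitely_generated_module ::
    "('r, 'x) ring_scheme \<Rightarrow> ('r, 'm, 'y) module_scheme \<Rightarrow> bool"
  where "finitely_generated_module R M \<longleftrightarrow>
    (\<exists>S. finite S \<and> S \<subseteq> carrier M \<and> submodule_span R M S = carrier M)"

definition noetherian_module :: "('r, 'x) ring_scheme \<Rightarrow> ('r, 'm, 'y) module_scheme \<Rightarrow> bool"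
  where "noetherian_module R M \<longleftrightarrow>
    (\<forall>H :: nat \<Rightarrow> 'm set. (\<forall>n. submodule (H n) R M) \<and> (\<forall>n. H n \<subseteq> H (Suc n)) \<longrightarrow>
       (\<exists>N. \<forall>n\<ge>N. H n = H N))"

definition artinian_module :: "('r, 'x) ring_scheme \<Rightarrow> ('r, 'm, 'y) module_scheme \<Rightarrow> bool"
  where "artinian_module R M \<longleftrightarrow>
    (\<forall>H :: nat \<Rightarrow> 'm set. (\<forall>n. submodule (H n) R M) \<and> (\<forall>n. H (Suc n) \<subseteq> H n) \<longrightarrow>
       (\<exists>N. \<forall>n\<ge>N. H n = H N))"

text \<open>A composition series is a finite strictly increasing chain of submodules from \<open>0\<close> to \<open>M\<close>
  into which no further submodule can be inserted. The zero module has the series with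
  \<open>n = 0\<close>.\<close>

definition composition_series ::
    "('r, 'x) ring_scheme \<Rightarrow> ('r, 'm, 'y) module_scheme \<Rightarrow> nat \<Rightarrow> (nat \<Rightarrow> 'm set) \<Rightarrow> bool"
  where "composition_series R M n H \<longleftrightarrow>
    H 0 = {\<zero>\<^bsub>M\<^esub>} \<and> H n = carrier M \<and>
    (\<forall>i\<le>n. submodule (H i) R M) \<and>
    (\<forall>i<n. H i \<subset> H (Suc i) \<and> \<not> (\<exists>K. submodule K R M \<and> H i \<subset> K \<and> K \<subset> H (Suc i)))"

definition finite_length_module :: "('r, 'x) ring_scheme \<Rightarrow> ('r, 'm, 'y) module_scheme \<Rightarrow> bool"
  where "finite_length_module R M \<longleftrightarrow> (\<exists>n H. composition_series R M n H)"


section \<open>Injective modules\<close>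

text \<open>A definition cannot quantify over types, so the modules \<open>A\<close> and \<open>B\<close> along which homomorphisms
  have to extend are taken here with carriers in the type of the ring elements. This is no
  restriction: \<open>injective_module_extends\<close> below (Baer's argument) gives the
  extension property for \<open>A\<close> and \<open>B\<close> over arbitrary types.\<close>

definition injective_module :: "('r, 'x) ring_scheme \<Rightarrow> ('r, 'm, 'y) module_scheme \<Rightarrow> bool"
  where "injective_module R M \<longleftrightarrow> module R M \<and>
    (\<forall>(A :: ('r, 'r) module) (B :: ('r, 'r) module) f g.
       module R A \<and> module R B \<and> f \<in> module_hom R A B \<and> inj_on f (carrier A) \<and>
       g \<in> module_hom R A M \<longrightarrow>
       (\<exists>h \<in> module_hom R B M. \<forall>x \<in> carrier A. h (f x) = g x))"

lemma module_homD:
  assumes "h \<in> module_hom R M N"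
  shows "\<And>x. x \<in> carrier M \<Longrightarrow> h x \<in> carrier N"
    and "\<And>x y. \<lbrakk>x \<in> carrier M; y \<in> carrier M\<rbrakk> \<Longrightarrow> h (x \<oplus>\<^bsub>M\<^esub> y) = h x \<oplus>\<^bsub>N\<^esub> h y"
    and "\<And>r x. \<lbrakk>r \<in> carrier R; x \<in> carrier M\<rbrakk> \<Longrightarrow> h (r \<odot>\<^bsub>M\<^esub> x) = r \<odot>\<^bsub>N\<^esub> h x"
  using assms by (auto simp: module_hom_def)

lemma module_homI:
  assumes "\<And>x. x \<in> carrier M \<Longrightarrow> h x \<in> carrier N"
    and "\<And>x y. \<lbrakk>x \<in> carrier M; y \<in> carrier M\<rbrakk> \<Longrightarrow> h (x \<oplus>\<^bsub>M\<^esub> y) = h x \<oplus>\<^bsub>N\<^esub> h y"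
    and "\<And>r x. \<lbrakk>r \<in> carrier R; x \<in> carrier M\<rbrakk> \<Longrightarrow> h (r \<odot>\<^bsub>M\<^esub> x) = r \<odot>\<^bsub>N\<^esub> h x"
  shows "h \<in> module_hom R M N"
  using assms by (auto simp: module_hom_def)

lemma module_hom_zero:
  assumes "module R M" "module R N" "h \<in> module_hom R M N"
  shows "h \<zero>\<^bsub>M\<^esub> = \<zero>\<^bsub>N\<^esub>"
proof -
  interpret M: module R M by fact
  interpret N: module R N by fact
  have "h (\<zero>\<^bsub>R\<^esub> \<odot>\<^bsub>M\<^esub> \<zero>\<^bsub>M\<^esub>) = \<zero>\<^bsub>R\<^esub> \<odot>\<^bsub>N\<^esub> h \<zero>\<^bsub>M\<^esub>"
    by (rule module_homD(3)[OF assms(3)]) auto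
  thus ?thesis using module_homD(1)[OF assms(3)] by simp
qed

definition ring_module :: "('r, 'x) ring_scheme \<Rightarrow> ('r, 'r) module"
  where "ring_module R = \<lparr>carrier = carrier R, mult = mult R, one = \<one>\<^bsub>R\<^esub>, zero = \<zero>\<^bsub>R\<^esub>,
    add = add R, smult = mult R\<rparr>"

lemma ring_module_simps [simp]:
  "carrier (ring_module R) = carrier R" "zero (ring_module R) = zero R"
  "add (ring_module R) = add R" "smult (ring_module R) = mult R"
  by (auto simp: ring_module_def)

lemma (in cring) module_ring_module: "module R (ring_module R)"
proof (rule moduleI)
  show "abelian_group (ring_module R)"
    by (rule abelian_groupI) (auto simp: a_ac intro: a_inv_closed l_neg bexI[of _ "\<ominus> x" for x])
qed (auto simp: is_cring l_distr r_distr m_assoc)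

theorem injective_module_extends:
  fixes R :: "('r, 'x) ring_scheme" and E :: "('r, 'e, 'y) module_scheme"
    and A :: "('r, 'a, 'z) module_scheme" and B :: "('r, 'b, 'w) module_scheme"
  assumes inj: "injective_module R E" and A: "module R A" and B: "module R B"
    and f: "f \<in> module_hom R A B" "inj_on f (carrier A)" and g: "g \<in> module_hom R A E"
  shows "\<exists>h \<in> module_hom R B E. \<forall>x \<in> carrier A. h (f x) = g x"
proof -
  interpret A: module R A by fact
  interpret B: module R B by fact
  have E: "module R E" using inj by (simp add: injective_module_def)
  interpret E: module R E by fact
  have f0: "f \<zero>\<^bsub>A\<^esub> = \<zero>\<^bsub>B\<^esub>" and g0: "g \<zero>\<^bsub>A\<^esub> = \<zero>\<^bsub>E\<^esub>"
    using module_hom_zero A B E f g by blast+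

  define good where "good = (\<lambda>G. G \<subseteq> carrier B \<times> carrier E \<and>
      (\<forall>x\<in>carrier A. (f x, g x) \<in> G) \<and>
      (\<forall>x y x' y'. (x, y) \<in> G \<longrightarrow> (x', y') \<in> G \<longrightarrow> (x \<oplus>\<^bsub>B\<^esub> x', y \<oplus>\<^bsub>E\<^esub> y') \<in> G) \<and>
      (\<forall>r\<in>carrier R. \<forall>x y. (x, y) \<in> G \<longrightarrow> (r \<odot>\<^bsub>B\<^esub> x, r \<odot>\<^bsub>E\<^esub> y) \<in> G) \<and>
      (\<forall>y. (\<zero>\<^bsub>B\<^esub>, y) \<in> G \<longrightarrow> y = \<zero>\<^bsub>E\<^esub>))"
  have good_sub: "(x, y) \<in> G \<Longrightarrow> x \<in> carrier B \<and> y \<in> carrier E" if "good G" for G x y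
    using that by (auto simp: good_def)
  have good_fg: "x \<in> carrier A \<Longrightarrow> (f x, g x) \<in> G" if "good G" for G x
    using that by (auto simp: good_def)
  have good_add: "(x, y) \<in> G \<Longrightarrow> (x', y') \<in> G \<Longrightarrow> (x \<oplus>\<^bsub>B\<^esub> x', y \<oplus>\<^bsub>E\<^esub> y') \<in> G"
    if "good G" for G x y x' y'
    using that by (auto simp: good_def)
  have good_smult: "r \<in> carrier R \<Longrightarrow> (x, y) \<in> G \<Longrightarrow> (r \<odot>\<^bsub>B\<^esub> x, r \<odot>\<^bsub>E\<^esub> y) \<in> G"
    if "good G" for G r x y
    using that by (auto simp: good_def)
  have good_zero: "(\<zero>\<^bsub>B\<^esub>, y) \<in> G \<Longrightarrow> y = \<zero>\<^bsub>E\<^esub>" if "good G" for G y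
    using that by (auto simp: good_def)
  have good_fun: "y = y'" if G: "good G" and xy: "(x, y) \<in> G" "(x, y') \<in> G" for G x y y'
  proof -
    have c: "x \<in> carrier B" "y \<in> carrier E" "y' \<in> carrier E"
      using good_sub[OF G] xy by auto
    have "(x \<oplus>\<^bsub>B\<^esub> (\<ominus>\<^bsub>R\<^esub> \<one>\<^bsub>R\<^esub>) \<odot>\<^bsub>B\<^esub> x, y \<oplus>\<^bsub>E\<^esub> (\<ominus>\<^bsub>R\<^esub> \<one>\<^bsub>R\<^esub>) \<odot>\<^bsub>E\<^esub> y') \<in> G"
      using good_add[OF G xy(1) good_smult[OF G _ xy(2)]] by simp
    hence "(\<zero>\<^bsub>B\<^esub>, y \<oplus>\<^bsub>E\<^esub> (\<ominus>\<^bsub>E\<^esub> y')) \<in> G"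
      using c by (simp add: B.smult_l_minus E.smult_l_minus B.M.r_neg)
    hence "y \<oplus>\<^bsub>E\<^esub> (\<ominus>\<^bsub>E\<^esub> y') = \<zero>\<^bsub>E\<^esub>" by (rule good_zero[OF G])
    thus ?thesis using c by (metis E.M.minus_equality E.M.minus_minus E.M.a_inv_closed)
  qed

  let ?G0 = "(\<lambda>x. (f x, g x)) ` carrier A"
  have "good ?G0"
    unfolding good_def
  proof (intro conjI ballI allI impI)
    show "?G0 \<subseteq> carrier B \<times> carrier E"
      using module_homD(1)[OF f(1)] module_homD(1)[OF g] by auto
    fix x y x' y' assume "(x, y) \<in> ?G0" "(x', y') \<in> ?G0"
    then obtain a a' where "a \<in> carrier A" "a' \<in> carrier A" "x = f a" "y = g a" "x' = f a'" "y' = g a'"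
      by auto
    thus "(x \<oplus>\<^bsub>B\<^esub> x', y \<oplus>\<^bsub>E\<^esub> y') \<in> ?G0"
      by (intro image_eqI[of _ _ "a \<oplus>\<^bsub>A\<^esub> a'"])
         (simp_all add: module_homD(2)[OF f(1)] module_homD(2)[OF g])
  next
    fix r x y assume "r \<in> carrier R" "(x, y) \<in> ?G0"
    then obtain a where "a \<in> carrier A" "x = f a" "y = g a" "r \<in> carrier R" by auto
    thus "(r \<odot>\<^bsub>B\<^esub> x, r \<odot>\<^bsub>E\<^esub> y) \<in> ?G0"
      by (intro image_eqI[of _ _ "r \<odot>\<^bsub>A\<^esub> a"])
         (simp_all add: module_homD(3)[OF f(1)] module_homD(3)[OF g])
  next
    fix y assume "(\<zero>\<^bsub>B\<^esub>, y) \<in> ?G0"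
    then obtain a where a: "a \<in> carrier A" "f a = \<zero>\<^bsub>B\<^esub>" "y = g a" by auto
    have "a = \<zero>\<^bsub>A\<^esub>" using a f0 f(2) by (metis A.M.zero_closed inj_on_eq_iff)
    thus "y = \<zero>\<^bsub>E\<^esub>" using a g0 by simp
  qed auto
  have "\<exists>G\<in>Collect good. \<forall>X\<in>Collect good. G \<subseteq> X \<longrightarrow> X = G"
  proof (rule subset_Zorn_nonempty)
    show "Collect good \<noteq> {}" using \<open>good ?G0\<close> by blast
    fix C assume "C \<noteq> {}" and "subset.chain (Collect good) C"
    hence gd: "\<And>G. G \<in> C \<Longrightarrow> good G" and
      ch: "\<And>G G'. G \<in> C \<Longrightarrow> G' \<in> C \<Longrightarrow> G \<subseteq> G' \<or> G' \<subseteq> G"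
      unfolding subset.chain_def by auto
    have "good (\<Union>C)"
      unfolding good_def
    proof (intro conjI ballI allI impI)
      show "\<Union>C \<subseteq> carrier B \<times> carrier E" using good_sub[OF gd] by fastforce
      show "(f x, g x) \<in> \<Union>C" if "x \<in> carrier A" for x
        using good_fg[OF gd that] \<open>C \<noteq> {}\<close> by blast
      show "(x \<oplus>\<^bsub>B\<^esub> x', y \<oplus>\<^bsub>E\<^esub> y') \<in> \<Union>C" if m: "(x, y) \<in> \<Union>C" "(x', y') \<in> \<Union>C" for x y x' y'
      proof -
        obtain G G' where G: "G \<in> C" "G' \<in> C" "(x, y) \<in> G" "(x', y') \<in> G'" using m by blast
        from ch[OF G(1,2)] show ?thesis
        proof
          assume "G \<subseteq> G'"
          thus ?thesis using good_add[OF gd[OF G(2)]] G by blast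
        next
          assume "G' \<subseteq> G"
          thus ?thesis using good_add[OF gd[OF G(1)]] G by blast
        qed
      qed
      show "(r \<odot>\<^bsub>B\<^esub> x, r \<odot>\<^bsub>E\<^esub> y) \<in> \<Union>C" if "r \<in> carrier R" "(x, y) \<in> \<Union>C" for r x y
        using that good_smult[OF gd] by blast
      show "y = \<zero>\<^bsub>E\<^esub>" if "(\<zero>\<^bsub>B\<^esub>, y) \<in> \<Union>C" for y
        using that good_zero[OF gd] by blast
    qed
    thus "\<Union>C \<in> Collect good" by simp
  qed
  then obtain G where G: "good G" and max: "\<And>X. good X \<Longrightarrow> G \<subseteq> X \<Longrightarrow> X = G" by blast
  have G0: "(\<zero>\<^bsub>B\<^esub>, \<zero>\<^bsub>E\<^esub>) \<in> G"
    using good_fg[OF G, of "\<zero>\<^bsub>A\<^esub>"] f0 g0 by simp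

  have total: "\<exists>e. (b, e) \<in> G" if b: "b \<in> carrier B" for b
  proof -
    define I where "I = {r \<in> carrier R. \<exists>e. (r \<odot>\<^bsub>B\<^esub> b, e) \<in> G}"
    define \<phi> where "\<phi> = (\<lambda>r. THE e. (r \<odot>\<^bsub>B\<^esub> b, e) \<in> G)"
    have phi: "\<phi> r = e" if "(r \<odot>\<^bsub>B\<^esub> b, e) \<in> G" for r e
      unfolding \<phi>_def using that good_fun[OF G] by blast
    have phiG: "(r \<odot>\<^bsub>B\<^esub> b, \<phi> r) \<in> G" if "r \<in> I" for r
      using that phi unfolding I_def by auto
    have I_add: "r \<oplus>\<^bsub>R\<^esub> s \<in> I \<and> \<phi> (r \<oplus>\<^bsub>R\<^esub> s) = \<phi> r \<oplus>\<^bsub>E\<^esub> \<phi> s" if "r \<in> I" "s \<in> I" for r s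
    proof -
      have "((r \<oplus>\<^bsub>R\<^esub> s) \<odot>\<^bsub>B\<^esub> b, \<phi> r \<oplus>\<^bsub>E\<^esub> \<phi> s) \<in> G"
        using good_add[OF G phiG[OF that(1)] phiG[OF that(2)]] that b
        by (auto simp: I_def B.smult_l_distr)
      thus ?thesis using that phi unfolding I_def by auto
    qed
    have I_mult: "r \<otimes>\<^bsub>R\<^esub> s \<in> I \<and> \<phi> (r \<otimes>\<^bsub>R\<^esub> s) = r \<odot>\<^bsub>E\<^esub> \<phi> s" if "r \<in> carrier R" "s \<in> I" for r s
    proof -
      have "((r \<otimes>\<^bsub>R\<^esub> s) \<odot>\<^bsub>B\<^esub> b, r \<odot>\<^bsub>E\<^esub> \<phi> s) \<in> G"
        using good_smult[OF G that(1) phiG[OF that(2)]] that b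
        by (auto simp: I_def B.smult_assoc1)
      thus ?thesis using that phi unfolding I_def by auto
    qed
    have I_sub: "I \<subseteq> carrier R" by (auto simp: I_def)
    have I0: "\<zero>\<^bsub>R\<^esub> \<in> I" using G0 b by (auto simp: I_def)
    interpret RM: module R "ring_module R" by (rule cring.module_ring_module[OF module.axioms(1)[OF A]])
    have "submodule I R (ring_module R)"
    proof (rule RM.submoduleI)
      show "\<ominus>\<^bsub>ring_module R\<^esub> r \<in> I" if "r \<in> I" for r
      proof -
        have r: "r \<in> carrier R" using that I_sub by blast
        have "\<ominus>\<^bsub>ring_module R\<^esub> r = (\<ominus>\<^bsub>R\<^esub> \<one>\<^bsub>R\<^esub>) \<odot>\<^bsub>ring_module R\<^esub> r"
          using r RM.smult_l_minus[of "\<one>\<^bsub>R\<^esub>" r] RM.smult_one[of r] by simp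
        thus ?thesis using I_mult[OF _ that, of "\<ominus>\<^bsub>R\<^esub> \<one>\<^bsub>R\<^esub>"] by simp
      qed
    qed (use I_sub I0 I_add I_mult in auto)
    hence Imod: "module R ((ring_module R)\<lparr>carrier := I\<rparr>)"
      using submodule.submodule_is_module RM.module_axioms by blast
    have "(\<lambda>r. r) \<in> module_hom R ((ring_module R)\<lparr>carrier := I\<rparr>) (ring_module R)"
      using I_sub by (intro module_homI) auto
    moreover have "\<phi> \<in> module_hom R ((ring_module R)\<lparr>carrier := I\<rparr>) E"
      using I_add I_mult phiG good_sub[OF G] by (intro module_homI) (simp_all, blast)
    ultimately obtain \<psi> where psi: "\<psi> \<in> module_hom R (ring_module R) E"
        and psi_phi: "\<And>r. r \<in> I \<Longrightarrow> \<psi> r = \<phi> r"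
      using inj Imod RM.module_axioms unfolding injective_module_def
      by (fastforce simp: inj_on_def)
    define e where "e = \<psi> \<one>\<^bsub>R\<^esub>"
    have e: "e \<in> carrier E" using module_homD(1)[OF psi] by (simp add: e_def)
    have re: "r \<odot>\<^bsub>E\<^esub> e = \<phi> r" if "r \<in> I" for r
    proof -
      have "\<psi> (r \<otimes>\<^bsub>R\<^esub> \<one>\<^bsub>R\<^esub>) = r \<odot>\<^bsub>E\<^esub> e"
        using module_homD(3)[OF psi, of r "\<one>\<^bsub>R\<^esub>"] that I_sub by (auto simp: e_def)
      thus ?thesis using that I_sub psi_phi by (auto simp: subset_iff)
    qed
    define G' where "G' = {(x \<oplus>\<^bsub>B\<^esub> r \<odot>\<^bsub>B\<^esub> b, y \<oplus>\<^bsub>E\<^esub> r \<odot>\<^bsub>E\<^esub> e) | x y r. (x, y) \<in> G \<and> r \<in> carrier R}"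
    have G'I: "(x \<oplus>\<^bsub>B\<^esub> r \<odot>\<^bsub>B\<^esub> b, y \<oplus>\<^bsub>E\<^esub> r \<odot>\<^bsub>E\<^esub> e) \<in> G'" if "(x, y) \<in> G" "r \<in> carrier R" for x y r
      using that unfolding G'_def by blast
    have sub: "G \<subseteq> G'"
    proof
      fix p assume p: "p \<in> G"
      obtain x y where xy: "p = (x, y)" by (cases p)
      have "p = (x \<oplus>\<^bsub>B\<^esub> \<zero>\<^bsub>R\<^esub> \<odot>\<^bsub>B\<^esub> b, y \<oplus>\<^bsub>E\<^esub> \<zero>\<^bsub>R\<^esub> \<odot>\<^bsub>E\<^esub> e)"
        using good_sub[OF G] p xy b e by simp
      thus "p \<in> G'" using G'I[OF _ A.R.zero_closed] p xy by metis
    qed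
    have "good G'"
      unfolding good_def
    proof (intro conjI ballI allI impI)
      show "G' \<subseteq> carrier B \<times> carrier E"
        using good_sub[OF G] b e unfolding G'_def by auto
      show "(f x, g x) \<in> G'" if "x \<in> carrier A" for x
        using sub good_fg[OF G that] by blast
      show "(x \<oplus>\<^bsub>B\<^esub> x', y \<oplus>\<^bsub>E\<^esub> y') \<in> G'" if m: "(x, y) \<in> G'" "(x', y') \<in> G'" for x y x' y'
      proof -
        obtain u v r u' v' r' where w: "(u, v) \<in> G" "r \<in> carrier R" "x = u \<oplus>\<^bsub>B\<^esub> r \<odot>\<^bsub>B\<^esub> b"
          "y = v \<oplus>\<^bsub>E\<^esub> r \<odot>\<^bsub>E\<^esub> e" "(u', v') \<in> G" "r' \<in> carrier R" "x' = u' \<oplus>\<^bsub>B\<^esub> r' \<odot>\<^bsub>B\<^esub> b"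
          "y' = v' \<oplus>\<^bsub>E\<^esub> r' \<odot>\<^bsub>E\<^esub> e"
          using m unfolding G'_def by blast
        have c: "u \<in> carrier B" "v \<in> carrier E" "u' \<in> carrier B" "v' \<in> carrier E"
          using good_sub[OF G] w by auto
        have "x \<oplus>\<^bsub>B\<^esub> x' = (u \<oplus>\<^bsub>B\<^esub> u') \<oplus>\<^bsub>B\<^esub> (r \<oplus>\<^bsub>R\<^esub> r') \<odot>\<^bsub>B\<^esub> b"
          using w c b by (simp add: B.smult_l_distr B.M.a_ac)
        moreover have "y \<oplus>\<^bsub>E\<^esub> y' = (v \<oplus>\<^bsub>E\<^esub> v') \<oplus>\<^bsub>E\<^esub> (r \<oplus>\<^bsub>R\<^esub> r') \<odot>\<^bsub>E\<^esub> e"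
          using w c e by (simp add: E.smult_l_distr E.M.a_ac)
        ultimately show ?thesis
          unfolding G'_def using good_add[OF G w(1) w(5)] w(2,6) A.R.a_closed by blast
      qed
      show "(s \<odot>\<^bsub>B\<^esub> x, s \<odot>\<^bsub>E\<^esub> y) \<in> G'" if s: "s \<in> carrier R" and m: "(x, y) \<in> G'" for s x y
      proof -
        obtain u v r where w: "(u, v) \<in> G" "r \<in> carrier R" "x = u \<oplus>\<^bsub>B\<^esub> r \<odot>\<^bsub>B\<^esub> b"
          "y = v \<oplus>\<^bsub>E\<^esub> r \<odot>\<^bsub>E\<^esub> e"
          using m unfolding G'_def by blast
        have c: "u \<in> carrier B" "v \<in> carrier E" using good_sub[OF G] w by auto
        have "s \<odot>\<^bsub>B\<^esub> x = s \<odot>\<^bsub>B\<^esub> u \<oplus>\<^bsub>B\<^esub> (s \<otimes>\<^bsub>R\<^esub> r) \<odot>\<^bsub>B\<^esub> b"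
          using w c b s by (simp add: B.smult_r_distr B.smult_assoc1)
        moreover have "s \<odot>\<^bsub>E\<^esub> y = s \<odot>\<^bsub>E\<^esub> v \<oplus>\<^bsub>E\<^esub> (s \<otimes>\<^bsub>R\<^esub> r) \<odot>\<^bsub>E\<^esub> e"
          using w c e s by (simp add: E.smult_r_distr E.smult_assoc1)
        ultimately show ?thesis
          unfolding G'_def using good_smult[OF G s w(1)] s w(2) A.R.m_closed by blast
      qed
      show "y = \<zero>\<^bsub>E\<^esub>" if m: "(\<zero>\<^bsub>B\<^esub>, y) \<in> G'" for y
      proof -
        obtain u v r where w: "(u, v) \<in> G" "r \<in> carrier R" "\<zero>\<^bsub>B\<^esub> = u \<oplus>\<^bsub>B\<^esub> r \<odot>\<^bsub>B\<^esub> b"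
          "y = v \<oplus>\<^bsub>E\<^esub> r \<odot>\<^bsub>E\<^esub> e"
          using m unfolding G'_def by blast
        have c: "u \<in> carrier B" "v \<in> carrier E" using good_sub[OF G] w by auto
        have rb: "r \<odot>\<^bsub>B\<^esub> b = \<ominus>\<^bsub>B\<^esub> u"
          using w c b B.M.minus_equality[of "r \<odot>\<^bsub>B\<^esub> b" u] B.M.a_comm by simp
        have "((\<ominus>\<^bsub>R\<^esub> \<one>\<^bsub>R\<^esub>) \<odot>\<^bsub>B\<^esub> u, (\<ominus>\<^bsub>R\<^esub> \<one>\<^bsub>R\<^esub>) \<odot>\<^bsub>E\<^esub> v) \<in> G"
          using good_smult[OF G _ w(1)] by simp
        hence m': "(r \<odot>\<^bsub>B\<^esub> b, \<ominus>\<^bsub>E\<^esub> v) \<in> G"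
          using c rb by (simp add: B.smult_l_minus E.smult_l_minus)
        hence "r \<in> I" using w(2) by (auto simp: I_def)
        hence "r \<odot>\<^bsub>E\<^esub> e = \<ominus>\<^bsub>E\<^esub> v" using re phi[OF m'] by simp
        thus ?thesis using w c by (simp add: E.M.r_neg)
      qed
    qed
    hence "G' = G" using max sub by blast
    moreover have "(\<zero>\<^bsub>B\<^esub> \<oplus>\<^bsub>B\<^esub> \<one>\<^bsub>R\<^esub> \<odot>\<^bsub>B\<^esub> b, \<zero>\<^bsub>E\<^esub> \<oplus>\<^bsub>E\<^esub> \<one>\<^bsub>R\<^esub> \<odot>\<^bsub>E\<^esub> e) \<in> G'"
      unfolding G'_def using G0 A.R.one_closed by blast
    ultimately show ?thesis by auto (use b in auto)
  qed

  define h where "h = (\<lambda>b. THE e. (b, e) \<in> G)"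
  have h: "h b = e" if "(b, e) \<in> G" for b e
    unfolding h_def using that good_fun[OF G] by blast
  have hG: "(b, h b) \<in> G" if "b \<in> carrier B" for b
    using total[OF that] h by auto
  have "h \<in> module_hom R B E"
  proof (rule module_homI)
    show "h x \<in> carrier E" if "x \<in> carrier B" for x using hG[OF that] good_sub[OF G] by blast
    show "h (x \<oplus>\<^bsub>B\<^esub> y) = h x \<oplus>\<^bsub>E\<^esub> h y" if "x \<in> carrier B" "y \<in> carrier B" for x y
      by (rule h) (rule good_add[OF G hG[OF that(1)] hG[OF that(2)]])
    show "h (r \<odot>\<^bsub>B\<^esub> x) = r \<odot>\<^bsub>E\<^esub> h x" if "r \<in> carrier R" "x \<in> carrier B" for r x
      by (rule h) (rule good_smult[OF G that(1) hG[OF that(2)]])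
  qed
  moreover have "h (f x) = g x" if "x \<in> carrier A" for x
    by (rule h) (rule good_fg[OF G that])
  ultimately show ?thesis by blast
qed


section \<open>Injective envelopes and finite cogeneration\<close>

definition simple_module :: "('r, 'x) ring_scheme \<Rightarrow> ('r, 'm, 'y) module_scheme \<Rightarrow> bool"
  where "simple_module R M \<longleftrightarrow> module R M \<and> carrier M \<noteq> {\<zero>\<^bsub>M\<^esub>} \<and>
    (\<forall>H. submodule H R M \<longrightarrow> H = {\<zero>\<^bsub>M\<^esub>} \<or> H = carrier M)"

definition essential_submodule ::
    "('r, 'x) ring_scheme \<Rightarrow> ('r, 'm, 'y) module_scheme \<Rightarrow> 'm set \<Rightarrow> bool"
  where "essential_submodule R M H \<longleftrightarrow> submodule H R M \<and>
    (\<forall>K. submodule K R M \<and> K \<noteq> {\<zero>\<^bsub>M\<^esub>} \<longrightarrow> H \<inter> K \<noteq> {\<zero>\<^bsub>M\<^esub>})"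

definition injective_envelope ::
    "('r, 'x) ring_scheme \<Rightarrow> ('r, 'm, 'y) module_scheme \<Rightarrow> ('r, 'n, 'z) module_scheme \<Rightarrow> ('m \<Rightarrow> 'n) \<Rightarrow> bool"
  where "injective_envelope R M N f \<longleftrightarrow>
    module R M \<and> injective_module R N \<and> f \<in> module_hom R M N \<and> inj_on f (carrier M) \<and>
    essential_submodule R N (f ` carrier M)"

text \<open>Modules are records that extend
  rings; the ring multiplication and unit of such a record play no role.\<close>

definition direct_sum_module ::
    "'i set \<Rightarrow> ('i \<Rightarrow> ('r, 'm, 'y) module_scheme) \<Rightarrow> ('r, 'i \<Rightarrow> 'm) module"
  where "direct_sum_module I D =
    \<lparr>carrier = {x \<in> (\<Pi>\<^sub>E i\<in>I. carrier (D i)). finite {i \<in> I. x i \<noteq> \<zero>\<^bsub>D i\<^esub>}},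
     mult = undefined, one = undefined,
     zero = (\<lambda>i\<in>I. \<zero>\<^bsub>D i\<^esub>),
     add = (\<lambda>x y. \<lambda>i\<in>I. x i \<oplus>\<^bsub>D i\<^esub> y i),
     smult = (\<lambda>r x. \<lambda>i\<in>I. r \<odot>\<^bsub>D i\<^esub> x i)\<rparr>"

text \<open>Injective envelopes are unique up to isomorphism, so it does not matter which ones are chosen;
  but their carriers have to be looked for in a fixed type that is large enough. The type below is:
  \<open>M\<close> embeds into a divisible abelian group \<open>D\<close> with at most \<open>max |M| \<aleph>\<^sub>0\<close> elements, hence into
  the injective module of additive maps from \<open>R\<close> to \<open>D\<close>, each of which is a subset of \<open>R \<times> D\<close>.
  A simple module is a quotient of \<open>R\<close>, so that the same bound applies to its envelope.\<close>

type_synonym ('r, 'm) envelope_carrier = "('r + 'm + nat) set"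

definition finitely_cogenerated ::
    "('r, 'x) ring_scheme \<Rightarrow> ('r, 'm, 'y) module_scheme \<Rightarrow> bool"
  where "finitely_cogenerated R M \<longleftrightarrow>
    (\<exists>(N :: ('r, ('r, 'm) envelope_carrier) module) f (n :: nat)
       (S :: nat \<Rightarrow> ('r, ('r, 'm) envelope_carrier) module)
       (D :: nat \<Rightarrow> ('r, ('r, 'm) envelope_carrier) module) g.
       injective_envelope R M N f \<and>
       (\<forall>i<n. simple_module R (S i) \<and> injective_envelope R (S i) (D i) (g i)) \<and>
       module_iso R N (direct_sum_module {..<n} D) \<noteq> {})"

end

(* Let R be artinian. If for every maximal ideal m the part of M killed by m lies in a submodule of
   finite length, then M has finite length: enlarging the part killed by an ideal I to the part
   killed by an ideal I' < I with I/I' = R/m adds a factor that embeds in the part killed by m. If E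
   is injective and the part killed by some m is not of finite length, it contains an infinite direct
   sum of copies of R/m; shifting the summands and fixing a complement extends to an injective
   endomorphism of E that is not surjective. So a co-Hopfian E has finite length, and a Hopfian
   injective module is co-Hopfian because injective endomorphisms have left inverses. For finite
   cogeneration, split envelopes of simple submodules off E as long as possible; conversely, in the
   envelope of a simple module S the part killed by a maximal ideal is S or 0. *)

theory Submission
  imports Defs
begin

section \<open>Submodules and homomorphisms\<close>

text \<open>Quotients are never formed. A simple factor H'/H appears as a covering pair of
  submodules, R/m as the rule that multiplication by an element outside m can be undone on whatever
  m kills, and a homomorphism defined on a sum of submodules as a relation, its graph. In place of
  the filtration by powers of the Jacobson radical, which rests on its nilpotence, a minimal ideal
  is taken among those whose killed part has finite length. The obstacle in the co-Hopfian case is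
  that the independent sum U and a complement K found by Zorn's lemma need not fill E: K + U is only
  essential in E. So injectivity of the extended shift, and the element that it misses, must be
  derived from essentiality and cannot be read off from coordinates. Finite length is asked of some
  submodule containing the killed part so that a greedy choice can continue from any submodule of
  finite length, without checking that it stays inside the killed part.\<close>

context module
begin

lemma submodule_iff:
  "submodule H R M \<longleftrightarrow> H \<subseteq> carrier M \<and> \<zero>\<^bsub>M\<^esub> \<in> H \<and> (\<forall>x\<in>H. \<forall>y\<in>H. x \<oplus>\<^bsub>M\<^esub> y \<in> H) \<and>
     (\<forall>r\<in>carrier R. \<forall>x\<in>H. r \<odot>\<^bsub>M\<^esub> x \<in> H)" (is "_ \<longleftrightarrow> ?rhs")
proof
  assume H: "submodule H R M"
  obtain x where "x \<in> H" using submoduleE(2)[OF H] by blast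
  hence "\<zero>\<^bsub>M\<^esub> \<in> H"
    using submoduleE(1)[OF H] submoduleE(4)[OF H R.zero_closed, of x] by auto
  with submoduleE[OF H] show ?rhs by blast
next
  assume H: ?rhs
  show "submodule H R M"
  proof (rule submoduleI)
    fix a assume a: "a \<in> H"
    have "\<ominus>\<^bsub>M\<^esub> a = (\<ominus> \<one>) \<odot>\<^bsub>M\<^esub> a" using a H by (subst smult_l_minus) auto
    with a H show "\<ominus>\<^bsub>M\<^esub> a \<in> H" by simp
  qed (use H in auto)
qed

lemma submoduleI_smult:
  assumes "H \<subseteq> carrier M" "\<zero>\<^bsub>M\<^esub> \<in> H" "\<And>x y. \<lbrakk>x \<in> H; y \<in> H\<rbrakk> \<Longrightarrow> x \<oplus>\<^bsub>M\<^esub> y \<in> H"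
    "\<And>r x. \<lbrakk>r \<in> carrier R; x \<in> H\<rbrakk> \<Longrightarrow> r \<odot>\<^bsub>M\<^esub> x \<in> H"
  shows "submodule H R M"
  using assms by (simp add: submodule_iff)

lemma submodule_in_carrier: "\<lbrakk>submodule H R M; x \<in> H\<rbrakk> \<Longrightarrow> x \<in> carrier M"
  using submoduleE(1) by blast

lemma submodule_zero: "submodule H R M \<Longrightarrow> \<zero>\<^bsub>M\<^esub> \<in> H"
  by (simp add: submodule_iff)

lemma submodule_add: "\<lbrakk>submodule H R M; x \<in> H; y \<in> H\<rbrakk> \<Longrightarrow> x \<oplus>\<^bsub>M\<^esub> y \<in> H"
  by (simp add: submodule_iff)

lemma submodule_smult: "\<lbrakk>submodule H R M; r \<in> carrier R; x \<in> H\<rbrakk> \<Longrightarrow> r \<odot>\<^bsub>M\<^esub> x \<in> H"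
  by (simp add: submodule_iff)

lemma submodule_add_cancel_right:
  assumes H: "submodule H R M" and "x \<oplus>\<^bsub>M\<^esub> y \<in> H" "y \<in> H" "x \<in> carrier M"
  shows "x \<in> H"
proof -
  have "y \<in> carrier M" using assms submodule_in_carrier by blast
  hence "x = (x \<oplus>\<^bsub>M\<^esub> y) \<oplus>\<^bsub>M\<^esub> \<ominus>\<^bsub>M\<^esub> y" using assms by (simp add: M.a_assoc M.r_neg)
  thus ?thesis using submodule_add[OF H assms(2) submoduleE(3)[OF H assms(3)]] by simp
qed

lemma submodule_add_cancel_left:
  assumes "submodule H R M" "y \<oplus>\<^bsub>M\<^esub> x \<in> H" "y \<in> H" "x \<in> carrier M"
  shows "x \<in> H"
  using submodule_add_cancel_right[of H x y] assms M.a_comm submodule_in_carrier by metis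

lemma submodule_diff: "\<lbrakk>submodule H R M; x \<in> H; y \<in> H\<rbrakk> \<Longrightarrow> x \<ominus>\<^bsub>M\<^esub> y \<in> H"
  unfolding a_minus_def using submodule_add submoduleE(3) by blast

lemma zero_submodule: "submodule {\<zero>\<^bsub>M\<^esub>} R M"
  by (auto simp: submodule_iff)

lemma submodule_Int: "\<lbrakk>submodule H R M; submodule K R M\<rbrakk> \<Longrightarrow> submodule (H \<inter> K) R M"
  by (auto simp: submodule_iff)

lemma module_restrict: "submodule H R M \<Longrightarrow> module R (M\<lparr>carrier := H\<rparr>)"
  using submodule.submodule_is_module module_axioms by blast

lemma submodule_restrict_iff:
  assumes "submodule K R M"
  shows "submodule H R (M\<lparr>carrier := K\<rparr>) \<longleftrightarrow> submodule H R M \<and> H \<subseteq> K"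
  using submoduleE(1)[OF assms]
  by (auto simp: submodule_iff module.submodule_iff[OF module_restrict[OF assms]])

lemma submodule_Union_mono:
  fixes H :: "nat \<Rightarrow> _"
  assumes H: "\<And>n. submodule (H n) R M" and mono: "\<And>n. H n \<subseteq> H (Suc n)"
  shows "submodule (\<Union>n. H n) R M"
proof -
  have add: "x \<oplus>\<^bsub>M\<^esub> y \<in> (\<Union>n. H n)" if "x \<in> H i" "y \<in> H j" for x y i j
  proof -
    have "x \<in> H (max i j)" "y \<in> H (max i j)"
      using that lift_Suc_mono_le[of H, OF mono] by (meson max.cobounded1 max.cobounded2 subsetD)+
    thus ?thesis using submodule_add[OF H] by blast
  qed
  show ?thesis
  proof (rule submoduleI_smult)
    show "r \<odot>\<^bsub>M\<^esub> x \<in> (\<Union>n. H n)" if "r \<in> carrier R" "x \<in> (\<Union>n. H n)" for r x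
      using submodule_smult[OF H] that by blast
  qed (use submoduleE(1)[OF H] submodule_zero[OF H] add in auto)
qed

text \<open>Multiplies x by 1 = sr + (1 - sr). When 1 - sr kills x, this exhibits x as a multiple of
  rx: the action of an inverse of r modulo a maximal ideal.\<close>

lemma smult_one_minus:
  assumes "s \<in> carrier R" "r \<in> carrier R" "x \<in> carrier M"
  shows "x = s \<odot>\<^bsub>M\<^esub> (r \<odot>\<^bsub>M\<^esub> x) \<oplus>\<^bsub>M\<^esub> (\<one> \<ominus> s \<otimes> r) \<odot>\<^bsub>M\<^esub> x"
proof -
  have "s \<otimes> r \<oplus> (\<one> \<ominus> s \<otimes> r) = \<one>" using assms by algebra
  hence "x = (s \<otimes> r \<oplus> (\<one> \<ominus> s \<otimes> r)) \<odot>\<^bsub>M\<^esub> x" using assms by simp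
  also have "\<dots> = (s \<otimes> r) \<odot>\<^bsub>M\<^esub> x \<oplus>\<^bsub>M\<^esub> (\<one> \<ominus> s \<otimes> r) \<odot>\<^bsub>M\<^esub> x"
    by (rule smult_l_distr) (use assms in auto)
  finally show ?thesis using assms by (simp add: smult_assoc1)
qed

lemma submodule_sum:
  assumes H: "submodule H R M" and K: "submodule K R M"
  shows "submodule {h \<oplus>\<^bsub>M\<^esub> k | h k. h \<in> H \<and> k \<in> K} R M" (is "submodule ?A R M")
    and "H \<subseteq> {h \<oplus>\<^bsub>M\<^esub> k | h k. h \<in> H \<and> k \<in> K}"
    and "K \<subseteq> {h \<oplus>\<^bsub>M\<^esub> k | h k. h \<in> H \<and> k \<in> K}"
proof -
  note c = submodule_in_carrier[OF H] submodule_in_carrier[OF K]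
  show sub: "H \<subseteq> ?A"
  proof
    fix h assume "h \<in> H"
    moreover have "h = h \<oplus>\<^bsub>M\<^esub> \<zero>\<^bsub>M\<^esub>" using c(1)[OF \<open>h \<in> H\<close>] by simp
    ultimately show "h \<in> ?A" using submodule_zero[OF K] by blast
  qed
  show "K \<subseteq> ?A"
  proof
    fix k assume "k \<in> K"
    moreover have "k = \<zero>\<^bsub>M\<^esub> \<oplus>\<^bsub>M\<^esub> k" using c(2)[OF \<open>k \<in> K\<close>] by simp
    ultimately show "k \<in> ?A" using submodule_zero[OF H] by blast
  qed
  show "submodule ?A R M"
  proof (rule submoduleI_smult)
    show "?A \<subseteq> carrier M" using c by auto
    show "\<zero>\<^bsub>M\<^esub> \<in> ?A" using sub submodule_zero[OF H] by (rule subsetD)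
  next
    fix u v assume "u \<in> ?A" "v \<in> ?A"
    then obtain a b a' b' where w: "a \<in> H" "b \<in> K" "u = a \<oplus>\<^bsub>M\<^esub> b" "a' \<in> H" "b' \<in> K" "v = a' \<oplus>\<^bsub>M\<^esub> b'"
      by blast
    have "u \<oplus>\<^bsub>M\<^esub> v = (a \<oplus>\<^bsub>M\<^esub> a') \<oplus>\<^bsub>M\<^esub> (b \<oplus>\<^bsub>M\<^esub> b')" using w c by (simp add: M.a_ac)
    thus "u \<oplus>\<^bsub>M\<^esub> v \<in> ?A" using submodule_add[OF H w(1,4)] submodule_add[OF K w(2,5)] by blast
  next
    fix r u assume r: "r \<in> carrier R" and "u \<in> ?A"
    then obtain a b where w: "a \<in> H" "b \<in> K" "u = a \<oplus>\<^bsub>M\<^esub> b" by blast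
    have "r \<odot>\<^bsub>M\<^esub> u = r \<odot>\<^bsub>M\<^esub> a \<oplus>\<^bsub>M\<^esub> r \<odot>\<^bsub>M\<^esub> b" using w c r by (simp add: smult_r_distr)
    thus "r \<odot>\<^bsub>M\<^esub> u \<in> ?A" using submodule_smult[OF H r w(1)] submodule_smult[OF K r w(2)] by blast
  qed
qed

lemma submodule_cyclic:
  assumes x: "x \<in> carrier M"
  shows "submodule {r \<odot>\<^bsub>M\<^esub> x | r. r \<in> carrier R} R M" (is "submodule ?A R M")
    and "x \<in> {r \<odot>\<^bsub>M\<^esub> x | r. r \<in> carrier R}"
proof -
  show "submodule ?A R M"
  proof (rule submoduleI_smult)
    show "?A \<subseteq> carrier M" using x by auto
    have "\<zero>\<^bsub>M\<^esub> = \<zero> \<odot>\<^bsub>M\<^esub> x" using x by simp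
    thus "\<zero>\<^bsub>M\<^esub> \<in> ?A" by blast
  next
    fix u v assume "u \<in> ?A" "v \<in> ?A"
    then obtain r s where w: "r \<in> carrier R" "u = r \<odot>\<^bsub>M\<^esub> x" "s \<in> carrier R" "v = s \<odot>\<^bsub>M\<^esub> x" by blast
    hence "u \<oplus>\<^bsub>M\<^esub> v = (r \<oplus> s) \<odot>\<^bsub>M\<^esub> x" using x by (simp add: smult_l_distr)
    thus "u \<oplus>\<^bsub>M\<^esub> v \<in> ?A" using w by blast
  next
    fix s u assume s: "s \<in> carrier R" and "u \<in> ?A"
    then obtain r where w: "r \<in> carrier R" "u = r \<odot>\<^bsub>M\<^esub> x" by blast
    hence "s \<odot>\<^bsub>M\<^esub> u = (s \<otimes> r) \<odot>\<^bsub>M\<^esub> x" using x s by (simp add: smult_assoc1)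
    thus "s \<odot>\<^bsub>M\<^esub> u \<in> ?A" using w s by blast
  qed
  have "x = \<one> \<odot>\<^bsub>M\<^esub> x" using x by simp
  thus "x \<in> ?A" by blast
qed

lemma submodule_adjoin:
  assumes H: "submodule H R M" and x: "x \<in> carrier M"
  shows "submodule {h \<oplus>\<^bsub>M\<^esub> r \<odot>\<^bsub>M\<^esub> x | h r. h \<in> H \<and> r \<in> carrier R} R M"
    and "H \<subseteq> {h \<oplus>\<^bsub>M\<^esub> r \<odot>\<^bsub>M\<^esub> x | h r. h \<in> H \<and> r \<in> carrier R}"
    and "x \<in> {h \<oplus>\<^bsub>M\<^esub> r \<odot>\<^bsub>M\<^esub> x | h r. h \<in> H \<and> r \<in> carrier R}"
proof -
  have "{h \<oplus>\<^bsub>M\<^esub> r \<odot>\<^bsub>M\<^esub> x | h r. h \<in> H \<and> r \<in> carrier R} =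
      {h \<oplus>\<^bsub>M\<^esub> k | h k. h \<in> H \<and> k \<in> {r \<odot>\<^bsub>M\<^esub> x | r. r \<in> carrier R}}" by blast
  thus "submodule {h \<oplus>\<^bsub>M\<^esub> r \<odot>\<^bsub>M\<^esub> x | h r. h \<in> H \<and> r \<in> carrier R} R M"
    "H \<subseteq> {h \<oplus>\<^bsub>M\<^esub> r \<odot>\<^bsub>M\<^esub> x | h r. h \<in> H \<and> r \<in> carrier R}"
    "x \<in> {h \<oplus>\<^bsub>M\<^esub> r \<odot>\<^bsub>M\<^esub> x | h r. h \<in> H \<and> r \<in> carrier R}"
    using submodule_sum[OF H submodule_cyclic(1)[OF x]] submodule_cyclic(2)[OF x] by auto
qed

text \<open>Zorn's lemma, with maximality stated elementwise: adjoining any x outside K hits T. If T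
  consists of the nonzero elements of a submodule, K is a relative complement and the sum of the two
  is essential. If T = {v}, the class of v lies in every nonzero submodule of the quotient by
  K.\<close>

lemma maximal_avoiding_submodule:
  assumes H: "submodule H R M" "H \<inter> T = {}"
  obtains K where "submodule K R M" "H \<subseteq> K" "K \<inter> T = {}"
    "\<And>x. \<lbrakk>x \<in> carrier M; x \<notin> K\<rbrakk> \<Longrightarrow> \<exists>k\<in>K. \<exists>r\<in>carrier R. k \<oplus>\<^bsub>M\<^esub> r \<odot>\<^bsub>M\<^esub> x \<in> T"
proof -
  let ?F = "{K. submodule K R M \<and> H \<subseteq> K \<and> K \<inter> T = {}}"
  have "\<exists>K\<in>?F. \<forall>X\<in>?F. K \<subseteq> X \<longrightarrow> X = K"
  proof (rule subset_Zorn_nonempty)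
    show "?F \<noteq> {}" using H by blast
    fix C assume C: "C \<noteq> {}" "subset.chain ?F C"
    hence gd: "\<And>X. X \<in> C \<Longrightarrow> X \<in> ?F" and
      ch: "\<And>X Y. X \<in> C \<Longrightarrow> Y \<in> C \<Longrightarrow> X \<subseteq> Y \<or> Y \<subseteq> X"
      by (auto simp: subset_chain_def)
    have add: "x \<oplus>\<^bsub>M\<^esub> y \<in> \<Union>C" if "x \<in> X" "X \<in> C" "y \<in> Y" "Y \<in> C" for x y X Y
      using ch[OF that(2,4)] that gd submodule_add by (metis (no_types, lifting) Union_iff mem_Collect_eq subsetD)
    have "submodule (\<Union>C) R M"
    proof (rule submoduleI_smult)
      show "\<Union>C \<subseteq> carrier M" using gd submoduleE(1) by blast
      show "\<zero>\<^bsub>M\<^esub> \<in> \<Union>C" using gd C(1) submodule_zero by blast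
      show "r \<odot>\<^bsub>M\<^esub> x \<in> \<Union>C" if "r \<in> carrier R" "x \<in> \<Union>C" for r x
        using gd submodule_smult that by blast
    qed (use add in blast)
    thus "\<Union>C \<in> ?F" using gd C(1) by blast
  qed
  then obtain K where "K \<in> ?F" and max: "\<forall>X\<in>?F. K \<subseteq> X \<longrightarrow> X = K" by (rule bexE)
  hence K: "submodule K R M" "H \<subseteq> K" "K \<inter> T = {}" by simp_all
  have "\<exists>k\<in>K. \<exists>r\<in>carrier R. k \<oplus>\<^bsub>M\<^esub> r \<odot>\<^bsub>M\<^esub> x \<in> T" if x: "x \<in> carrier M" "x \<notin> K" for x
  proof (rule ccontr)
    assume *: "\<not> ?thesis"
    note A = submodule_adjoin[OF K(1) x(1)]
    have "{h \<oplus>\<^bsub>M\<^esub> r \<odot>\<^bsub>M\<^esub> x | h r. h \<in> K \<and> r \<in> carrier R} = K"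
      by (rule max[rule_format]) (use A(1,2) * K(2) in auto)
    thus False using A(3) x(2) by simp
  qed
  with K that show ?thesis by blast
qed

end

section \<open>Homomorphisms: kernels, images, preimages, inverses\<close>

lemma module_hom_minus:
  assumes "module R M" "module R N" "h \<in> module_hom R M N" "x \<in> carrier M" "y \<in> carrier M"
  shows "h (x \<ominus>\<^bsub>M\<^esub> y) = h x \<ominus>\<^bsub>N\<^esub> h y"
proof -
  interpret M: module R M by fact
  interpret N: module R N by fact
  note hD = module_homD[OF assms(3)]
  have "h (\<ominus>\<^bsub>M\<^esub> y) = h ((\<ominus>\<^bsub>R\<^esub> \<one>\<^bsub>R\<^esub>) \<odot>\<^bsub>M\<^esub> y)" using assms by (simp add: M.smult_l_minus)
  also have "\<dots> = \<ominus>\<^bsub>N\<^esub> h y" using assms hD by (subst hD(3)) (auto simp: N.smult_l_minus)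
  finally show ?thesis using assms hD by (simp add: a_minus_def)
qed

lemma module_hom_inj_onI:
  assumes "module R M" "module R N" "h \<in> module_hom R M N"
    and ker: "\<And>x. \<lbrakk>x \<in> carrier M; h x = \<zero>\<^bsub>N\<^esub>\<rbrakk> \<Longrightarrow> x = \<zero>\<^bsub>M\<^esub>"
  shows "inj_on h (carrier M)"
proof
  interpret M: module R M by fact
  interpret N: module R N by fact
  fix x y assume xy: "x \<in> carrier M" "y \<in> carrier M" "h x = h y"
  have "h (x \<ominus>\<^bsub>M\<^esub> y) = \<zero>\<^bsub>N\<^esub>"
    using module_hom_minus[OF assms(1-3) xy(1,2)] xy module_homD(1)[OF assms(3)]
    by (simp add: a_minus_def N.M.r_neg)
  hence "x \<ominus>\<^bsub>M\<^esub> y = \<zero>\<^bsub>M\<^esub>" using ker xy by simp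
  thus "x = y" using xy M.M.minus_equality[of x "\<ominus>\<^bsub>M\<^esub> y"] by (simp add: a_minus_def)
qed

lemma module_hom_compose:
  assumes "f \<in> module_hom R L M" "g \<in> module_hom R M N"
  shows "(\<lambda>x. g (f x)) \<in> module_hom R L N"
  using module_homD[OF assms(1)] module_homD[OF assms(2)] by (intro module_homI) auto

lemma module_hom_id: "(\<lambda>x. x) \<in> module_hom R M M"
  by (intro module_homI) auto

lemma submodule_vimage:
  assumes "module R M" "module R N" and h: "h \<in> module_hom R M N" and K: "submodule K R N"
  shows "submodule {x \<in> carrier M. h x \<in> K} R M"
proof -
  interpret M: module R M by fact
  interpret N: module R N by fact
  show ?thesis
    using K module_homD[OF h] module_hom_zero[OF assms(1,2) h]
    unfolding M.submodule_iff N.submodule_iff by auto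
qed

lemma submodule_image:
  assumes "module R M" "module R N" and h: "h \<in> module_hom R M N" and H: "submodule H R M"
  shows "submodule (h ` H) R N"
proof -
  interpret M: module R M by fact
  interpret N: module R N by fact
  have c: "\<And>x. x \<in> H \<Longrightarrow> x \<in> carrier M" using M.submodule_in_carrier[OF H] .
  show ?thesis
    unfolding N.submodule_iff
  proof (intro conjI ballI)
    show "h ` H \<subseteq> carrier N" using c module_homD(1)[OF h] by blast
    show "\<zero>\<^bsub>N\<^esub> \<in> h ` H" using M.submodule_zero[OF H] module_hom_zero[OF assms(1,2) h] by force
    fix y assume "y \<in> h ` H"
    then obtain x where x: "x \<in> H" "y = h x" by blast
    show "y \<oplus>\<^bsub>N\<^esub> y' \<in> h ` H" if y': "y' \<in> h ` H" for y'
    proof -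
      obtain x' where "x' \<in> H" "y' = h x'" using y' by blast
      thus ?thesis using x c M.submodule_add[OF H, of x x'] by (auto simp flip: module_homD(2)[OF h])
    qed
  next
    fix r y assume "r \<in> carrier R" "y \<in> h ` H"
    then obtain x where "x \<in> H" "y = h x" by blast
    thus "r \<odot>\<^bsub>N\<^esub> y \<in> h ` H"
      using \<open>r \<in> carrier R\<close> c M.submodule_smult[OF H] by (auto simp flip: module_homD(3)[OF h])
  qed
qed

lemma submodule_kernel:
  assumes "module R M" "module R N" "h \<in> module_hom R M N"
  shows "submodule {x \<in> carrier M. h x = \<zero>\<^bsub>N\<^esub>} R M"
  using submodule_vimage[OF assms module.zero_submodule[OF assms(2)]] by simp

lemma module_iso_inv:
  assumes "module R M" "module R N" and h: "h \<in> module_iso R M N"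
  shows "inv_into (carrier M) h \<in> module_iso R N M"
proof -
  interpret M: module R M by fact
  have hom: "h \<in> module_hom R M N" and bij: "bij_betw h (carrier M) (carrier N)"
    using h by (auto simp: module_iso_def)
  let ?g = "inv_into (carrier M) h"
  have g: "?g y \<in> carrier M" "h (?g y) = y" if "y \<in> carrier N" for y
    using that bij by (auto simp: bij_betw_def inv_into_into f_inv_into_f)
  have gh: "?g (h x) = x" if "x \<in> carrier M" for x
    using that bij by (simp add: bij_betw_def)
  have "?g \<in> module_hom R N M"
  proof (rule module_homI)
    show "?g (x \<oplus>\<^bsub>N\<^esub> y) = ?g x \<oplus>\<^bsub>M\<^esub> ?g y" if "x \<in> carrier N" "y \<in> carrier N" for x y
      using gh[of "?g x \<oplus>\<^bsub>M\<^esub> ?g y"] g that by (simp add: module_homD(2)[OF hom])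
    show "?g (r \<odot>\<^bsub>N\<^esub> x) = r \<odot>\<^bsub>M\<^esub> ?g x" if "r \<in> carrier R" "x \<in> carrier N" for r x
      using gh[of "r \<odot>\<^bsub>M\<^esub> ?g x"] g that by (simp add: module_homD(3)[OF hom])
  qed (use g in auto)
  thus ?thesis using bij by (simp add: module_iso_def bij_betw_inv_into)
qed

section \<open>Chain conditions\<close>

lemma noetherian_moduleD:
  assumes "noetherian_module R M" "\<And>n. submodule (H n) R M" "\<And>n. H n \<subseteq> H (Suc n)"
  shows "\<exists>N. \<forall>n\<ge>N. H n = H N"
  using assms by (simp add: noetherian_module_def)

lemma artinian_moduleD:
  assumes "artinian_module R M" "\<And>n. submodule (H n) R M" "\<And>n. H (Suc n) \<subseteq> H n"
  shows "\<exists>N. \<forall>n\<ge>N. H n = H N"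
  using assms by (simp add: artinian_module_def)

lemma artinian_module_minimal:
  assumes art: "artinian_module R M" and F: "H \<in> F" "\<And>K. K \<in> F \<Longrightarrow> submodule K R M"
  obtains K where "K \<in> F" "\<And>L. \<lbrakk>L \<in> F; L \<subseteq> K\<rbrakk> \<Longrightarrow> L = K"
proof (rule ccontr)
  assume "\<not> thesis"
  hence step: "\<forall>K\<in>F. \<exists>L. L \<in> F \<and> L \<subset> K" using that by blast
  have "\<exists>N. \<forall>n. N n \<in> F \<and> N (Suc n) \<subset> N n"
    by (rule dependent_nat_choice) (use step F(1) in auto)
  then obtain N :: "nat \<Rightarrow> _" where N: "\<And>n. N n \<in> F" "\<And>n. N (Suc n) \<subset> N n" by blast
  then obtain k where "\<forall>n\<ge>k. N n = N k"
    using artinian_moduleD[OF art, of N] F(2) by (auto simp: less_imp_le)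
  thus False using N(2)[of k] by (metis le_SucI order_refl psubset_eq)
qed

section \<open>Iterates of an endomorphism\<close>

lemma funpow_module_hom:
  assumes "h \<in> module_hom R M M"
  shows "h ^^ n \<in> module_hom R M M"
proof (induction n)
  case (Suc n)
  thus ?case using module_hom_compose[OF Suc assms] by (simp add: comp_def)
qed (simp add: module_hom_id id_def)

text \<open>The kernels of the iterates ascend, so they are constant from some N on. By surjectivity
  an x killed by h is \<open>(h ^^ N) y\<close>; then y is killed by N+1 iterates, hence already by
  N, and x = 0.\<close>

lemma noetherian_imp_hopfian:
  assumes M: "module R M" and noeth: "noetherian_module R M"
  shows "hopfian R M"
  unfolding hopfian_def
proof (intro ballI impI)
  interpret module R M by fact
  fix h assume h: "h \<in> module_hom R M M" and surj: "h ` carrier M = carrier M"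
  let ?K = "\<lambda>n. {x \<in> carrier M. (h ^^ n) x = \<zero>\<^bsub>M\<^esub>}"
  have "?K n \<subseteq> ?K (Suc n)" for n
    using module_hom_zero[OF M M h] by auto
  moreover have "submodule (?K n) R M" for n
    by (rule submodule_kernel[OF M M funpow_module_hom[OF h]])
  ultimately have "\<exists>N. \<forall>n\<ge>N. ?K n = ?K N" by (intro noetherian_moduleD[OF noeth])
  then obtain N where N: "\<forall>n\<ge>N. ?K n = ?K N" ..
  have surjN: "(h ^^ n) ` carrier M = carrier M" for n
    by (induction n) (simp_all only: funpow.simps image_comp[symmetric] surj image_id id_apply image_ident)
  have "inj_on h (carrier M)"
  proof (rule module_hom_inj_onI[OF M M h])
    fix x assume x: "x \<in> carrier M" "h x = \<zero>\<^bsub>M\<^esub>"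
    obtain y where y: "y \<in> carrier M" "x = (h ^^ N) y" using surjN[of N] x by blast
    hence "y \<in> ?K (Suc N)" using x by simp
    moreover have "?K (Suc N) = ?K N" using N[rule_format, of "Suc N"] by simp
    ultimately have "y \<in> ?K N" by (simp only:)
    thus "x = \<zero>\<^bsub>M\<^esub>" using y by simp
  qed
  thus "h \<in> module_iso R M M" using h surj by (simp add: module_iso_def bij_betw_def)
qed

text \<open>Dual argument with the images of the iterates: \<open>(h ^^ N) x\<close> equals
  \<open>(h ^^ N) (h z)\<close> for some z, and the iterate, being injective, cancels.\<close>

lemma artinian_imp_cohopfian:
  assumes M: "module R M" and art: "artinian_module R M"
  shows "cohopfian R M"
  unfolding cohopfian_def
proof (intro ballI impI)
  interpret module R M by fact
  fix h assume h: "h \<in> module_hom R M M" and inj: "inj_on h (carrier M)"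
  let ?K = "\<lambda>n. (h ^^ n) ` carrier M"
  have "?K (Suc n) \<subseteq> ?K n" for n
    using module_homD(1)[OF h] by (auto simp: funpow_Suc_right simp del: funpow.simps)
  moreover have "submodule (?K n) R M" for n
    by (rule submodule_image[OF M M funpow_module_hom[OF h] carrier_is_submodule])
  ultimately have "\<exists>N. \<forall>n\<ge>N. ?K n = ?K N" by (intro artinian_moduleD[OF art])
  then obtain N where N: "\<forall>n\<ge>N. ?K n = ?K N" ..
  have injN: "inj_on (h ^^ n) (carrier M)" for n
  proof (induction n)
    case (Suc n)
    have "(h ^^ n) ` carrier M \<subseteq> carrier M" using module_homD(1)[OF funpow_module_hom[OF h]] by blast
    thus ?case using comp_inj_on[OF Suc, of h] inj by (simp add: inj_on_subset comp_def)
  qed simp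
  have "x \<in> h ` carrier M" if x: "x \<in> carrier M" for x
  proof -
    have "(h ^^ N) x \<in> ?K (Suc N)" using N[rule_format, of "Suc N"] x by simp
    then obtain z where z: "z \<in> carrier M" "(h ^^ N) x = (h ^^ N) (h z)"
      by (auto simp: funpow_Suc_right simp del: funpow.simps)
    hence "x = h z" using injN x module_homD(1)[OF h] by (auto dest: inj_onD)
    thus ?thesis using z by blast
  qed
  hence "h ` carrier M = carrier M" using module_homD(1)[OF h] by blast
  thus "h \<in> module_iso R M M" using h inj by (simp add: module_iso_def bij_betw_def)
qed

section \<open>Modules of finite length\<close>

text \<open>For submodules this expresses that H'/H is simple.\<close>

definition submodule_cover ::
    "('r, 'x) ring_scheme \<Rightarrow> ('r, 'm, 'y) module_scheme \<Rightarrow> 'm set \<Rightarrow> 'm set \<Rightarrow> bool"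
  where "submodule_cover R M H H' \<longleftrightarrow> H \<subset> H' \<and> \<not> (\<exists>K. submodule K R M \<and> H \<subset> K \<and> K \<subset> H')"

lemma composition_series_iff:
  "composition_series R M n c \<longleftrightarrow> c 0 = {\<zero>\<^bsub>M\<^esub>} \<and> c n = carrier M \<and>
     (\<forall>i\<le>n. submodule (c i) R M) \<and> (\<forall>i<n. submodule_cover R M (c i) (c (Suc i)))"
  by (simp add: composition_series_def submodule_cover_def)

lemma submodule_coverD:
  assumes "submodule_cover R M H H'" "submodule K R M" "H \<subseteq> K" "K \<subseteq> H'"
  shows "K = H \<or> K = H'"
  using assms unfolding submodule_cover_def by blast

section \<open>Extending and pulling back composition series; chain conditions\<close>

context module
begin

lemma submodule_cover_restrict:
  assumes "submodule L R M" "H' \<subseteq> L"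
  shows "submodule_cover R (M\<lparr>carrier := L\<rparr>) H H' \<longleftrightarrow> submodule_cover R M H H'"
  using assms(2) unfolding submodule_cover_def submodule_restrict_iff[OF assms(1)] by blast

lemma finite_length_zero: "finite_length_module R (M\<lparr>carrier := {\<zero>\<^bsub>M\<^esub>}\<rparr>)"
proof -
  have "composition_series R (M\<lparr>carrier := {\<zero>\<^bsub>M\<^esub>}\<rparr>) 0 (\<lambda>_. {\<zero>\<^bsub>M\<^esub>})"
    by (simp add: composition_series_iff submodule_restrict_iff zero_submodule)
  thus ?thesis unfolding finite_length_module_def by blast
qed

lemma finite_length_cover:
  assumes H: "submodule H R M" "finite_length_module R (M\<lparr>carrier := H\<rparr>)"
    and H': "submodule H' R M" and cover: "submodule_cover R M H H'"
  shows "finite_length_module R (M\<lparr>carrier := H'\<rparr>)"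
proof -
  obtain n c where c: "composition_series R (M\<lparr>carrier := H\<rparr>) n c"
    using H(2) unfolding finite_length_module_def by blast
  note c = c[unfolded composition_series_iff submodule_restrict_iff[OF H(1)], simplified]
  have HH': "H \<subseteq> H'" using cover by (auto simp: submodule_cover_def)
  have cov: "submodule_cover R M (c i) (c (Suc i))" if "i < n" for i
  proof -
    have "c (Suc i) \<subseteq> H" using c that by auto
    thus ?thesis using c that submodule_cover_restrict[OF H(1)] by blast
  qed
  have "composition_series R (M\<lparr>carrier := H'\<rparr>) (Suc n) (c(Suc n := H'))"
    unfolding composition_series_iff submodule_restrict_iff[OF H']
  proof (intro conjI allI impI)
    fix i assume i: "i < Suc n"
    have "c (Suc i) \<subseteq> H" if "i \<noteq> n" using c i that by simp
    hence sub: "(c(Suc n := H')) (Suc i) \<subseteq> H'" using HH' by auto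
    have "submodule_cover R M ((c(Suc n := H')) i) ((c(Suc n := H')) (Suc i))"
      using c cov[of i] cover i by (cases "i = n") auto
    thus "submodule_cover R (M\<lparr>carrier := H'\<rparr>) ((c(Suc n := H')) i) ((c(Suc n := H')) (Suc i))"
      using submodule_cover_restrict[OF H' sub] by simp
  qed (use c HH' H' in \<open>auto simp: le_Suc_eq\<close>)
  thus ?thesis unfolding finite_length_module_def by blast
qed

text \<open>The preimages of a composition series of N form a chain from the kernel of p up to M. As
  p may fail to be onto, consecutive preimages may coincide; if they do not, the larger one covers
  the smaller.\<close>

lemma finite_length_extension:
  assumes N: "module R N" and p: "p \<in> module_hom R M N" and len: "finite_length_module R N"
    and ker: "finite_length_module R (M\<lparr>carrier := {x \<in> carrier M. p x = \<zero>\<^bsub>N\<^esub>}\<rparr>)"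
  shows "finite_length_module R M"
proof -
  interpret N: module R N by fact
  note M = module_axioms
  obtain n c where "composition_series R N n c"
    using len unfolding finite_length_module_def by blast
  note c = this[unfolded composition_series_iff]
  define P where "P = (\<lambda>i. {x \<in> carrier M. p x \<in> c i})"
  have "finite_length_module R (M\<lparr>carrier := P i\<rparr>) \<and> submodule (P i) R M" if "i \<le> n" for i
    using that
  proof (induction i)
    case 0
    thus ?case using ker c submodule_kernel[OF M N p] by (simp add: P_def)
  next
    case (Suc i)
    hence ci: "submodule (c i) R N" "submodule (c (Suc i)) R N"
      and cov: "submodule_cover R N (c i) (c (Suc i))" using c by auto
    have P': "submodule (P (Suc i)) R M" unfolding P_def by (rule submodule_vimage[OF M N p ci(2)])
    have IH: "finite_length_module R (M\<lparr>carrier := P i\<rparr>)" "submodule (P i) R M" using Suc by auto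
    have sub: "P i \<subseteq> P (Suc i)" using cov by (auto simp: P_def submodule_cover_def)
    show ?case
    proof (cases "P i = P (Suc i)")
      case True
      thus ?thesis using IH by simp
    next
      case False
      have "P (Suc i) \<subseteq> K" if K: "submodule K R M" "P i \<subset> K" "K \<subseteq> P (Suc i)" for K
      proof
        fix z assume z: "z \<in> P (Suc i)"
        obtain k where k: "k \<in> K" "k \<notin> P i" using K(2) by blast
        have kM: "\<And>k. k \<in> K \<Longrightarrow> k \<in> carrier M" using submodule_in_carrier[OF K(1)] .
        have ciN: "\<And>a. a \<in> c i \<Longrightarrow> a \<in> carrier N" using N.submodule_in_carrier[OF ci(1)] .
        \<comment> \<open>This is c i + p K. It contains p k, which is outside c i, so the covering
          makes it all of c (Suc i). Hence z differs from some l in K by an element of P i, which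
          lies in K as well.\<close>
        let ?L = "{a \<oplus>\<^bsub>N\<^esub> y | a y. a \<in> c i \<and> y \<in> p ` K}"
        have pK: "submodule (p ` K) R N" by (rule submodule_image[OF M N p K(1)])
        have "?L \<subseteq> c (Suc i)"
        proof
          fix y assume "y \<in> ?L"
          then obtain a l where al: "y = a \<oplus>\<^bsub>N\<^esub> p l" "a \<in> c i" "l \<in> K" by blast
          hence "a \<in> c (Suc i)" "p l \<in> c (Suc i)"
            using K(3) cov by (auto simp: P_def submodule_cover_def)
          thus "y \<in> c (Suc i)" using N.submodule_add[OF ci(2)] al(1) by simp
        qed
        moreover have "p k \<in> ?L" using N.submodule_sum(3)[OF ci(1) pK] k by blast
        moreover have "p k \<notin> c i" using k kM by (auto simp: P_def)
        ultimately have "?L = c (Suc i)"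
          using submodule_coverD[OF cov N.submodule_sum(1,2)[OF ci(1) pK]] by blast
        hence "p z \<in> ?L" using z by (simp add: P_def)
        then obtain a l where al: "a \<in> c i" "l \<in> K" "p z = a \<oplus>\<^bsub>N\<^esub> p l" by blast
        have zM: "z \<in> carrier M" using z by (simp add: P_def)
        have "p (z \<ominus>\<^bsub>M\<^esub> l) = (a \<oplus>\<^bsub>N\<^esub> p l) \<ominus>\<^bsub>N\<^esub> p l"
          using module_hom_minus[OF M N p zM kM[OF al(2)]] al by simp
        also have "\<dots> = a"
          using al ciN kM module_homD(1)[OF p] by (simp add: a_minus_def N.M.a_assoc N.M.r_neg)
        finally have "z \<ominus>\<^bsub>M\<^esub> l \<in> P i" using al kM zM by (simp add: P_def)
        hence "z \<oplus>\<^bsub>M\<^esub> \<ominus>\<^bsub>M\<^esub> l \<in> K" using K(2) by (auto simp: a_minus_def)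
        thus "z \<in> K"
          using submodule_add_cancel_right[OF K(1) _ _ zM] submoduleE(3)[OF K(1) al(2)] by blast
      qed
      hence "submodule_cover R M (P i) (P (Suc i))"
        using sub False unfolding submodule_cover_def by blast
      thus ?thesis using finite_length_cover[OF IH(2,1) P'] P' by blast
    qed
  qed
  moreover have "P n = carrier M" using c module_homD(1)[OF p] by (auto simp: P_def)
  ultimately show ?thesis
    by (metis (mono_tags) finite_length_module_def le_refl partial_object.surjective partial_object.update_convs(1))
qed

text \<open>The modular law, in the form that makes both chain conditions pass up a composition series.\<close>

lemma submodule_Int_cover_eq:
  assumes sub: "submodule A R M" "submodule B R M" "submodule H R M" "submodule H' R M"
    and AB: "A \<subseteq> B" "A \<inter> H = B \<inter> H" and cover: "submodule_cover R M H H'" and nA: "\<not> A \<inter> H' \<subseteq> H"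
  shows "A \<inter> H' = B \<inter> H'"
proof
  show "B \<inter> H' \<subseteq> A \<inter> H'"
  proof
    fix w assume w: "w \<in> B \<inter> H'"
    obtain u where u: "u \<in> A" "u \<in> H'" "u \<notin> H" using nA by blast
    have wM: "w \<in> carrier M" and uM: "u \<in> carrier M"
      using w u submodule_in_carrier sub by blast+
    note adj = submodule_adjoin[OF sub(3) uM]
    have HH': "H \<subseteq> H'" using cover by (auto simp: submodule_cover_def)
    let ?L = "{h \<oplus>\<^bsub>M\<^esub> r \<odot>\<^bsub>M\<^esub> u | h r. h \<in> H \<and> r \<in> carrier R}"
    have "?L \<subseteq> H'"
      using HH' u submodule_add[OF sub(4)] submodule_smult[OF sub(4)] by blast
    hence "?L = H'" using submodule_coverD[OF cover adj(1,2)] adj(3) u by blast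
    then obtain h r where h: "h \<in> H" "r \<in> carrier R" "w = h \<oplus>\<^bsub>M\<^esub> r \<odot>\<^bsub>M\<^esub> u" using w by blast
    have ru: "r \<odot>\<^bsub>M\<^esub> u \<in> A" using submodule_smult[OF sub(1)] h u by blast
    hence "h \<in> B"
      using w h AB(1) submodule_add_cancel_right[OF sub(2)] submodule_in_carrier[OF sub(3)] by blast
    hence "h \<in> A" using h AB(2) by blast
    thus "w \<in> A \<inter> H'" using submodule_add[OF sub(1) _ ru] h w by blast
  qed
qed (use AB in blast)

text \<open>Along the composition series, the intersections of the chain with c i are shown to
  stabilize for each i. Once a term meets c (Suc i) outside c i, the modular law freezes the
  intersection with c (Suc i) from there on; if no late term does, that intersection is the one with
  c i.\<close>

lemma finite_length_imp_noetherian: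
  assumes "finite_length_module R M"
  shows "noetherian_module R M"
  unfolding noetherian_module_def
proof (intro allI impI, elim conjE)
  obtain n c where "composition_series R M n c"
    using assms unfolding finite_length_module_def by blast
  note c = this[unfolded composition_series_iff]
  fix H :: "nat \<Rightarrow> _"
  assume H: "\<forall>n. submodule (H n) R M" and "\<forall>n. H n \<subseteq> H (Suc n)"
  hence mono: "H i \<subseteq> H j" if "i \<le> j" for i j using lift_Suc_mono_le[of H] that by blast
  have "\<exists>k. \<forall>j\<ge>k. H j \<inter> c i = H k \<inter> c i" if "i \<le> n" for i
    using that
  proof (induction i)
    case 0
    thus ?case using c H submodule_zero by force
  next
    case (Suc i)
    then obtain k where k: "\<forall>j\<ge>k. H j \<inter> c i = H k \<inter> c i" by auto
    have sub: "submodule (c i) R M" "submodule (c (Suc i)) R M"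
      and cov: "submodule_cover R M (c i) (c (Suc i))" using c Suc by auto
    show ?case
    proof (cases "\<exists>l\<ge>k. \<not> H l \<inter> c (Suc i) \<subseteq> c i")
      case True
      then obtain l where l: "l \<ge> k" "\<not> H l \<inter> c (Suc i) \<subseteq> c i" by blast
      have "H l \<inter> c (Suc i) = H j \<inter> c (Suc i)" if "j \<ge> l" for j
        using submodule_Int_cover_eq[OF _ _ sub mono[OF that] _ cov l(2)] H k l(1) that
        by (metis order_trans)
      thus ?thesis by metis
    next
      case False
      hence "H j \<inter> c (Suc i) = H j \<inter> c i" if "j \<ge> k" for j
        using that cov by (auto simp: submodule_cover_def)
      thus ?thesis using k by (metis le_refl)
    qed
  qed
  from this[of n] show "\<exists>N. \<forall>m\<ge>N. H m = H N"
    using c H submoduleE(1) by (metis inf.absorb1 le_refl)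
qed

text \<open>As for ascending chains, with the cases exchanged: one term meeting c (Suc i) only
  inside c i forces this on all later terms; otherwise every term from k on leaves c i and the
  modular law applies from k.\<close>

lemma finite_length_imp_artinian:
  assumes "finite_length_module R M"
  shows "artinian_module R M"
  unfolding artinian_module_def
proof (intro allI impI, elim conjE)
  obtain n c where "composition_series R M n c"
    using assms unfolding finite_length_module_def by blast
  note c = this[unfolded composition_series_iff]
  fix H :: "nat \<Rightarrow> _"
  assume H: "\<forall>n. submodule (H n) R M" and "\<forall>n. H (Suc n) \<subseteq> H n"
  hence mono: "H j \<subseteq> H i" if "i \<le> j" for i j using lift_Suc_antimono_le[of H] that by blast
  have "\<exists>k. \<forall>j\<ge>k. H j \<inter> c i = H k \<inter> c i" if "i \<le> n" for i
    using that
  proof (induction i)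
    case 0
    thus ?case using c H submodule_zero by force
  next
    case (Suc i)
    then obtain k where k: "\<forall>j\<ge>k. H j \<inter> c i = H k \<inter> c i" by auto
    have sub: "submodule (c i) R M" "submodule (c (Suc i)) R M"
      and cov: "submodule_cover R M (c i) (c (Suc i))" using c Suc by auto
    show ?case
    proof (cases "\<exists>l\<ge>k. H l \<inter> c (Suc i) \<subseteq> c i")
      case True
      then obtain l where l: "l \<ge> k" "H l \<inter> c (Suc i) \<subseteq> c i" by blast
      have "H j \<inter> c (Suc i) = H j \<inter> c i" if "j \<ge> l" for j
        using that cov l(2) mono[OF that] by (auto simp: submodule_cover_def)
      thus ?thesis using k l(1) by (metis le_refl order_trans)
    next
      case False
      hence "H j \<inter> c (Suc i) = H k \<inter> c (Suc i)" if "j \<ge> k" for j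
        using submodule_Int_cover_eq[OF _ _ sub mono[OF that] _ cov] H k that by blast
      thus ?thesis by blast
    qed
  qed
  from this[of n] show "\<exists>N. \<forall>m\<ge>N. H m = H N"
    using c H submoduleE(1) by (metis inf.absorb1 le_refl)
qed

lemma submodule_span:
  assumes "S \<subseteq> carrier M"
  shows "submodule (submodule_span R M S) R M" and "S \<subseteq> submodule_span R M S"
    and "\<lbrakk>submodule H R M; S \<subseteq> H\<rbrakk> \<Longrightarrow> submodule_span R M S \<subseteq> H"
proof -
  show "submodule (submodule_span R M S) R M"
  proof (rule submoduleI_smult)
    show "submodule_span R M S \<subseteq> carrier M"
      using assms carrier_is_submodule unfolding submodule_span_def by blast
  qed (auto simp: submodule_span_def submodule_zero submodule_add submodule_smult)
qed (auto simp: submodule_span_def)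

text \<open>One generator per factor is enough: any z in c (Suc i) outside c i generates c (Suc i)
  together with c i, since nothing lies strictly between.\<close>

lemma finite_length_imp_finitely_generated:
  assumes "finite_length_module R M"
  shows "finitely_generated_module R M"
proof -
  obtain n c where "composition_series R M n c"
    using assms unfolding finite_length_module_def by blast
  note c = this[unfolded composition_series_iff]
  have "\<exists>S. finite S \<and> S \<subseteq> carrier M \<and> submodule_span R M S = c i" if "i \<le> n" for i
    using that
  proof (induction i)
    case 0
    have "submodule_span R M {} = {\<zero>\<^bsub>M\<^esub>}"
      using submodule_span[of "{}"] zero_submodule submodule_zero by blast
    thus ?case using c by auto
  next
    case (Suc i)
    then obtain S where S: "finite S" "S \<subseteq> carrier M" "submodule_span R M S = c i" by auto
    have sub: "submodule (c (Suc i)) R M"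
      and cov: "submodule_cover R M (c i) (c (Suc i))" using c Suc by auto
    obtain z where z: "z \<in> c (Suc i)" "z \<notin> c i" using cov by (auto simp: submodule_cover_def)
    let ?S = "insert z S"
    have S': "?S \<subseteq> carrier M" using S z submodule_in_carrier[OF sub] by blast
    note sp = submodule_span[OF S'] and sp0 = submodule_span[OF S(2)]
    have "c i \<subseteq> submodule_span R M ?S" using sp0(3)[OF sp(1)] sp(2) S(3) by blast
    moreover have "submodule_span R M ?S \<subseteq> c (Suc i)"
      using sp(3)[OF sub] z(1) cov sp0(2) S(3) by (auto simp: submodule_cover_def)
    ultimately have "submodule_span R M ?S = c (Suc i)"
      using submodule_coverD[OF cov sp(1)] sp(2) z by blast
    thus ?case using S(1) S' by blast
  qed
  from this[of n] show ?thesis using c unfolding finitely_generated_module_def by auto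
qed

end

section \<open>Modules over artinian rings\<close>

lemma (in cring) submodule_ring_module_imp_ideal:
  assumes "submodule I R (ring_module R)"
  shows "ideal I R"
proof -
  interpret RM: module R "ring_module R" by (rule module_ring_module)
  have I: "I \<subseteq> carrier R" "\<zero> \<in> I" "\<And>x y. \<lbrakk>x \<in> I; y \<in> I\<rbrakk> \<Longrightarrow> x \<oplus> y \<in> I"
    "\<And>r x. \<lbrakk>r \<in> carrier R; x \<in> I\<rbrakk> \<Longrightarrow> r \<otimes> x \<in> I"
    using assms unfolding RM.submodule_iff by auto
  have "\<ominus> x \<in> I" if "x \<in> I" for x
  proof -
    have "\<ominus> x = (\<ominus> \<one>) \<otimes> x" using that I(1) by (simp add: l_minus subset_iff)
    thus ?thesis using I(4)[OF _ that] by simp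
  qed
  hence sub: "subgroup I (add_monoid R)"
    using I by (intro subgroup.intro) (auto simp flip: a_inv_def)
  have "x \<otimes> a \<in> I \<and> a \<otimes> x \<in> I" if "a \<in> I" "x \<in> carrier R" for a x
    using I(4)[OF that(2,1)] m_comm[of a x] that I(1) by auto
  thus ?thesis by (intro idealI ring_axioms sub) auto
qed

lemma (in artinian_cring) artinian_ring_module: "artinian_module R (ring_module R)"
  unfolding artinian_module_def
  using descending_ideals_stabilize submodule_ring_module_imp_ideal by blast

text \<open>An ideal \<open>A \<noteq> R\<close> is maximal iff it satisfies this condition, which is the only property of
  maximal ideals that is needed; sets \<open>A\<close> that are not ideals and \<open>A = R\<close> do no harm.\<close>

definition invertible_outside :: "('r, 'x) ring_scheme \<Rightarrow> 'r set \<Rightarrow> bool"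
  where "invertible_outside R A \<longleftrightarrow> A \<subseteq> carrier R \<and>
    (\<forall>r \<in> carrier R - A. \<exists>s \<in> carrier R. \<one>\<^bsub>R\<^esub> \<ominus>\<^bsub>R\<^esub> s \<otimes>\<^bsub>R\<^esub> r \<in> A)"

text \<open>For an ideal A this is a copy of Hom(R/A, M); for a maximal ideal it is a vector space
  over the field R/A.\<close>

definition annihilated_part :: "('r, 'm, 'y) module_scheme \<Rightarrow> 'r set \<Rightarrow> 'm set"
  where "annihilated_part M A = {x \<in> carrier M. \<forall>a\<in>A. a \<odot>\<^bsub>M\<^esub> x = \<zero>\<^bsub>M\<^esub>}"

context module
begin

lemma submodule_annihilated_part:
  assumes "A \<subseteq> carrier R"
  shows "submodule (annihilated_part M A) R M"
proof (rule submoduleI_smult)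
  show "r \<odot>\<^bsub>M\<^esub> x \<in> annihilated_part M A" if "r \<in> carrier R" "x \<in> annihilated_part M A" for r x
  proof -
    have "a \<odot>\<^bsub>M\<^esub> (r \<odot>\<^bsub>M\<^esub> x) = \<zero>\<^bsub>M\<^esub>" if "a \<in> A" for a
    proof -
      have x: "x \<in> carrier M" "a \<odot>\<^bsub>M\<^esub> x = \<zero>\<^bsub>M\<^esub>" "a \<in> carrier R"
        using that assms \<open>x \<in> _\<close> by (auto simp: annihilated_part_def)
      have "a \<odot>\<^bsub>M\<^esub> (r \<odot>\<^bsub>M\<^esub> x) = r \<odot>\<^bsub>M\<^esub> (a \<odot>\<^bsub>M\<^esub> x)"
        using x \<open>r \<in> carrier R\<close> by (metis R.m_comm smult_assoc1)
      thus ?thesis using x \<open>r \<in> carrier R\<close> by simp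
    qed
    thus ?thesis using that by (simp add: annihilated_part_def)
  qed
qed (use assms in \<open>auto simp: annihilated_part_def smult_r_distr subset_iff\<close>)

text \<open>Multiplication by r outside A is invertible on the annihilated part, so x and rx
  generate the same submodule.\<close>

lemma annihilated_part_recover:
  assumes A: "invertible_outside R A" and x: "x \<in> annihilated_part M A"
    and r: "r \<in> carrier R" "r \<notin> A"
  obtains s where "s \<in> carrier R" "s \<odot>\<^bsub>M\<^esub> (r \<odot>\<^bsub>M\<^esub> x) = x"
proof -
  obtain s where s: "s \<in> carrier R" "\<one> \<ominus> s \<otimes> r \<in> A"
    using A r unfolding invertible_outside_def by blast
  moreover have "x \<in> carrier M" "(\<one> \<ominus> s \<otimes> r) \<odot>\<^bsub>M\<^esub> x = \<zero>\<^bsub>M\<^esub>"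
    using x s by (auto simp: annihilated_part_def)
  ultimately show ?thesis using that[of s] smult_one_minus[of s r x] r(1) by simp
qed

text \<open>Finds a socle element of M/H. Among the ideals K with K x0 not inside H take a minimal
  one, and let y = k x0 with k in K lie outside H. Then A is the annihilator of y modulo H.\<close>

lemma obtain_maximal_annihilator:
  assumes art: "artinian_module R (ring_module R)"
    and H: "submodule H R M" and x0: "x0 \<in> carrier M" "x0 \<notin> H"
  obtains y A where "y \<in> carrier M" "y \<notin> H" "invertible_outside R A" "\<And>a. a \<in> A \<Longrightarrow> a \<odot>\<^bsub>M\<^esub> y \<in> H"
proof -
  interpret RM: module R "ring_module R" by (rule R.module_ring_module)
  let ?F = "{K. submodule K R (ring_module R) \<and> (\<exists>k\<in>K. k \<odot>\<^bsub>M\<^esub> x0 \<notin> H)}"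
  have "carrier R \<in> ?F"
    using RM.carrier_is_submodule x0 by (auto intro!: bexI[of _ \<one>])
  then obtain K where K: "K \<in> ?F" and min: "\<And>L. \<lbrakk>L \<in> ?F; L \<subseteq> K\<rbrakk> \<Longrightarrow> L = K"
    using artinian_module_minimal[OF art, of "carrier R" ?F] by (metis (mono_tags, lifting) mem_Collect_eq)
  have subK: "submodule K R (ring_module R)" using K by blast
  obtain k where k: "k \<in> K" "k \<odot>\<^bsub>M\<^esub> x0 \<notin> H" using K by blast
  have kR: "k \<in> carrier R" using RM.submodule_in_carrier[OF subK k(1)] by simp
  define y where "y = k \<odot>\<^bsub>M\<^esub> x0"
  define A where "A = {r \<in> carrier R. r \<odot>\<^bsub>M\<^esub> y \<in> H}"
  have y: "y \<in> carrier M" "y \<notin> H" using k kR x0 by (auto simp: y_def)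
  have "\<exists>s\<in>carrier R. \<one> \<ominus> s \<otimes> r \<in> A" if r: "r \<in> carrier R" "r \<notin> A" for r
  proof -
    have rk: "r \<otimes> k \<in> carrier (ring_module R)" "r \<otimes> k \<in> K"
      using r kR RM.submodule_smult[OF subK r(1) k(1)] by auto
    \<comment> \<open>The multiple rk still moves x0 out of H, so by minimality K is generated by
      rk. Writing k = s(rk) gives even (1 - sr) y = 0.\<close>
    let ?L = "{s \<odot>\<^bsub>ring_module R\<^esub> (r \<otimes> k) | s. s \<in> carrier R}"
    have "(r \<otimes> k) \<odot>\<^bsub>M\<^esub> x0 \<notin> H" using r kR x0 by (simp add: A_def y_def smult_assoc1)
    hence "?L \<in> ?F" using RM.submodule_cyclic[OF rk(1)] by blast
    moreover have "?L \<subseteq> K" using RM.submodule_smult[OF subK _ rk(2)] by blast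
    ultimately have "k \<in> ?L" using min[of ?L] k(1) by blast
    then obtain s where s: "s \<in> carrier R" "k = s \<otimes> (r \<otimes> k)" by auto
    have "s \<odot>\<^bsub>M\<^esub> (r \<odot>\<^bsub>M\<^esub> y) = (s \<otimes> (r \<otimes> k)) \<odot>\<^bsub>M\<^esub> x0"
      using s(1) r kR x0 by (simp add: y_def smult_assoc1)
    also have "\<dots> = y" using s by (simp add: y_def)
    finally have "y \<oplus>\<^bsub>M\<^esub> (\<one> \<ominus> s \<otimes> r) \<odot>\<^bsub>M\<^esub> y = y"
      using smult_one_minus[OF s(1) r(1) y(1)] by simp
    hence "(\<one> \<ominus> s \<otimes> r) \<odot>\<^bsub>M\<^esub> y = \<zero>\<^bsub>M\<^esub>" using y(1) s(1) r(1) by simp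
    hence "\<one> \<ominus> s \<otimes> r \<in> A" using s(1) r(1) submodule_zero[OF H] by (simp add: A_def)
    thus ?thesis using s(1) by blast
  qed
  hence "invertible_outside R A" by (auto simp: invertible_outside_def A_def)
  with y that show ?thesis by (auto simp: A_def)
qed

text \<open>Among the ideals \<open>I\<close> whose annihilated part has finite length take a minimal one. If its
  annihilated part is not all of \<open>M\<close>, then \<open>A I \<noteq> I\<close> for some maximal ideal \<open>A\<close>, so \<open>I\<close> has an ideal
  \<open>I'\<close> with simple quotient, generated by the class of some \<open>v\<close>. Multiplication by \<open>v\<close> maps the
  annihilated part of \<open>I'\<close> to that of \<open>A\<close>, and its kernel is the annihilated part of \<open>I\<close>.\<close>

theorem finite_length_if_annihilated_parts:
  assumes art: "artinian_module R (ring_module R)"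
    and fin: "\<And>A. invertible_outside R A \<Longrightarrow>
      \<exists>H. submodule H R M \<and> finite_length_module R (M\<lparr>carrier := H\<rparr>) \<and> annihilated_part M A \<subseteq> H"
  shows "finite_length_module R M"
proof -
  interpret RM: module R "ring_module R" by (rule R.module_ring_module)
  let ?F = "{I. submodule I R (ring_module R) \<and>
    finite_length_module R (M\<lparr>carrier := annihilated_part M I\<rparr>)}"
  have "x = \<zero>\<^bsub>M\<^esub>" if "x \<in> annihilated_part M (carrier R)" for x
  proof -
    have "\<one> \<odot>\<^bsub>M\<^esub> x = \<zero>\<^bsub>M\<^esub>" "x \<in> carrier M" using that by (auto simp: annihilated_part_def)
    thus ?thesis by simp
  qed
  hence "annihilated_part M (carrier R) = {\<zero>\<^bsub>M\<^esub>}"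
    by (auto simp: annihilated_part_def)
  hence "carrier R \<in> ?F" using RM.carrier_is_submodule finite_length_zero by simp
  then obtain I where I: "I \<in> ?F" and min: "\<And>L. \<lbrakk>L \<in> ?F; L \<subseteq> I\<rbrakk> \<Longrightarrow> L = I"
    using artinian_module_minimal[OF art, of "carrier R" ?F] by (metis (mono_tags, lifting) mem_Collect_eq)
  have subI: "submodule I R (ring_module R)" using I by blast
  have IR: "\<And>i. i \<in> I \<Longrightarrow> i \<in> carrier R" using RM.submodule_in_carrier[OF subI] by simp
  have "annihilated_part M I = carrier M"
  proof (rule ccontr)
    assume "\<not> ?thesis"
    then obtain x0 where x0: "x0 \<in> carrier M" "x0 \<notin> annihilated_part M I"
      by (auto simp: annihilated_part_def)
    have annI: "submodule (annihilated_part M I) R M"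
      using IR by (intro submodule_annihilated_part) blast
    obtain y A where y: "y \<in> carrier M" "y \<notin> annihilated_part M I" and A: "invertible_outside R A"
      and Ay: "\<And>a. a \<in> A \<Longrightarrow> a \<odot>\<^bsub>M\<^esub> y \<in> annihilated_part M I"
      using obtain_maximal_annihilator[OF art annI x0] by blast
    have AR: "\<And>a. a \<in> A \<Longrightarrow> a \<in> carrier R" using A by (auto simp: invertible_outside_def)
    obtain v where v: "v \<in> I" "v \<odot>\<^bsub>M\<^esub> y \<noteq> \<zero>\<^bsub>M\<^esub>" using y by (auto simp: annihilated_part_def)
    \<comment> \<open>Since A y is killed by I, every product of an element of A and one of I kills
      y. So H0 contains A I while it misses v, and the K obtained below separates A I from
      v.\<close>
    define H0 where "H0 = {i \<in> I. i \<odot>\<^bsub>M\<^esub> y = \<zero>\<^bsub>M\<^esub>}"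
    have AH0: "a \<otimes> w \<in> H0" if "a \<in> A" "w \<in> I" for a w
    proof -
      have "(a \<otimes> w) \<odot>\<^bsub>M\<^esub> y = w \<odot>\<^bsub>M\<^esub> (a \<odot>\<^bsub>M\<^esub> y)"
        using that AR IR y(1) by (metis R.m_comm smult_assoc1)
      also have "\<dots> = \<zero>\<^bsub>M\<^esub>" using Ay[OF that(1)] that(2) by (simp add: annihilated_part_def)
      finally show ?thesis using RM.submodule_smult[OF subI] that AR by (simp add: H0_def)
    qed
    have "submodule H0 R (ring_module R)"
      using RM.submodule_zero[OF subI] RM.submodule_add[OF subI] RM.submodule_smult[OF subI] y(1) IR
      by (intro RM.submoduleI_smult) (auto simp: H0_def smult_l_distr smult_assoc1)
    moreover have "H0 \<inter> {v} = {}" using v by (auto simp: H0_def)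
    ultimately obtain K where K: "submodule K R (ring_module R)" "H0 \<subseteq> K" "K \<inter> {v} = {}"
      and max: "\<And>w. \<lbrakk>w \<in> carrier R; w \<notin> K\<rbrakk> \<Longrightarrow>
        \<exists>k\<in>K. \<exists>r\<in>carrier R. k \<oplus> r \<otimes> w \<in> {v}"
      by (rule RM.maximal_avoiding_submodule) (auto simp only: ring_module_simps)
    \<comment> \<open>K is maximal among the ideals of R, not among those inside I. The smaller
      ideal wanted is therefore \<open>K \<inter> I\<close>, proper in I because it misses
      v.\<close>
    define P where "P = annihilated_part M (K \<inter> I)"
    have subKI: "submodule (K \<inter> I) R (ring_module R)" by (rule RM.submodule_Int[OF K(1) subI])
    have subP: "submodule P R M"
      unfolding P_def using IR by (intro submodule_annihilated_part) blast
    have PM: "\<And>x. x \<in> P \<Longrightarrow> x \<in> carrier M" by (simp add: P_def annihilated_part_def)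
    have Pz: "\<And>x i. \<lbrakk>x \<in> P; i \<in> K; i \<in> I\<rbrakk> \<Longrightarrow> i \<odot>\<^bsub>M\<^esub> x = \<zero>\<^bsub>M\<^esub>"
      by (simp add: P_def annihilated_part_def)
    obtain H where H: "submodule H R M" "finite_length_module R (M\<lparr>carrier := H\<rparr>)"
      "annihilated_part M A \<subseteq> H" using fin[OF A] by blast
    have vR: "v \<in> carrier R" using IR v by blast
    have vx: "v \<odot>\<^bsub>M\<^esub> x \<in> H" if "x \<in> P" for x
    proof -
      have "a \<odot>\<^bsub>M\<^esub> (v \<odot>\<^bsub>M\<^esub> x) = \<zero>\<^bsub>M\<^esub>" if "a \<in> A" for a
      proof -
        have "a \<otimes> v \<in> K" "a \<otimes> v \<in> I" using AH0[OF that v(1)] K(2) by (auto simp: H0_def)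
        thus ?thesis using Pz[OF \<open>x \<in> P\<close>] AR[OF that] vR PM[OF \<open>x \<in> P\<close>] by (simp flip: smult_assoc1)
      qed
      thus ?thesis using H(3) vR PM[OF that] by (auto simp: annihilated_part_def)
    qed
    have ker: "{x \<in> P. v \<odot>\<^bsub>M\<^esub> x = \<zero>\<^bsub>M\<^esub>} = annihilated_part M I"
    proof (intro equalityI subsetI)
      fix x assume "x \<in> {x \<in> P. v \<odot>\<^bsub>M\<^esub> x = \<zero>\<^bsub>M\<^esub>}"
      hence x: "x \<in> P" "v \<odot>\<^bsub>M\<^esub> x = \<zero>\<^bsub>M\<^esub>" "x \<in> carrier M" using PM by auto
      have "w \<odot>\<^bsub>M\<^esub> x = \<zero>\<^bsub>M\<^esub>" if w: "w \<in> I" for w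
      proof (cases "w \<in> K")
        \<comment> \<open>Decompose w = s(rw) + (1 - sr)w. The element rw kills x because v and k
          do; the second summand lies in A I, hence in \<open>K \<inter> I\<close>.\<close>
        case False
        then obtain k r where kr: "k \<in> K" "r \<in> carrier R" "k \<oplus> r \<otimes> w = v"
          using max[OF IR[OF w]] by blast
        have rw: "r \<otimes> w \<in> I" using RM.submodule_smult[OF subI kr(2) w] by simp
        have kR: "k \<in> carrier R" using RM.submodule_in_carrier[OF K(1) kr(1)] by simp
        have kI: "k \<in> I"
          using RM.submodule_add_cancel_right[OF subI, of k "r \<otimes> w"] kr(3) rw kR v(1) by simp
        have "r \<notin> A"
        proof
          assume "r \<in> A"
          hence "r \<otimes> w \<in> K" using AH0 w K(2) by blast
          hence "v \<in> K" using RM.submodule_add[OF K(1) kr(1)] kr(3) by force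
          thus False using K(3) by blast
        qed
        then obtain s where s: "s \<in> carrier R" "\<one> \<ominus> s \<otimes> r \<in> A"
          using A kr(2) unfolding invertible_outside_def by blast
        have "(k \<oplus> r \<otimes> w) \<odot>\<^bsub>M\<^esub> x = \<zero>\<^bsub>M\<^esub>" using kr(3) x(2) by simp
        hence 1: "(r \<otimes> w) \<odot>\<^bsub>M\<^esub> x = \<zero>\<^bsub>M\<^esub>"
          using Pz[OF x(1) kr(1) kI] kR rw IR x(3) by (simp add: smult_l_distr)
        have "(\<one> \<ominus> s \<otimes> r) \<otimes> w \<in> K \<inter> I" using AH0[OF s(2) w] K(2) by (auto simp: H0_def)
        hence 2: "((\<one> \<ominus> s \<otimes> r) \<otimes> w) \<odot>\<^bsub>M\<^esub> x = \<zero>\<^bsub>M\<^esub>" using Pz[OF x(1)] by blast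
        have wR: "w \<in> carrier R" using IR w by blast
        have "w \<odot>\<^bsub>M\<^esub> x = (s \<otimes> (r \<otimes> w) \<oplus> (\<one> \<ominus> s \<otimes> r) \<otimes> w) \<odot>\<^bsub>M\<^esub> x"
          using RM.smult_one_minus[OF s(1) kr(2), of w] wR by simp
        also have "\<dots> = s \<odot>\<^bsub>M\<^esub> ((r \<otimes> w) \<odot>\<^bsub>M\<^esub> x) \<oplus>\<^bsub>M\<^esub> ((\<one> \<ominus> s \<otimes> r) \<otimes> w) \<odot>\<^bsub>M\<^esub> x"
          using s(1) kr(2) wR x(3) by (simp add: smult_l_distr smult_assoc1)
        finally show ?thesis using 1 2 s(1) by simp
      qed (use Pz x(1) w in blast)
      thus "x \<in> annihilated_part M I" using x(3) by (simp add: annihilated_part_def)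
    next
      fix x assume "x \<in> annihilated_part M I"
      thus "x \<in> {x \<in> P. v \<odot>\<^bsub>M\<^esub> x = \<zero>\<^bsub>M\<^esub>}" using v(1) by (auto simp: P_def annihilated_part_def)
    qed
    have "finite_length_module R (M\<lparr>carrier := P\<rparr>)"
    proof (rule module.finite_length_extension[OF module_restrict[OF subP] module_restrict[OF H(1)]])
      show "(\<lambda>x. v \<odot>\<^bsub>M\<^esub> x) \<in> module_hom R (M\<lparr>carrier := P\<rparr>) (M\<lparr>carrier := H\<rparr>)"
      proof (rule module_homI)
        show "v \<odot>\<^bsub>M\<^esub> (r \<odot>\<^bsub>M\<lparr>carrier := P\<rparr>\<^esub> x) = r \<odot>\<^bsub>M\<lparr>carrier := H\<rparr>\<^esub> (v \<odot>\<^bsub>M\<^esub> x)"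
          if "r \<in> carrier R" "x \<in> carrier (M\<lparr>carrier := P\<rparr>)" for r x
          using that PM vR by simp (metis R.m_comm smult_assoc1)
      qed (use vx PM vR in \<open>auto simp: smult_r_distr\<close>)
    qed (use H ker I in auto)
    hence "K \<inter> I \<in> ?F" using subKI by (simp add: P_def)
    hence "K \<inter> I = I" using min by blast
    thus False using v(1) K(3) by blast
  qed
  thus ?thesis using I by simp
qed

text \<open>Induction on the generators. On H + Rx a descending chain is controlled by its
  intersections with H and by the ideals of coefficients that x takes in it, as in Hilbert's basis
  theorem. \<open>stable\<close> ranges over all chains of submodules of M, so no chain has to be
  cut down to H first.\<close>

lemma finitely_generated_imp_artinian:
  assumes art: "artinian_module R (ring_module R)" and fg: "finitely_generated_module R M"
  shows "artinian_module R M"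
proof -
  interpret RM: module R "ring_module R" by (rule R.module_ring_module)
  obtain S where S: "finite S" "S \<subseteq> carrier M" "submodule_span R M S = carrier M"
    using fg unfolding finitely_generated_module_def by blast
  define stable where "stable = (\<lambda>H. \<forall>N :: nat \<Rightarrow> 'c set. (\<forall>n. submodule (N n) R M) \<longrightarrow>
    (\<forall>n. N (Suc n) \<subseteq> N n) \<longrightarrow> (\<exists>k. \<forall>j\<ge>k. N j \<inter> H = N k \<inter> H))"
  from S(1,2) have "\<exists>H. submodule H R M \<and> S \<subseteq> H \<and> stable H"
  proof (induction S rule: finite_induct)
    case empty
    have "stable {\<zero>\<^bsub>M\<^esub>}" using submodule_zero by (fastforce simp: stable_def)
    thus ?case using zero_submodule by blast
  next
    case (insert x S)
    then obtain H where H: "submodule H R M" "S \<subseteq> H" "stable H" by auto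
    have x: "x \<in> carrier M" using insert by simp
    let ?H' = "{h \<oplus>\<^bsub>M\<^esub> r \<odot>\<^bsub>M\<^esub> x | h r. h \<in> H \<and> r \<in> carrier R}"
    have HM: "\<And>h. h \<in> H \<Longrightarrow> h \<in> carrier M" using submodule_in_carrier[OF H(1)] .
    have "stable ?H'"
      unfolding stable_def
    proof (intro allI impI)
      fix N :: "nat \<Rightarrow> 'c set"
      assume N: "\<forall>n. submodule (N n) R M" and desc: "\<forall>n. N (Suc n) \<subseteq> N n"
      have mono: "N j \<subseteq> N i" if "i \<le> j" for i j using lift_Suc_antimono_le[of N] desc that by blast
      obtain k where k: "\<forall>j\<ge>k. N j \<inter> H = N k \<inter> H" using H(3) N desc unfolding stable_def by blast
      define I where "I = (\<lambda>n. {r \<in> carrier R. \<exists>h\<in>H. h \<oplus>\<^bsub>M\<^esub> r \<odot>\<^bsub>M\<^esub> x \<in> N n})"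
      have "submodule (I n) R (ring_module R)" for n
      proof (rule RM.submoduleI_smult)
        show "\<zero>\<^bsub>ring_module R\<^esub> \<in> I n"
          using submodule_zero[OF H(1)] submodule_zero[OF N[rule_format, of n]] x
          by (auto simp: I_def intro!: bexI[of _ "\<zero>\<^bsub>M\<^esub>"])
      next
        fix r s assume "r \<in> I n" "s \<in> I n"
        then obtain a b where w: "r \<in> carrier R" "a \<in> H" "a \<oplus>\<^bsub>M\<^esub> r \<odot>\<^bsub>M\<^esub> x \<in> N n"
          "s \<in> carrier R" "b \<in> H" "b \<oplus>\<^bsub>M\<^esub> s \<odot>\<^bsub>M\<^esub> x \<in> N n" by (auto simp: I_def)
        have "(a \<oplus>\<^bsub>M\<^esub> b) \<oplus>\<^bsub>M\<^esub> (r \<oplus> s) \<odot>\<^bsub>M\<^esub> x = (a \<oplus>\<^bsub>M\<^esub> r \<odot>\<^bsub>M\<^esub> x) \<oplus>\<^bsub>M\<^esub> (b \<oplus>\<^bsub>M\<^esub> s \<odot>\<^bsub>M\<^esub> x)"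
          using w HM x by (simp add: smult_l_distr M.a_ac)
        hence "(a \<oplus>\<^bsub>M\<^esub> b) \<oplus>\<^bsub>M\<^esub> (r \<oplus> s) \<odot>\<^bsub>M\<^esub> x \<in> N n"
          using submodule_add[OF N[rule_format] w(3,6)] by simp
        thus "r \<oplus>\<^bsub>ring_module R\<^esub> s \<in> I n"
          using w submodule_add[OF H(1) w(2,5)] by (auto simp: I_def)
      next
        fix r s assume r: "r \<in> carrier R" and "s \<in> I n"
        then obtain b where w: "s \<in> carrier R" "b \<in> H" "b \<oplus>\<^bsub>M\<^esub> s \<odot>\<^bsub>M\<^esub> x \<in> N n" by (auto simp: I_def)
        have "r \<odot>\<^bsub>M\<^esub> b \<oplus>\<^bsub>M\<^esub> (r \<otimes> s) \<odot>\<^bsub>M\<^esub> x = r \<odot>\<^bsub>M\<^esub> (b \<oplus>\<^bsub>M\<^esub> s \<odot>\<^bsub>M\<^esub> x)"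
          using w r HM x by (simp add: smult_r_distr smult_assoc1)
        hence "r \<odot>\<^bsub>M\<^esub> b \<oplus>\<^bsub>M\<^esub> (r \<otimes> s) \<odot>\<^bsub>M\<^esub> x \<in> N n"
          using submodule_smult[OF N[rule_format] r w(3)] by simp
        thus "r \<odot>\<^bsub>ring_module R\<^esub> s \<in> I n"
          using w r submodule_smult[OF H(1) r w(2)] by (auto simp: I_def)
      qed (auto simp: I_def)
      moreover have "I (Suc n) \<subseteq> I n" for n using desc by (auto simp: I_def)
      ultimately have "\<exists>l. \<forall>j\<ge>l. I j = I l" by (intro artinian_moduleD[OF art])
      then obtain l where l: "\<forall>j\<ge>l. I j = I l" ..
      define m where "m = max k l"
      have "N j \<inter> ?H' = N m \<inter> ?H'" if j: "j \<ge> m" for j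
      proof (intro equalityI subsetI)
        fix w assume wm: "w \<in> N m \<inter> ?H'"
        then obtain h r where w: "w \<in> N m" "w = h \<oplus>\<^bsub>M\<^esub> r \<odot>\<^bsub>M\<^esub> x" "h \<in> H" "r \<in> carrier R" by blast
        have "I j = I m"
          using l[rule_format, of j] l[rule_format, of m] j by (metis m_def max.bounded_iff order_refl)
        moreover have "r \<in> I m" using w by (auto simp: I_def)
        ultimately obtain h' where h': "h' \<in> H" "h' \<oplus>\<^bsub>M\<^esub> r \<odot>\<^bsub>M\<^esub> x \<in> N j" by (auto simp: I_def)
        \<comment> \<open>h' belongs to an element of N j with the same coefficient r. Subtracting
          it leaves a difference in H and N m, where the chain is already constant.\<close>
        have eq: "w = (h \<ominus>\<^bsub>M\<^esub> h') \<oplus>\<^bsub>M\<^esub> (h' \<oplus>\<^bsub>M\<^esub> r \<odot>\<^bsub>M\<^esub> x)"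
          using w h' HM x by (simp add: a_minus_def M.a_assoc M.r_neg1 M.r_neg2)
        have hh: "h \<ominus>\<^bsub>M\<^esub> h' \<in> H" using submodule_diff[OF H(1)] w h' by blast
        moreover have "h \<ominus>\<^bsub>M\<^esub> h' \<in> N m"
          using submodule_add_cancel_right[OF N[rule_format, of m]] eq w(1) h'(2) mono[OF j] HM[OF hh]
          by (metis subsetD)
        moreover have "N j \<inter> H = N m \<inter> H"
          using k[rule_format, of j] k[rule_format, of m] j by (metis m_def max.bounded_iff order_refl)
        ultimately have "h \<ominus>\<^bsub>M\<^esub> h' \<in> N j" by blast
        hence "w \<in> N j" using eq submodule_add[OF N[rule_format]] h'(2) by metis
        thus "w \<in> N j \<inter> ?H'" using wm by blast
      qed (use mono[OF j] in blast)
      thus "\<exists>k. \<forall>j\<ge>k. N j \<inter> ?H' = N k \<inter> ?H'" by blast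
    qed
    thus ?case using submodule_adjoin[OF H(1) x] H(2) by blast
  qed
  then obtain H where H: "submodule H R M" "S \<subseteq> H" "stable H" by blast
  have "H = carrier M" using submodule_span(3)[OF S(2) H(1,2)] S(3) submoduleE(1)[OF H(1)] by blast
  thus ?thesis
    using H(3) submoduleE(1) unfolding artinian_module_def stable_def by (metis inf.absorb1)
qed

end

section \<open>Hopfian and co-Hopfian injective modules\<close>

text \<open>A partial homomorphism is handed over as its graph. A linear relation whose only value
  at 0 is 0 is single-valued everywhere, so a map on a sum of submodules can be defined without
  choosing representatives.\<close>

lemma injective_extend_relation:
  assumes inj: "injective_module R E" and M: "module R M"
    and sub: "G \<subseteq> carrier M \<times> carrier E" and zero: "(\<zero>\<^bsub>M\<^esub>, \<zero>\<^bsub>E\<^esub>) \<in> G"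
    and add: "\<And>x y x' y'. \<lbrakk>(x, y) \<in> G; (x', y') \<in> G\<rbrakk> \<Longrightarrow> (x \<oplus>\<^bsub>M\<^esub> x', y \<oplus>\<^bsub>E\<^esub> y') \<in> G"
    and smult: "\<And>r x y. \<lbrakk>r \<in> carrier R; (x, y) \<in> G\<rbrakk> \<Longrightarrow> (r \<odot>\<^bsub>M\<^esub> x, r \<odot>\<^bsub>E\<^esub> y) \<in> G"
    and single: "\<And>y. (\<zero>\<^bsub>M\<^esub>, y) \<in> G \<Longrightarrow> y = \<zero>\<^bsub>E\<^esub>"
  obtains h where "h \<in> module_hom R M E" "\<And>x y. (x, y) \<in> G \<Longrightarrow> h x = y"
proof -
  have E: "module R E" using inj by (simp add: injective_module_def)
  interpret M: module R M by fact
  interpret E: module R E by fact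
  have unique: "y = y'" if xy: "(x, y) \<in> G" "(x, y') \<in> G" for x y y'
  proof -
    have c: "x \<in> carrier M" "y \<in> carrier E" "y' \<in> carrier E" using sub xy by auto
    have "(x \<oplus>\<^bsub>M\<^esub> (\<ominus>\<^bsub>R\<^esub> \<one>\<^bsub>R\<^esub>) \<odot>\<^bsub>M\<^esub> x, y \<oplus>\<^bsub>E\<^esub> (\<ominus>\<^bsub>R\<^esub> \<one>\<^bsub>R\<^esub>) \<odot>\<^bsub>E\<^esub> y') \<in> G"
      using add[OF xy(1) smult[OF _ xy(2)]] by simp
    hence "(\<zero>\<^bsub>M\<^esub>, y \<ominus>\<^bsub>E\<^esub> y') \<in> G"
      using c by (simp add: M.smult_l_minus E.smult_l_minus M.M.r_neg a_minus_def)
    hence "y \<ominus>\<^bsub>E\<^esub> y' = \<zero>\<^bsub>E\<^esub>" by (rule single)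
    thus ?thesis using c E.M.minus_equality[of y "\<ominus>\<^bsub>E\<^esub> y'"] by (simp add: a_minus_def)
  qed
  define B where "B = {x. \<exists>y. (x, y) \<in> G}"
  define g where "g = (\<lambda>x. THE y. (x, y) \<in> G)"
  have g: "g x = y" if "(x, y) \<in> G" for x y
    unfolding g_def using that unique by blast
  have gG: "(x, g x) \<in> G" if "x \<in> B" for x
    using that g unfolding B_def by blast
  have BM: "B \<subseteq> carrier M" using sub by (auto simp: B_def)
  have subB: "submodule B R M"
  proof (rule M.submoduleI_smult)
    show "\<zero>\<^bsub>M\<^esub> \<in> B" using zero unfolding B_def by blast
    show "x \<oplus>\<^bsub>M\<^esub> y \<in> B" if "x \<in> B" "y \<in> B" for x y
      using add[OF gG[OF that(1)] gG[OF that(2)]] unfolding B_def by blast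
    show "r \<odot>\<^bsub>M\<^esub> x \<in> B" if "r \<in> carrier R" "x \<in> B" for r x
      using smult[OF that(1) gG[OF that(2)]] unfolding B_def by blast
  qed (rule BM)
  have "g \<in> module_hom R (M\<lparr>carrier := B\<rparr>) E"
  proof (rule module_homI)
    show "g x \<in> carrier E" if "x \<in> carrier (M\<lparr>carrier := B\<rparr>)" for x
      using gG[of x] that sub by auto
    show "g (x \<oplus>\<^bsub>M\<lparr>carrier := B\<rparr>\<^esub> y) = g x \<oplus>\<^bsub>E\<^esub> g y"
      if "x \<in> carrier (M\<lparr>carrier := B\<rparr>)" "y \<in> carrier (M\<lparr>carrier := B\<rparr>)" for x y
      using g[OF add[OF gG gG]] that by simp
    show "g (r \<odot>\<^bsub>M\<lparr>carrier := B\<rparr>\<^esub> x) = r \<odot>\<^bsub>E\<^esub> g x"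
      if "r \<in> carrier R" "x \<in> carrier (M\<lparr>carrier := B\<rparr>)" for r x
      using g[OF smult[OF _ gG]] that by simp
  qed
  moreover have "(\<lambda>x. x) \<in> module_hom R (M\<lparr>carrier := B\<rparr>) M"
    using BM by (intro module_homI) auto
  ultimately obtain h where "h \<in> module_hom R M E" "\<forall>x\<in>B. h x = g x"
    using injective_module_extends[OF inj M.module_restrict[OF subB] M, of "\<lambda>x. x" g] by auto
  moreover have "x \<in> B" if "(x, y) \<in> G" for x y using that unfolding B_def by blast
  ultimately show ?thesis using that g by metis
qed

lemma injective_hopfian_imp_cohopfian:
  assumes inj: "injective_module R E" and hopf: "hopfian R E"
  shows "cohopfian R E"
  unfolding cohopfian_def
proof (intro ballI impI)
  have E: "module R E" using inj by (simp add: injective_module_def)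
  fix f assume f: "f \<in> module_hom R E E" "inj_on f (carrier E)"
  obtain h where h: "h \<in> module_hom R E E" "\<forall>x\<in>carrier E. h (f x) = x"
    using injective_module_extends[OF inj E E f module_hom_id] by blast
  have "h ` carrier E = carrier E"
    using module_homD(1)[OF f(1)] module_homD(1)[OF h(1)] h(2) by force
  hence "inj_on h (carrier E)"
    using hopf h(1) by (auto simp: hopfian_def module_iso_def bij_betw_def)
  \<comment> \<open>Both sides have the same image under the injective h: the left inverse of f is
    also a right inverse.\<close>
  hence "f (h y) = y" if "y \<in> carrier E" for y
    using that h(2) module_homD(1)[OF f(1)] module_homD(1)[OF h(1)] by (metis inj_onD)
  hence "f ` carrier E = carrier E"
    using module_homD(1)[OF f(1)] module_homD(1)[OF h(1)] by force
  thus "f \<in> module_iso R E E" using f by (simp add: module_iso_def bij_betw_def)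
qed

section \<open>Independent sequences in the part killed by a maximal ideal\<close>

context module
begin

text \<open>H + Rx is H or covers H: a larger intermediate submodule contains some h + rx outside H;
  then r is not in A, and x is recovered from rx.\<close>

lemma finite_length_adjoin:
  assumes H: "submodule H R M" "finite_length_module R (M\<lparr>carrier := H\<rparr>)"
    and A: "invertible_outside R A" and x: "x \<in> annihilated_part M A"
  shows "finite_length_module R (M\<lparr>carrier := {h \<oplus>\<^bsub>M\<^esub> r \<odot>\<^bsub>M\<^esub> x | h r. h \<in> H \<and> r \<in> carrier R}\<rparr>)"
    (is "finite_length_module R (M\<lparr>carrier := ?H'\<rparr>)")
proof -
  have xM: "x \<in> carrier M" using x by (simp add: annihilated_part_def)
  note adj = submodule_adjoin[OF H(1) xM]
  have "?H' \<subseteq> K" if K: "submodule K R M" "H \<subset> K" "K \<subseteq> ?H'" for K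
  proof -
    obtain z where z: "z \<in> K" "z \<notin> H" using K(2) by blast
    then obtain h r where hr: "h \<in> H" "r \<in> carrier R" "z = h \<oplus>\<^bsub>M\<^esub> r \<odot>\<^bsub>M\<^esub> x" using K(3) by blast
    have "r \<notin> A"
    proof
      assume "r \<in> A"
      hence "z = h" using hr x submodule_in_carrier[OF H(1)] by (simp add: annihilated_part_def)
      thus False using z hr by simp
    qed
    then obtain s where s: "s \<in> carrier R" "s \<odot>\<^bsub>M\<^esub> (r \<odot>\<^bsub>M\<^esub> x) = x"
      using annihilated_part_recover[OF A x hr(2)] by blast
    have "r \<odot>\<^bsub>M\<^esub> x \<in> K"
      using submodule_add_cancel_left[OF K(1), of h "r \<odot>\<^bsub>M\<^esub> x"] hr z K(2) xM by auto
    hence "x \<in> K" using submodule_smult[OF K(1) s(1)] s(2) by force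
    thus ?thesis
      using K(2) submodule_add[OF K(1)] submodule_smult[OF K(1)] by blast
  qed
  hence cov: "submodule_cover R M H ?H'" if "H \<noteq> ?H'"
    using adj(2) that unfolding submodule_cover_def by blast
  show ?thesis
  proof (cases "H = ?H'")
    case True
    thus ?thesis using H(2) by metis
  next
    case False
    show ?thesis by (rule finite_length_cover[OF H adj(1) cov[OF False]])
  qed
qed

text \<open>Greedy choice: X n is spanned by the first n elements and has finite length, so it
  cannot contain the whole annihilated part and a further element is available.\<close>

lemma annihilated_part_sequence:
  assumes A: "invertible_outside R A"
    and inf: "\<not> (\<exists>H. submodule H R M \<and> finite_length_module R (M\<lparr>carrier := H\<rparr>) \<and>
      annihilated_part M A \<subseteq> H)"
  shows "\<exists>X x. X 0 = {\<zero>\<^bsub>M\<^esub>} \<and>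
    (\<forall>n. X (Suc n) = {h \<oplus>\<^bsub>M\<^esub> r \<odot>\<^bsub>M\<^esub> x n | h r. h \<in> X n \<and> r \<in> carrier R}) \<and>
    (\<forall>n::nat. submodule (X n) R M \<and> x n \<in> annihilated_part M A \<and> x n \<notin> X n)"
proof -
  \<comment> \<open>The choice depends on the submodule alone, so X is plain recursion; finite
    length is proved afterwards.\<close>
  define pick where "pick = (\<lambda>H. SOME x. x \<in> annihilated_part M A \<and> x \<notin> H)"
  define X where "X = rec_nat {\<zero>\<^bsub>M\<^esub>} (\<lambda>_ H. {h \<oplus>\<^bsub>M\<^esub> r \<odot>\<^bsub>M\<^esub> pick H | h r. h \<in> H \<and> r \<in> carrier R})"
  have X: "X 0 = {\<zero>\<^bsub>M\<^esub>}"
    "\<And>n. X (Suc n) = {h \<oplus>\<^bsub>M\<^esub> r \<odot>\<^bsub>M\<^esub> pick (X n) | h r. h \<in> X n \<and> r \<in> carrier R}"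
    by (simp_all add: X_def)
  have pick: "pick H \<in> annihilated_part M A \<and> pick H \<notin> H"
    if "submodule H R M" "finite_length_module R (M\<lparr>carrier := H\<rparr>)" for H
    unfolding pick_def by (rule someI_ex) (use inf that in blast)
  have *: "submodule (X n) R M \<and> finite_length_module R (M\<lparr>carrier := X n\<rparr>)" for n
  proof (induction n)
    case 0
    thus ?case using X(1) zero_submodule finite_length_zero by simp
  next
    case (Suc n)
    have p: "pick (X n) \<in> annihilated_part M A" using pick Suc by blast
    hence pM: "pick (X n) \<in> carrier M" by (simp add: annihilated_part_def)
    show ?case
      unfolding X(2) using submodule_adjoin(1)[OF _ pM] finite_length_adjoin[OF _ _ A p] Suc by blast
  qed
  show ?thesis
    by (rule exI[of _ X], rule exI[of _ "\<lambda>n. pick (X n)"]) (use X * pick in simp)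
qed

text \<open>The submodules of the greedy sequence would ascend strictly forever.\<close>

lemma noetherian_imp_annihilated_part_finite_length:
  assumes noeth: "noetherian_module R M" and A: "invertible_outside R A"
  shows "\<exists>H. submodule H R M \<and> finite_length_module R (M\<lparr>carrier := H\<rparr>) \<and> annihilated_part M A \<subseteq> H"
proof (rule ccontr)
  assume inf: "\<not> ?thesis"
  obtain X x where *: "X 0 = {\<zero>\<^bsub>M\<^esub>} \<and>
    (\<forall>n. X (Suc n) = {h \<oplus>\<^bsub>M\<^esub> r \<odot>\<^bsub>M\<^esub> x n | h r. h \<in> X n \<and> r \<in> carrier R}) \<and>
    (\<forall>n::nat. submodule (X n) R M \<and> x n \<in> annihilated_part M A \<and> x n \<notin> X n)"
    using annihilated_part_sequence[OF A inf] by (elim exE) (rule that)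
  have X: "X 0 = {\<zero>\<^bsub>M\<^esub>}"
    "X (Suc n) = {h \<oplus>\<^bsub>M\<^esub> r \<odot>\<^bsub>M\<^esub> x n | h r. h \<in> X n \<and> r \<in> carrier R}"
    and sub: "submodule (X n) R M" and x: "x n \<in> annihilated_part M A" "x n \<notin> X n" for n
    using * by simp_all
  have xM: "x n \<in> carrier M" for n using x(1)[of n] by (simp add: annihilated_part_def)
  note adj = submodule_adjoin[OF sub xM, of n n for n, folded X(2)]
  obtain N where N: "\<forall>n\<ge>N. X n = X N" using noetherian_moduleD[OF noeth, of X] sub adj(2) by blast
  have "x N \<in> X N" using adj(3)[of N] N[rule_format, of "Suc N"] by simp
  thus False using x(2) by blast
qed

text \<open>If the annihilated part is too big, it contains an infinite independent sequence \<open>x\<close>. The shift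
  \<open>x n \<mapsto> x (Suc n)\<close>, together with the identity on a complement \<open>K\<close>, extends to an injective
  endomorphism of the module that does not reach \<open>x 0\<close>.\<close>

lemma cohopfian_imp_annihilated_part_finite_length:
  assumes inj: "injective_module R M" and cohopf: "cohopfian R M" and A: "invertible_outside R A"
  shows "\<exists>H. submodule H R M \<and> finite_length_module R (M\<lparr>carrier := H\<rparr>) \<and> annihilated_part M A \<subseteq> H"
proof (rule ccontr)
  assume inf: "\<not> ?thesis"
  obtain X x where *: "X 0 = {\<zero>\<^bsub>M\<^esub>} \<and>
    (\<forall>n. X (Suc n) = {h \<oplus>\<^bsub>M\<^esub> r \<odot>\<^bsub>M\<^esub> x n | h r. h \<in> X n \<and> r \<in> carrier R}) \<and>
    (\<forall>n::nat. submodule (X n) R M \<and> x n \<in> annihilated_part M A \<and> x n \<notin> X n)"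
    using annihilated_part_sequence[OF A inf] by (elim exE) (rule that)
  have X: "X 0 = {\<zero>\<^bsub>M\<^esub>}"
    "X (Suc n) = {h \<oplus>\<^bsub>M\<^esub> r \<odot>\<^bsub>M\<^esub> x n | h r. h \<in> X n \<and> r \<in> carrier R}"
    and sub: "submodule (X n) R M" and x: "x n \<in> annihilated_part M A" "x n \<notin> X n" for n
    using * by simp_all
  have xM: "x n \<in> carrier M" for n using x(1)[of n] by (simp add: annihilated_part_def)
  have xz: "r \<odot>\<^bsub>M\<^esub> x n = \<zero>\<^bsub>M\<^esub>" if "r \<in> A" for r n
    using x(1)[of n] that by (simp add: annihilated_part_def)
  note adj = submodule_adjoin[OF sub xM, of n n for n, folded X(2)]
  have mono: "X i \<subseteq> X j" if "i \<le> j" for i j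
    using lift_Suc_mono_le[of X, OF adj(2)] that by blast
  define U where "U = (\<Union>n. X n)"
  have subU: "submodule U R M" unfolding U_def by (rule submodule_Union_mono[of X]) (rule sub adj(2))+
  have xU: "x n \<in> U" for n using adj(3)[of n] by (auto simp: U_def)
  \<comment> \<open>K is a complement relative to U. Property \<open>max\<close> says that K + U is
    essential in M, though it may be smaller than M.\<close>
  have "{\<zero>\<^bsub>M\<^esub>} \<inter> (U - {\<zero>\<^bsub>M\<^esub>}) = {}" by blast
  then obtain K where K: "submodule K R M" "{\<zero>\<^bsub>M\<^esub>} \<subseteq> K" "K \<inter> (U - {\<zero>\<^bsub>M\<^esub>}) = {}"
    and max: "\<And>z. \<lbrakk>z \<in> carrier M; z \<notin> K\<rbrakk> \<Longrightarrow> \<exists>k\<in>K. \<exists>r\<in>carrier R. k \<oplus>\<^bsub>M\<^esub> r \<odot>\<^bsub>M\<^esub> z \<in> U - {\<zero>\<^bsub>M\<^esub>}"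
    by (rule maximal_avoiding_submodule[OF zero_submodule]) metis
  have KU: "k = \<zero>\<^bsub>M\<^esub>" if "k \<in> K" "k \<in> U" for k using that K(3) by blast
  have KM: "k \<in> carrier M" if "k \<in> K" for k using submodule_in_carrier[OF K(1) that] .

  define D where "D = (\<lambda>n. {k \<oplus>\<^bsub>M\<^esub> a | k a. k \<in> K \<and> a \<in> X n})"
  have subD: "submodule (D n) R M" for n unfolding D_def by (rule submodule_sum(1)[OF K(1) sub])
  have KD: "K \<subseteq> D n" and XD: "X n \<subseteq> D n" for n
    unfolding D_def using submodule_sum(2,3)[OF K(1) sub] by blast+
  have Dmono: "D n \<subseteq> D (Suc n)" for n using adj(2) unfolding D_def by blast
  have xD: "x n \<in> D (Suc n)" for n using XD adj(3) by blast
  have xnD: "x n \<notin> D n" for n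
  proof
    assume "x n \<in> D n"
    then obtain k a where ka: "x n = k \<oplus>\<^bsub>M\<^esub> a" "k \<in> K" "a \<in> X n" by (auto simp: D_def)
    have "k \<in> U"
      using submodule_add_cancel_right[OF subU, of k a] ka xU[of n] KM by (auto simp: U_def)
    hence "x n = a" using KU[OF ka(2)] ka(1) submodule_in_carrier[OF sub ka(3)] by simp
    thus False using x(2) ka by blast
  qed
  \<comment> \<open>The coefficient of x n modulo D n = K + X n is determined up to A, so the
    sequence is independent over K.\<close>
  have indep: "r \<in> A" if r: "r \<in> carrier R" "r \<odot>\<^bsub>M\<^esub> x n \<in> D n" for r n
  proof (rule ccontr)
    assume "r \<notin> A"
    then obtain s where "s \<in> carrier R" "s \<odot>\<^bsub>M\<^esub> (r \<odot>\<^bsub>M\<^esub> x n) = x n"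
      using annihilated_part_recover[OF A x(1) r(1)] by blast
    thus False using submodule_smult[OF subD _ r(2)] xnD[of n] by force
  qed

  \<comment> \<open>G n is the graph, with domain D n, of the map that fixes K and shifts the
    sequence. The equivalence \<open>Gz\<close> below yields both that it is single-valued and that
    it is injective.\<close>
  define G where "G = rec_nat {(k, k) | k. k \<in> K} (\<lambda>n g.
    {(a \<oplus>\<^bsub>M\<^esub> r \<odot>\<^bsub>M\<^esub> x n, b \<oplus>\<^bsub>M\<^esub> r \<odot>\<^bsub>M\<^esub> x (Suc n)) | a b r. (a, b) \<in> g \<and> r \<in> carrier R})"
  have G0: "G 0 = {(k, k) | k. k \<in> K}" and
    GSuc: "\<And>n. G (Suc n) =
      {(a \<oplus>\<^bsub>M\<^esub> r \<odot>\<^bsub>M\<^esub> x n, b \<oplus>\<^bsub>M\<^esub> r \<odot>\<^bsub>M\<^esub> x (Suc n)) | a b r. (a, b) \<in> G n \<and> r \<in> carrier R}"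
    by (simp_all add: G_def)
  have GD: "a \<in> D n \<and> b \<in> D (Suc n)" if "(a, b) \<in> G n" for a b n
    using that
  proof (induction n arbitrary: a b)
    case 0
    thus ?case using KD by (auto simp: G0)
  next
    case (Suc n)
    then obtain a' b' r where w: "(a', b') \<in> G n" "r \<in> carrier R"
      "a = a' \<oplus>\<^bsub>M\<^esub> r \<odot>\<^bsub>M\<^esub> x n" "b = b' \<oplus>\<^bsub>M\<^esub> r \<odot>\<^bsub>M\<^esub> x (Suc n)" unfolding GSuc by blast
    have "a' \<in> D (Suc n)" "b' \<in> D (Suc (Suc n))" using Suc.IH[OF w(1)] Dmono by blast+
    thus ?case
      using w submodule_add[OF subD] submodule_smult[OF subD w(2) xD] by simp
  qed
  have GM: "a \<in> carrier M" "b \<in> carrier M" if "(a, b) \<in> G n" for a b n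
    using GD[OF that] submodule_in_carrier[OF subD] by blast+
  have Gz: "a = \<zero>\<^bsub>M\<^esub> \<longleftrightarrow> b = \<zero>\<^bsub>M\<^esub>" if "(a, b) \<in> G n" for a b n
    using that
  proof (induction n arbitrary: a b)
    case 0
    thus ?case by (auto simp: G0)
  next
    case (Suc n)
    then obtain a' b' r where w: "(a', b') \<in> G n" "r \<in> carrier R"
      "a = a' \<oplus>\<^bsub>M\<^esub> r \<odot>\<^bsub>M\<^esub> x n" "b = b' \<oplus>\<^bsub>M\<^esub> r \<odot>\<^bsub>M\<^esub> x (Suc n)" unfolding GSuc by blast
    have "r \<in> A" if "a = \<zero>\<^bsub>M\<^esub> \<or> b = \<zero>\<^bsub>M\<^esub>"
    proof -
      have "a \<in> D n \<or> b \<in> D (Suc n)" using that submodule_zero[OF subD] by blast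
      hence "r \<odot>\<^bsub>M\<^esub> x n \<in> D n \<or> r \<odot>\<^bsub>M\<^esub> x (Suc n) \<in> D (Suc n)"
        using w GD[OF w(1)] submodule_add_cancel_left[OF subD] xM by (metis smult_closed)
      thus ?thesis using indep w(2) by blast
    qed
    moreover have "a = \<zero>\<^bsub>M\<^esub> \<longleftrightarrow> b = \<zero>\<^bsub>M\<^esub>" if "r \<in> A"
      using w xz[OF that] Suc.IH[OF w(1)] GM[OF w(1)] by simp
    ultimately show ?case by blast
  qed
  \<comment> \<open>Since x 0 lies in D (Suc n), independence makes the last term of b vanish at
    every stage; going down to stage 0 would put x 0 into K.\<close>
  have Gx0: "b \<noteq> x 0" if "(a, b) \<in> G n" for a b n
    using that
  proof (induction n arbitrary: a b)
    case 0
    thus ?case using KD xnD[of 0] by (auto simp: G0)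
  next
    case (Suc n)
    then obtain a' b' r where w: "(a', b') \<in> G n" "r \<in> carrier R"
      "b = b' \<oplus>\<^bsub>M\<^esub> r \<odot>\<^bsub>M\<^esub> x (Suc n)" unfolding GSuc by blast
    show ?case
    proof
      assume b: "b = x 0"
      have "x 0 \<in> D (Suc n)" using adj(3)[of 0] mono[of "Suc 0" "Suc n"] XD[of "Suc n"] by auto
      hence "r \<odot>\<^bsub>M\<^esub> x (Suc n) \<in> D (Suc n)"
        using w b GD[OF w(1)] submodule_add_cancel_left[OF subD] xM by (metis smult_closed)
      hence "r \<odot>\<^bsub>M\<^esub> x (Suc n) = \<zero>\<^bsub>M\<^esub>" by (intro xz indep[OF w(2)])
      hence "b = b'" using w(3) GM[OF w(1)] by simp
      thus False using b Suc.IH[OF w(1)] by simp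
    qed
  qed

  have Gadd: "(a \<oplus>\<^bsub>M\<^esub> a', b \<oplus>\<^bsub>M\<^esub> b') \<in> G n" if "(a, b) \<in> G n" "(a', b') \<in> G n" for a b a' b' n
    using that
  proof (induction n arbitrary: a b a' b')
    case 0
    thus ?case using submodule_add[OF K(1)] by (auto simp: G0)
  next
    case (Suc n)
    obtain c d r where w: "(c, d) \<in> G n" "r \<in> carrier R"
      "a = c \<oplus>\<^bsub>M\<^esub> r \<odot>\<^bsub>M\<^esub> x n" "b = d \<oplus>\<^bsub>M\<^esub> r \<odot>\<^bsub>M\<^esub> x (Suc n)"
      using Suc.prems(1) unfolding GSuc by blast
    obtain c' d' r' where w': "(c', d') \<in> G n" "r' \<in> carrier R"
      "a' = c' \<oplus>\<^bsub>M\<^esub> r' \<odot>\<^bsub>M\<^esub> x n" "b' = d' \<oplus>\<^bsub>M\<^esub> r' \<odot>\<^bsub>M\<^esub> x (Suc n)"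
      using Suc.prems(2) unfolding GSuc by blast
    have "a \<oplus>\<^bsub>M\<^esub> a' = (c \<oplus>\<^bsub>M\<^esub> c') \<oplus>\<^bsub>M\<^esub> (r \<oplus> r') \<odot>\<^bsub>M\<^esub> x n"
      "b \<oplus>\<^bsub>M\<^esub> b' = (d \<oplus>\<^bsub>M\<^esub> d') \<oplus>\<^bsub>M\<^esub> (r \<oplus> r') \<odot>\<^bsub>M\<^esub> x (Suc n)"
      using w w' GM[OF w(1)] GM[OF w'(1)] xM by (simp_all add: smult_l_distr M.a_ac)
    thus ?case unfolding GSuc using Suc.IH[OF w(1) w'(1)] w(2) w'(2) R.a_closed by blast
  qed
  have Gsmult: "(s \<odot>\<^bsub>M\<^esub> a, s \<odot>\<^bsub>M\<^esub> b) \<in> G n" if "s \<in> carrier R" "(a, b) \<in> G n" for s a b n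
    using that(2)
  proof (induction n arbitrary: a b)
    case 0
    thus ?case using submodule_smult[OF K(1) that(1)] by (auto simp: G0)
  next
    case (Suc n)
    obtain c d r where w: "(c, d) \<in> G n" "r \<in> carrier R"
      "a = c \<oplus>\<^bsub>M\<^esub> r \<odot>\<^bsub>M\<^esub> x n" "b = d \<oplus>\<^bsub>M\<^esub> r \<odot>\<^bsub>M\<^esub> x (Suc n)"
      using Suc.prems unfolding GSuc by blast
    have "s \<odot>\<^bsub>M\<^esub> a = s \<odot>\<^bsub>M\<^esub> c \<oplus>\<^bsub>M\<^esub> (s \<otimes> r) \<odot>\<^bsub>M\<^esub> x n"
      "s \<odot>\<^bsub>M\<^esub> b = s \<odot>\<^bsub>M\<^esub> d \<oplus>\<^bsub>M\<^esub> (s \<otimes> r) \<odot>\<^bsub>M\<^esub> x (Suc n)"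
      using w GM[OF w(1)] xM that(1) by (simp_all add: smult_r_distr smult_assoc1)
    thus ?case unfolding GSuc using Suc.IH[OF w(1)] w(2) that(1) R.m_closed by blast
  qed
  have GSucI: "(a \<oplus>\<^bsub>M\<^esub> r \<odot>\<^bsub>M\<^esub> x n, b \<oplus>\<^bsub>M\<^esub> r \<odot>\<^bsub>M\<^esub> x (Suc n)) \<in> G (Suc n)"
    if "(a, b) \<in> G n" "r \<in> carrier R" for a b r n
    using that unfolding GSuc by blast
  have "G n \<subseteq> G (Suc n)" for n
  proof
    fix p assume p: "p \<in> G n"
    obtain a b where ab: "p = (a, b)" by (cases p)
    thus "p \<in> G (Suc n)" using GSucI[of a b n \<zero>] p GM[of a b n] xM by simp
  qed
  hence Gmono: "G i \<subseteq> G j" if "i \<le> j" for i j using lift_Suc_mono_le[of G] that by blast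
  define GG where "GG = (\<Union>n. G n)"
  have zeroG: "(\<zero>\<^bsub>M\<^esub>, \<zero>\<^bsub>M\<^esub>) \<in> G 0" using submodule_zero[OF K(1)] by (simp add: G0)
  obtain \<sigma> where \<sigma>: "\<sigma> \<in> module_hom R M M" and \<sigma>G: "\<And>a b. (a, b) \<in> GG \<Longrightarrow> \<sigma> a = b"
  proof (rule injective_extend_relation[OF inj module_axioms, of GG])
    show "(a \<oplus>\<^bsub>M\<^esub> a', b \<oplus>\<^bsub>M\<^esub> b') \<in> GG" if ab: "(a, b) \<in> GG" "(a', b') \<in> GG" for a b a' b'
    proof -
      obtain i j where "(a, b) \<in> G i" "(a', b') \<in> G j" using ab by (auto simp: GG_def)
      hence "(a, b) \<in> G (max i j)" "(a', b') \<in> G (max i j)"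
        using Gmono[of i "max i j"] Gmono[of j "max i j"] by auto
      thus ?thesis using Gadd unfolding GG_def by blast
    qed
    show "(s \<odot>\<^bsub>M\<^esub> a, s \<odot>\<^bsub>M\<^esub> b) \<in> GG" if "s \<in> carrier R" "(a, b) \<in> GG" for s a b
      using that Gsmult unfolding GG_def by blast
    show "y = \<zero>\<^bsub>M\<^esub>" if "(\<zero>\<^bsub>M\<^esub>, y) \<in> GG" for y
      using that Gz by (auto simp: GG_def)
    show "GG \<subseteq> carrier M \<times> carrier M" using GM by (auto simp: GG_def)
    show "(\<zero>\<^bsub>M\<^esub>, \<zero>\<^bsub>M\<^esub>) \<in> GG" using zeroG by (auto simp: GG_def)
  qed blast
  have KG: "(k, k) \<in> GG" if "k \<in> K" for k
    using that G0 unfolding GG_def by blast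
  have "\<exists>b. (u, b) \<in> G n" if "u \<in> X n" for u n
    using that
  proof (induction n arbitrary: u)
    case 0
    hence "u = \<zero>\<^bsub>M\<^esub>" using X(1) by simp
    thus ?case using zeroG by blast
  next
    case (Suc n)
    then obtain a r where "a \<in> X n" "r \<in> carrier R" "u = a \<oplus>\<^bsub>M\<^esub> r \<odot>\<^bsub>M\<^esub> x n" unfolding X(2) by blast
    thus ?case using Suc.IH GSucI by blast
  qed
  hence UG: "(u, \<sigma> u) \<in> GG" if "u \<in> U" for u
    using that \<sigma>G unfolding U_def GG_def by blast
  have GGz: "a = \<zero>\<^bsub>M\<^esub>" if "(a, \<zero>\<^bsub>M\<^esub>) \<in> GG" for a
    using that Gz by (auto simp: GG_def)
  note hom = module_homD[OF \<sigma>]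
  \<comment> \<open>Both k and k + rz lie in the domain of the shift, hence so does their difference
    rz.\<close>
  have diff: "(r \<odot>\<^bsub>M\<^esub> z, \<sigma> (r \<odot>\<^bsub>M\<^esub> z)) \<in> GG"
    if kz: "k \<in> K" "r \<in> carrier R" "z \<in> carrier M" "k \<oplus>\<^bsub>M\<^esub> r \<odot>\<^bsub>M\<^esub> z \<in> U" for k r z
  proof -
    let ?u = "k \<oplus>\<^bsub>M\<^esub> r \<odot>\<^bsub>M\<^esub> z"
    have kk: "(\<ominus> \<one> \<odot>\<^bsub>M\<^esub> k, \<ominus> \<one> \<odot>\<^bsub>M\<^esub> k) \<in> GG" using KG submodule_smult[OF K(1)] kz by simp
    obtain i j where "(?u, \<sigma> ?u) \<in> G i" "(\<ominus> \<one> \<odot>\<^bsub>M\<^esub> k, \<ominus> \<one> \<odot>\<^bsub>M\<^esub> k) \<in> G j"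
      using UG[OF kz(4)] kk by (auto simp: GG_def)
    hence "(?u, \<sigma> ?u) \<in> G (max i j)" "(\<ominus> \<one> \<odot>\<^bsub>M\<^esub> k, \<ominus> \<one> \<odot>\<^bsub>M\<^esub> k) \<in> G (max i j)"
      using Gmono[of i "max i j"] Gmono[of j "max i j"] by auto
    hence "(?u \<oplus>\<^bsub>M\<^esub> \<ominus> \<one> \<odot>\<^bsub>M\<^esub> k, \<sigma> ?u \<oplus>\<^bsub>M\<^esub> \<ominus> \<one> \<odot>\<^bsub>M\<^esub> k) \<in> GG"
      using Gadd unfolding GG_def by blast
    moreover have "?u \<oplus>\<^bsub>M\<^esub> \<ominus> \<one> \<odot>\<^bsub>M\<^esub> k = r \<odot>\<^bsub>M\<^esub> z"
      using kz KM[OF kz(1)] by (simp add: smult_l_minus M.a_comm[of k] M.a_assoc M.r_neg)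
    ultimately show ?thesis using \<sigma>G by force
  qed
  have "inj_on \<sigma> (carrier M)"
  proof (rule module_hom_inj_onI[OF module_axioms module_axioms \<sigma>])
    fix z assume z: "z \<in> carrier M" "\<sigma> z = \<zero>\<^bsub>M\<^esub>"
    show "z = \<zero>\<^bsub>M\<^esub>"
    proof (cases "z \<in> K")
      case True
      thus ?thesis using \<sigma>G[OF KG[OF True]] z(2) by simp
    next
      case False
      then obtain k r where kr: "k \<in> K" "r \<in> carrier R" "k \<oplus>\<^bsub>M\<^esub> r \<odot>\<^bsub>M\<^esub> z \<in> U"
        "k \<oplus>\<^bsub>M\<^esub> r \<odot>\<^bsub>M\<^esub> z \<noteq> \<zero>\<^bsub>M\<^esub>" using max[OF z(1)] by blast
      have "r \<odot>\<^bsub>M\<^esub> z = \<zero>\<^bsub>M\<^esub>" using diff[OF kr(1,2) z(1) kr(3)] hom(3)[OF kr(2) z(1)] z(2) kr(2) GGz by simp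
      hence "k \<in> U" "k \<noteq> \<zero>\<^bsub>M\<^esub>" using kr(3,4) KM[OF kr(1)] by simp_all
      thus ?thesis using KU[OF kr(1)] by blast
    qed
  qed
  hence "\<sigma> \<in> module_iso R M M" using cohopf \<sigma> by (simp add: cohopfian_def)
  hence "x 0 \<in> \<sigma> ` carrier M" using xM by (simp add: module_iso_def bij_betw_def)
  then obtain y where y: "y \<in> carrier M" "\<sigma> y = x 0" by (metis imageE)
  \<comment> \<open>A preimage y of x 0 might lie outside K + U. But A kills x 0, hence kills y by
    injectivity, so y can be recovered from a multiple ry that lies in the domain of the
    shift.\<close>
  have "y = \<zero>\<^bsub>M\<^esub> \<or> (y, x 0) \<in> GG"
  proof (cases "y \<in> K")
    case True
    thus ?thesis using KG[OF True] \<sigma>G[OF KG[OF True]] y by simp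
  next
    case False
    then obtain k r where kr: "k \<in> K" "r \<in> carrier R" "k \<oplus>\<^bsub>M\<^esub> r \<odot>\<^bsub>M\<^esub> y \<in> U"
      "k \<oplus>\<^bsub>M\<^esub> r \<odot>\<^bsub>M\<^esub> y \<noteq> \<zero>\<^bsub>M\<^esub>" using max[OF y(1)] by blast
    have AR: "a \<in> carrier R" if "a \<in> A" for a using that A by (auto simp: invertible_outside_def)
    have "a \<odot>\<^bsub>M\<^esub> y = \<zero>\<^bsub>M\<^esub>" if a: "a \<in> A" for a
    proof (rule inj_onD[OF \<open>inj_on \<sigma> (carrier M)\<close>])
      show "\<sigma> (a \<odot>\<^bsub>M\<^esub> y) = \<sigma> \<zero>\<^bsub>M\<^esub>"
        using hom(3)[OF AR[OF a] y(1)] y(2) xz[OF a] module_hom_zero[OF module_axioms module_axioms \<sigma>]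
        by simp
    qed (use AR[OF a] y(1) in auto)
    hence "y \<in> annihilated_part M A" using y(1) by (simp add: annihilated_part_def)
    moreover have "r \<notin> A"
    proof
      assume "r \<in> A"
      hence "r \<odot>\<^bsub>M\<^esub> y = \<zero>\<^bsub>M\<^esub>" using calculation by (simp add: annihilated_part_def)
      thus False using kr(3,4) KU[OF kr(1)] KM[OF kr(1)] by simp
    qed
    ultimately obtain s where s: "s \<in> carrier R" "s \<odot>\<^bsub>M\<^esub> (r \<odot>\<^bsub>M\<^esub> y) = y"
      using annihilated_part_recover[OF A _ kr(2)] by blast
    have "(s \<odot>\<^bsub>M\<^esub> (r \<odot>\<^bsub>M\<^esub> y), s \<odot>\<^bsub>M\<^esub> \<sigma> (r \<odot>\<^bsub>M\<^esub> y)) \<in> GG"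
      using diff[OF kr(1,2) y(1) kr(3)] Gsmult[OF s(1)] unfolding GG_def by blast
    hence "(y, s \<odot>\<^bsub>M\<^esub> \<sigma> (r \<odot>\<^bsub>M\<^esub> y)) \<in> GG" using s(2) by simp
    hence "(y, x 0) \<in> GG" using \<sigma>G y(2) by metis
    thus ?thesis ..
  qed
  thus False
  proof
    assume "y = \<zero>\<^bsub>M\<^esub>"
    hence "x 0 = \<zero>\<^bsub>M\<^esub>" using y module_hom_zero[OF module_axioms module_axioms \<sigma>] by simp
    thus False using x(2)[of 0] X(1) by simp
  next
    assume "(y, x 0) \<in> GG"
    thus False using Gx0 by (auto simp: GG_def)
  qed
qed

end

section \<open>Finitely cogenerated modules\<close>

lemma carrier_direct_sum_module:
  assumes "finite I"
  shows "carrier (direct_sum_module I D) = (\<Pi>\<^sub>E i\<in>I. carrier (D i))"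
  using assms by (simp add: direct_sum_module_def)

lemma direct_sum_module_simps:
  "add (direct_sum_module I D) x y = (\<lambda>i\<in>I. x i \<oplus>\<^bsub>D i\<^esub> y i)"
  "smult (direct_sum_module I D) r x = (\<lambda>i\<in>I. r \<odot>\<^bsub>D i\<^esub> x i)"
  by (simp_all add: direct_sum_module_def)

text \<open>By essentiality a nonzero x killed by A has a nonzero multiple in the image of S. The
  multiplier is not in A, so x is recovered from the multiple and lies in that image too.\<close>

lemma finite_length_envelope_of_simple:
  assumes art: "artinian_module R (ring_module R)"
    and S: "simple_module R S" and env: "injective_envelope R S D g"
  shows "finite_length_module R D"
proof -
  have Smod: "module R S" and Dmod: "module R D" and g: "g \<in> module_hom R S D" "inj_on g (carrier S)"
    and ess: "essential_submodule R D (g ` carrier S)"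
    using env by (auto simp: injective_envelope_def injective_module_def)
  interpret S: module R S by fact
  interpret D: module R D by fact
  let ?H = "g ` carrier S"
  have subH: "submodule ?H R D" using ess by (simp add: essential_submodule_def)
  have g0: "g \<zero>\<^bsub>S\<^esub> = \<zero>\<^bsub>D\<^esub>" by (rule module_hom_zero[OF Smod Dmod g(1)])
  have "submodule_cover R D {\<zero>\<^bsub>D\<^esub>} ?H"
    unfolding submodule_cover_def
  proof (intro conjI notI)
    obtain x where "x \<in> carrier S" "x \<noteq> \<zero>\<^bsub>S\<^esub>"
      using S S.M.zero_closed unfolding simple_module_def by blast
    hence "g x \<noteq> \<zero>\<^bsub>D\<^esub>" using g(2) g0 by (metis S.M.zero_closed inj_onD)
    thus "{\<zero>\<^bsub>D\<^esub>} \<subset> ?H" using \<open>x \<in> carrier S\<close> D.submodule_zero[OF subH] by blast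
  next
    assume "\<exists>K. submodule K R D \<and> {\<zero>\<^bsub>D\<^esub>} \<subset> K \<and> K \<subset> ?H"
    then obtain K where K: "submodule K R D" "{\<zero>\<^bsub>D\<^esub>} \<subset> K" "K \<subset> ?H" by blast
    let ?L = "{x \<in> carrier S. g x \<in> K}"
    have "submodule ?L R S" by (rule submodule_vimage[OF Smod Dmod g(1) K(1)])
    hence "?L = {\<zero>\<^bsub>S\<^esub>} \<or> ?L = carrier S" using S by (simp add: simple_module_def)
    moreover have "K = g ` ?L" using K(3) by blast
    ultimately have "K = g ` {\<zero>\<^bsub>S\<^esub>} \<or> K = ?H" by (elim disjE) simp_all
    thus False using K g0 by auto
  qed
  hence fin: "finite_length_module R (D\<lparr>carrier := ?H\<rparr>)"
    using D.finite_length_cover[OF D.zero_submodule D.finite_length_zero subH] by blast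
  have "annihilated_part D A \<subseteq> ?H" if A: "invertible_outside R A" for A
  proof
    fix x assume x: "x \<in> annihilated_part D A"
    show "x \<in> ?H"
    proof (cases "x = \<zero>\<^bsub>D\<^esub>")
      case True
      thus ?thesis using D.submodule_zero[OF subH] by simp
    next
      case False
      have xD: "x \<in> carrier D" using x by (simp add: annihilated_part_def)
      let ?K = "{r \<odot>\<^bsub>D\<^esub> x | r. r \<in> carrier R}"
      have K: "submodule ?K R D" "x \<in> ?K" using D.submodule_cyclic[OF xD] by blast+
      hence "?H \<inter> ?K \<noteq> {\<zero>\<^bsub>D\<^esub>}" using ess False unfolding essential_submodule_def by blast
      moreover have "\<zero>\<^bsub>D\<^esub> \<in> ?H \<inter> ?K" using D.submodule_zero K(1) subH by blast
      ultimately obtain z where "z \<in> ?H" "z \<in> ?K" "z \<noteq> \<zero>\<^bsub>D\<^esub>" by auto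
      then obtain r where r: "r \<in> carrier R" "r \<odot>\<^bsub>D\<^esub> x \<in> ?H" "r \<odot>\<^bsub>D\<^esub> x \<noteq> \<zero>\<^bsub>D\<^esub>" by force
      have "r \<notin> A" using r(3) x by (auto simp: annihilated_part_def)
      then obtain s where "s \<in> carrier R" "s \<odot>\<^bsub>D\<^esub> (r \<odot>\<^bsub>D\<^esub> x) = x"
        using D.annihilated_part_recover[OF A x r(1)] by blast
      thus ?thesis using D.submodule_smult[OF subH _ r(2)] by metis
    qed
  qed
  thus ?thesis using D.finite_length_if_annihilated_parts[OF art] subH fin by blast
qed

lemma finitely_cogenerated_imp_finite_length:
  fixes R :: "('r, 'x) ring_scheme" and E :: "('r, 'e, 'y) module_scheme"
  assumes art: "artinian_module R (ring_module R)" and fc: "finitely_cogenerated R E"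
  shows "finite_length_module R E"
proof -
  obtain N :: "('r, ('r, 'e) envelope_carrier) module" and f n
    and S D :: "nat \<Rightarrow> ('r, ('r, 'e) envelope_carrier) module" and g
    where env: "injective_envelope R E N f"
    and D: "\<forall>i<n. simple_module R (S i) \<and> injective_envelope R (S i) (D i) (g i)"
    and iso: "module_iso R N (direct_sum_module {..<n} D) \<noteq> {}"
    using fc unfolding finitely_cogenerated_def by blast
  have E: "module R E" using env by (simp add: injective_envelope_def)
  interpret module R E by fact
  obtain \<phi> where \<phi>: "\<phi> \<in> module_hom R N (direct_sum_module {..<n} D)" "inj_on \<phi> (carrier N)"
    using iso by (auto simp: module_iso_def bij_betw_def)
  have f: "f \<in> module_hom R E N" "inj_on f (carrier E)"
    using env by (auto simp: injective_envelope_def)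
  note fD = module_homD[OF f(1)] and \<phi>D = module_homD[OF \<phi>(1)]
  have q: "\<phi> (f x) \<in> (\<Pi>\<^sub>E i\<in>{..<n}. carrier (D i))" if "x \<in> carrier E" for x
    using \<phi>D(1)[OF fD(1)[OF that]] by (simp add: carrier_direct_sum_module)
  have Dmod: "module R (D i)" and Dfin: "finite_length_module R (D i)" if "i < n" for i
  proof -
    have "simple_module R (S i)" "injective_envelope R (S i) (D i) (g i)" using D that by auto
    thus "module R (D i)" "finite_length_module R (D i)"
      using finite_length_envelope_of_simple[OF art]
      by (auto simp: injective_envelope_def injective_module_def)
  qed
  define p where "p = (\<lambda>i x. \<phi> (f x) i)"
  have p: "p i \<in> module_hom R E (D i)" if "i < n" for i
    using q that fD \<phi>D by (intro module_homI) (auto simp: p_def direct_sum_module_simps)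
  \<comment> \<open>Elements supported on the first k coordinates. The map p k embeds G (Suc k)
    modulo G k into D k, so finite length climbs from G 0 = 0 to G n = E.\<close>
  define G where "G = (\<lambda>k. {x \<in> carrier E. \<forall>i<n. k \<le> i \<longrightarrow> p i x = \<zero>\<^bsub>D i\<^esub>})"
  have subG: "submodule (G k) R E" for k
  proof (rule submoduleI_smult)
    show "\<zero>\<^bsub>E\<^esub> \<in> G k" using module_hom_zero[OF E Dmod p] by (simp add: G_def)
    show "x \<oplus>\<^bsub>E\<^esub> y \<in> G k" if "x \<in> G k" "y \<in> G k" for x y
      using that module_homD(2)[OF p] Dmod by (auto simp: G_def module_def abelian_group_def abelian_monoid.l_zero abelian_monoid.zero_closed)
    show "r \<odot>\<^bsub>E\<^esub> x \<in> G k" if "r \<in> carrier R" "x \<in> G k" for r x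
      using that module_homD(3)[OF p] module.smult_r_null[OF Dmod] by (auto simp: G_def)
  qed (auto simp: G_def)
  have "finite_length_module R (E\<lparr>carrier := G k\<rparr>)" if "k \<le> n" for k
    using that
  proof (induction k)
    case 0
    have "x = \<zero>\<^bsub>E\<^esub>" if "x \<in> G 0" for x
    proof -
      have x: "x \<in> carrier E" using that by (simp add: G_def)
      have "\<phi> (f x) i = \<phi> (f \<zero>\<^bsub>E\<^esub>) i" if "i \<in> {..<n}" for i
        using \<open>x \<in> G 0\<close> that module_hom_zero[OF E Dmod p, of i] by (simp add: G_def p_def)
      \<comment> \<open>Elements of the sum are undefined off the index set, so agreement in n
        coordinates is equality.\<close>
      hence "\<phi> (f x) = \<phi> (f \<zero>\<^bsub>E\<^esub>)" using PiE_ext[OF q q] x by blast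
      thus ?thesis using \<phi>(2) f(2) fD(1) x by (metis M.zero_closed inj_onD)
    qed
    hence "G 0 = {\<zero>\<^bsub>E\<^esub>}" using submodule_zero[OF subG] by blast
    thus ?case using finite_length_zero by simp
  next
    case (Suc k)
    have GE: "G (Suc k) \<subseteq> carrier E" by (auto simp: G_def)
    have "p k \<in> module_hom R (E\<lparr>carrier := G (Suc k)\<rparr>) (D k)"
      using module_homD[OF p, of k] GE Suc(2) by (intro module_homI) (simp_all add: subset_iff)
    moreover have "{x \<in> G (Suc k). p k x = \<zero>\<^bsub>D k\<^esub>} = G k"
      using Suc(2) by (auto simp: G_def Suc_le_eq le_less)
    ultimately show ?case
      using module.finite_length_extension[OF module_restrict[OF subG] Dmod _ Dfin, of k "p k" "Suc k"]
        Suc by simp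
  qed
  from this[of n] show ?thesis by (simp add: G_def)
qed

section \<open>Splitting injective modules into envelopes of simple submodules\<close>

lemma injective_module_retract:
  assumes inj: "injective_module R E" and D: "submodule D R E"
    and \<pi>: "\<pi> \<in> module_hom R E E" "\<pi> ` carrier E \<subseteq> D" "\<And>d. d \<in> D \<Longrightarrow> \<pi> d = d"
  shows "injective_module R (E\<lparr>carrier := D\<rparr>)"
  unfolding injective_module_def
proof (intro conjI allI impI)
  have E: "module R E" using inj by (simp add: injective_module_def)
  interpret module R E by fact
  show "module R (E\<lparr>carrier := D\<rparr>)" by (rule module_restrict[OF D])
  fix A B :: "('a, 'a) module" and f g
  assume *: "module R A \<and> module R B \<and> f \<in> module_hom R A B \<and> inj_on f (carrier A) \<and>
    g \<in> module_hom R A (E\<lparr>carrier := D\<rparr>)"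
  hence "g \<in> module_hom R A E"
    using submodule_in_carrier[OF D] by (auto simp: module_hom_def Pi_iff)
  then obtain h where h: "h \<in> module_hom R B E" "\<forall>x\<in>carrier A. h (f x) = g x"
    using * inj unfolding injective_module_def by blast
  have "(\<lambda>x. \<pi> (h x)) \<in> module_hom R B (E\<lparr>carrier := D\<rparr>)"
    using module_hom_compose[OF h(1) \<pi>(1)] \<pi>(2) module_homD(1)[OF h(1)] by (auto simp: module_hom_def)
  moreover have "\<forall>x\<in>carrier A. \<pi> (h (f x)) = g x"
    using h(2) \<pi>(3) * by (auto simp: module_hom_def Pi_iff)
  ultimately show "\<exists>h\<in>module_hom R B (E\<lparr>carrier := D\<rparr>). \<forall>x\<in>carrier A. h (f x) = g x"
    by (intro bexI[of _ "\<lambda>x. \<pi> (h x)"])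
qed

text \<open>Take \<open>C\<close> maximal with \<open>C \<inter> S = 0\<close> and then \<open>D \<supseteq> S\<close> maximal with \<open>D \<inter> C = 0\<close>. The projection of
  \<open>D + C\<close> onto \<open>D\<close> extends to \<open>\<pi>\<close>; its kernel is \<open>C\<close> by maximality of \<open>C\<close>, and its image still meets
  \<open>C\<close> trivially, so it is \<open>D\<close> by maximality of \<open>D\<close>.\<close>

lemma injective_module_splits:
  assumes inj: "injective_module R E" and S: "submodule S R E"
  obtains D \<pi> where "submodule D R E" "S \<subseteq> D" "\<pi> \<in> module_hom R E E" "\<pi> ` carrier E = D"
    "\<And>d. d \<in> D \<Longrightarrow> \<pi> d = d" "essential_submodule R (E\<lparr>carrier := D\<rparr>) S"
proof -
  have E: "module R E" using inj by (simp add: injective_module_def)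
  interpret module R E by fact
  have "{\<zero>\<^bsub>E\<^esub>} \<inter> (S - {\<zero>\<^bsub>E\<^esub>}) = {}" by blast
  then obtain C where C: "submodule C R E" "{\<zero>\<^bsub>E\<^esub>} \<subseteq> C" "C \<inter> (S - {\<zero>\<^bsub>E\<^esub>}) = {}"
    and maxC: "\<And>z. \<lbrakk>z \<in> carrier E; z \<notin> C\<rbrakk> \<Longrightarrow> \<exists>k\<in>C. \<exists>r\<in>carrier R. k \<oplus>\<^bsub>E\<^esub> r \<odot>\<^bsub>E\<^esub> z \<in> S - {\<zero>\<^bsub>E\<^esub>}"
    by (rule maximal_avoiding_submodule[OF zero_submodule]) metis
  have "S \<inter> (C - {\<zero>\<^bsub>E\<^esub>}) = {}" using C(3) by blast
  then obtain D where D: "submodule D R E" "S \<subseteq> D" "D \<inter> (C - {\<zero>\<^bsub>E\<^esub>}) = {}"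
    and maxD: "\<And>z. \<lbrakk>z \<in> carrier E; z \<notin> D\<rbrakk> \<Longrightarrow> \<exists>k\<in>D. \<exists>r\<in>carrier R. k \<oplus>\<^bsub>E\<^esub> r \<odot>\<^bsub>E\<^esub> z \<in> C - {\<zero>\<^bsub>E\<^esub>}"
    by (rule maximal_avoiding_submodule[OF S]) metis
  have CS: "x = \<zero>\<^bsub>E\<^esub>" if "x \<in> C" "x \<in> S" for x using that C(3) by blast
  have DC: "x = \<zero>\<^bsub>E\<^esub>" if "x \<in> D" "x \<in> C" for x using that D(3) by blast
  have CE: "c \<in> carrier E" if "c \<in> C" for c by (rule submodule_in_carrier[OF C(1) that])
  have DE: "d \<in> carrier E" if "d \<in> D" for d by (rule submodule_in_carrier[OF D(1) that])
  define G where "G = {(d \<oplus>\<^bsub>E\<^esub> c, d) | d c. d \<in> D \<and> c \<in> C}"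
  have GI: "(d \<oplus>\<^bsub>E\<^esub> c, d) \<in> G" if "d \<in> D" "c \<in> C" for d c using that by (auto simp: G_def)
  obtain \<pi> where \<pi>: "\<pi> \<in> module_hom R E E" and \<pi>G: "\<And>x y. (x, y) \<in> G \<Longrightarrow> \<pi> x = y"
  proof (rule injective_extend_relation[OF inj E, of G])
    show "G \<subseteq> carrier E \<times> carrier E" using CE DE by (auto simp: G_def)
    show "(\<zero>\<^bsub>E\<^esub>, \<zero>\<^bsub>E\<^esub>) \<in> G"
      using GI[OF submodule_zero[OF D(1)] submodule_zero[OF C(1)]] by simp
    show "(x \<oplus>\<^bsub>E\<^esub> x', y \<oplus>\<^bsub>E\<^esub> y') \<in> G" if xy: "(x, y) \<in> G" "(x', y') \<in> G" for x y x' y'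
    proof -
      obtain c c' where w: "c \<in> C" "x = y \<oplus>\<^bsub>E\<^esub> c" "y \<in> D" "c' \<in> C" "x' = y' \<oplus>\<^bsub>E\<^esub> c'" "y' \<in> D"
        using xy by (auto simp: G_def)
      hence "x \<oplus>\<^bsub>E\<^esub> x' = (y \<oplus>\<^bsub>E\<^esub> y') \<oplus>\<^bsub>E\<^esub> (c \<oplus>\<^bsub>E\<^esub> c')" using CE DE by (simp add: M.a_ac)
      thus ?thesis using GI[OF submodule_add[OF D(1) w(3,6)] submodule_add[OF C(1) w(1,4)]] by simp
    qed
    show "(r \<odot>\<^bsub>E\<^esub> x, r \<odot>\<^bsub>E\<^esub> y) \<in> G" if r: "r \<in> carrier R" and xy: "(x, y) \<in> G" for r x y
    proof -
      obtain c where w: "c \<in> C" "x = y \<oplus>\<^bsub>E\<^esub> c" "y \<in> D" using xy by (auto simp: G_def)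
      hence "r \<odot>\<^bsub>E\<^esub> x = r \<odot>\<^bsub>E\<^esub> y \<oplus>\<^bsub>E\<^esub> r \<odot>\<^bsub>E\<^esub> c" using CE DE r by (simp add: smult_r_distr)
      thus ?thesis using GI[OF submodule_smult[OF D(1) r w(3)] submodule_smult[OF C(1) r w(1)]] by simp
    qed
    show "y = \<zero>\<^bsub>E\<^esub>" if yG: "(\<zero>\<^bsub>E\<^esub>, y) \<in> G" for y
    proof -
      obtain c where w: "c \<in> C" "\<zero>\<^bsub>E\<^esub> = y \<oplus>\<^bsub>E\<^esub> c" "y \<in> D" using yG by (auto simp: G_def)
      have "y \<in> C"
        using submodule_add_cancel_right[OF C(1) _ w(1) DE[OF w(3)]] w(2) C(2) by auto
      thus ?thesis using DC w(3) by blast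
    qed
  qed blast
  note hom = module_homD[OF \<pi>]
  have \<pi>D: "\<pi> d = d" if "d \<in> D" for d
    using \<pi>G[OF GI[OF that submodule_zero[OF C(1)]]] DE[OF that] by simp
  have \<pi>C: "\<pi> c = \<zero>\<^bsub>E\<^esub>" if "c \<in> C" for c
    using \<pi>G[OF GI[OF submodule_zero[OF D(1)] that]] CE[OF that] by simp
  have im: "submodule (\<pi> ` carrier E) R E"
    by (rule submodule_image[OF E E \<pi> carrier_is_submodule])
  have imC: "y = \<zero>\<^bsub>E\<^esub>" if y: "y \<in> \<pi> ` carrier E" "y \<in> C" for y
  proof -
    obtain x where x: "x \<in> carrier E" "y = \<pi> x" using y(1) by blast
    show ?thesis
    proof (cases "x \<in> C")
      \<comment> \<open>Some nonzero s = c + rx lies in S. As \<pi> fixes s and kills c, s = ry lies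
        in C, against the choice of C.\<close>
      case False
      then obtain c r where cr: "c \<in> C" "r \<in> carrier R" "c \<oplus>\<^bsub>E\<^esub> r \<odot>\<^bsub>E\<^esub> x \<in> S"
        "c \<oplus>\<^bsub>E\<^esub> r \<odot>\<^bsub>E\<^esub> x \<noteq> \<zero>\<^bsub>E\<^esub>" using maxC[OF x(1)] by blast
      let ?s = "c \<oplus>\<^bsub>E\<^esub> r \<odot>\<^bsub>E\<^esub> x"
      have "\<pi> ?s = r \<odot>\<^bsub>E\<^esub> y"
        using x cr(2) CE[OF cr(1)] \<pi>C[OF cr(1)] hom by simp
      moreover have "\<pi> ?s = ?s" using \<pi>D cr(3) D(2) by blast
      ultimately have "?s \<in> C" using submodule_smult[OF C(1) cr(2) y(2)] by simp
      thus ?thesis using CS cr(3,4) by blast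
    qed (use x \<pi>C in blast)
  qed
  have "\<pi> ` carrier E \<subseteq> D"
  proof
    fix y assume y: "y \<in> \<pi> ` carrier E"
    show "y \<in> D"
    proof (rule ccontr)
      assume "y \<notin> D"
      then obtain d r where dr: "d \<in> D" "r \<in> carrier R" "d \<oplus>\<^bsub>E\<^esub> r \<odot>\<^bsub>E\<^esub> y \<in> C"
        "d \<oplus>\<^bsub>E\<^esub> r \<odot>\<^bsub>E\<^esub> y \<noteq> \<zero>\<^bsub>E\<^esub>" using maxD submodule_in_carrier[OF im y] by blast
      have "d \<in> \<pi> ` carrier E" using \<pi>D[OF dr(1)] DE[OF dr(1)] by (metis image_eqI)
      hence "d \<oplus>\<^bsub>E\<^esub> r \<odot>\<^bsub>E\<^esub> y \<in> \<pi> ` carrier E"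
        using submodule_add[OF im] submodule_smult[OF im dr(2) y] by blast
      thus False using imC dr(3,4) by blast
    qed
  qed
  moreover have "D \<subseteq> \<pi> ` carrier E" using \<pi>D DE by (metis image_eqI subsetI)
  ultimately have imD: "\<pi> ` carrier E = D" by blast
  \<comment> \<open>For a nonzero l in L, maximality of C gives c + rl in S, nonzero. This forces c
    into both D and C, so c = 0 and rl itself is the common element.\<close>
  have "essential_submodule R (E\<lparr>carrier := D\<rparr>) S"
    unfolding essential_submodule_def submodule_restrict_iff[OF D(1)]
  proof (intro conjI allI impI)
    fix L assume L: "(submodule L R E \<and> L \<subseteq> D) \<and> L \<noteq> {\<zero>\<^bsub>E\<lparr>carrier := D\<rparr>\<^esub>}"
    hence subL: "submodule L R E" by blast
    have "L \<noteq> {\<zero>\<^bsub>E\<^esub>}" using L by simp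
    then obtain l where l: "l \<in> L" "l \<noteq> \<zero>\<^bsub>E\<^esub>" using submodule_zero[OF subL] by blast
    hence "l \<notin> C" using DC L by blast
    then obtain c r where cr: "c \<in> C" "r \<in> carrier R" "c \<oplus>\<^bsub>E\<^esub> r \<odot>\<^bsub>E\<^esub> l \<in> S"
      "c \<oplus>\<^bsub>E\<^esub> r \<odot>\<^bsub>E\<^esub> l \<noteq> \<zero>\<^bsub>E\<^esub>" using maxC submodule_in_carrier[OF subL l(1)] by blast
    have rl: "r \<odot>\<^bsub>E\<^esub> l \<in> L" using submodule_smult[OF subL cr(2) l(1)] .
    hence "c \<in> D" using submodule_add_cancel_right[OF D(1) _ _ CE[OF cr(1)]] cr(3) D(2) L by blast
    hence "c = \<zero>\<^bsub>E\<^esub>" using DC cr(1) by blast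
    hence "r \<odot>\<^bsub>E\<^esub> l \<in> S" "r \<odot>\<^bsub>E\<^esub> l \<noteq> \<zero>\<^bsub>E\<^esub>"
      using cr submodule_in_carrier[OF subL rl] by simp_all
    thus "S \<inter> L \<noteq> {\<zero>\<^bsub>E\<lparr>carrier := D\<rparr>\<^esub>}" using rl by auto
  qed (use S D in auto)
  with D(1,2) \<pi> imD \<pi>D show ?thesis using that by blast
qed

text \<open>M is the internal direct sum of D and the kernel C of the idempotent \<pi>, with x -
  \<pi> x as the component in C. The new summand gets index n so that the earlier indices keep their
  meaning.\<close>

lemma direct_sum_Suc_iso:
  assumes M: "module R M" and D: "submodule D R M"
    and \<pi>: "\<pi> \<in> module_hom R M M" "\<pi> ` carrier M = D" "\<And>d. d \<in> D \<Longrightarrow> \<pi> d = d"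
    and C: "C = {x \<in> carrier M. \<pi> x = \<zero>\<^bsub>M\<^esub>}"
    and \<phi>: "\<phi> \<in> module_iso R (M\<lparr>carrier := C\<rparr>) (direct_sum_module {..<n} N)"
    and N: "N n = M\<lparr>carrier := D\<rparr>"
  shows "(\<lambda>x. \<lambda>i\<in>{..<Suc n}. if i = n then \<pi> x else \<phi> (x \<ominus>\<^bsub>M\<^esub> \<pi> x) i)
    \<in> module_iso R M (direct_sum_module {..<Suc n} N)" (is "?\<psi> \<in> _")
proof -
  interpret module R M by fact
  note hom = module_homD[OF \<pi>(1)]
  let ?I = "{..<n}"
  have bij: "bij_betw \<phi> C (\<Pi>\<^sub>E i\<in>?I. carrier (N i))"
    and \<phi>hom: "\<phi> \<in> module_hom R (M\<lparr>carrier := C\<rparr>) (direct_sum_module ?I N)"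
    using \<phi> by (auto simp: module_iso_def carrier_direct_sum_module)
  have \<phi>add: "\<phi> (x \<oplus>\<^bsub>M\<^esub> y) = (\<lambda>i\<in>?I. \<phi> x i \<oplus>\<^bsub>N i\<^esub> \<phi> y i)" if "x \<in> C" "y \<in> C" for x y
    using module_homD(2)[OF \<phi>hom, of x y] that by (simp add: direct_sum_module_simps)
  have \<phi>smult: "\<phi> (r \<odot>\<^bsub>M\<^esub> x) = (\<lambda>i\<in>?I. r \<odot>\<^bsub>N i\<^esub> \<phi> x i)" if "r \<in> carrier R" "x \<in> C" for r x
    using module_homD(3)[OF \<phi>hom, of r x] that by (simp add: direct_sum_module_simps)
  have \<phi>C: "\<phi> x \<in> (\<Pi>\<^sub>E i\<in>?I. carrier (N i))" if "x \<in> C" for x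
    using bij that by (auto simp: bij_betw_def)
  have \<pi>\<pi>: "\<pi> (\<pi> x) = \<pi> x" "\<pi> x \<in> D" "\<pi> x \<in> carrier M" if "x \<in> carrier M" for x
    using \<pi> hom(1) that by auto
  define \<rho> where "\<rho> = (\<lambda>x. x \<ominus>\<^bsub>M\<^esub> \<pi> x)"
  have \<rho>C: "\<rho> x \<in> C" if "x \<in> carrier M" for x
    using that \<pi>\<pi>[OF that] module_hom_minus[OF M M \<pi>(1), of x "\<pi> x"]
    by (simp add: C \<rho>_def a_minus_def M.r_neg)
  have \<rho>add: "\<rho> (x \<oplus>\<^bsub>M\<^esub> y) = \<rho> x \<oplus>\<^bsub>M\<^esub> \<rho> y" if "x \<in> carrier M" "y \<in> carrier M" for x y
    using that \<pi>\<pi>(3) hom(2) by (simp add: \<rho>_def a_minus_def M.minus_add M.a_ac)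
  have \<rho>smult: "\<rho> (r \<odot>\<^bsub>M\<^esub> x) = r \<odot>\<^bsub>M\<^esub> \<rho> x" if "r \<in> carrier R" "x \<in> carrier M" for r x
    using that \<pi>\<pi>(3) hom(3) by (simp add: \<rho>_def a_minus_def smult_r_distr smult_r_minus)
  have sum: "\<pi> x \<oplus>\<^bsub>M\<^esub> \<rho> x = x" if "x \<in> carrier M" for x
    using that \<pi>\<pi>(3) by (simp add: \<rho>_def a_minus_def M.a_comm[of x] M.r_neg2)
  let ?\<psi>' = "\<lambda>x. \<lambda>i\<in>{..<Suc n}. if i = n then \<pi> x else \<phi> (\<rho> x) i"
  have carr: "?\<psi>' x \<in> carrier (direct_sum_module {..<Suc n} N)" if "x \<in> carrier M" for x
    using \<phi>C[OF \<rho>C[OF that]] \<pi>\<pi>[OF that] N by (auto simp: carrier_direct_sum_module PiE_iff less_Suc_eq)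
  have "?\<psi>' \<in> module_hom R M (direct_sum_module {..<Suc n} N)"
  proof (rule module_homI)
    show "?\<psi>' (x \<oplus>\<^bsub>M\<^esub> y) = ?\<psi>' x \<oplus>\<^bsub>direct_sum_module {..<Suc n} N\<^esub> ?\<psi>' y"
      if "x \<in> carrier M" "y \<in> carrier M" for x y
      using that \<rho>C hom(2) N
      by (auto simp: direct_sum_module_simps \<rho>add \<phi>add less_Suc_eq intro!: restrict_ext)
    show "?\<psi>' (r \<odot>\<^bsub>M\<^esub> x) = r \<odot>\<^bsub>direct_sum_module {..<Suc n} N\<^esub> ?\<psi>' x"
      if "r \<in> carrier R" "x \<in> carrier M" for r x
      using that \<rho>C hom(3) N
      by (auto simp: direct_sum_module_simps \<rho>smult \<phi>smult less_Suc_eq intro!: restrict_ext)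
  qed (rule carr)
  moreover have "inj_on ?\<psi>' (carrier M)"
  proof
    fix x y assume xy: "x \<in> carrier M" "y \<in> carrier M" "?\<psi>' x = ?\<psi>' y"
    have eq: "?\<psi>' x i = ?\<psi>' y i" for i using xy(3) by metis
    have 1: "\<pi> x = \<pi> y" using eq[of n] by simp
    have "\<phi> (\<rho> x) i = \<phi> (\<rho> y) i" if "i \<in> ?I" for i using eq[of i] that by simp
    hence "\<phi> (\<rho> x) = \<phi> (\<rho> y)" using PiE_ext[OF \<phi>C \<phi>C] \<rho>C xy by blast
    hence "\<rho> x = \<rho> y" using bij \<rho>C xy by (meson bij_betw_def inj_onD)
    thus "x = y" using 1 sum xy by metis
  qed
  moreover have "t \<in> ?\<psi>' ` carrier M" if "t \<in> carrier (direct_sum_module {..<Suc n} N)" for t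
  proof -
    have t: "t \<in> (\<Pi>\<^sub>E i\<in>{..<Suc n}. carrier (N i))" using that by (simp add: carrier_direct_sum_module)
    have tn: "t n \<in> D" using PiE_mem[OF t, of n] N by simp
    have "restrict t ?I \<in> (\<Pi>\<^sub>E i\<in>?I. carrier (N i))" using PiE_mem[OF t] by auto
    then obtain u where u: "u \<in> C" "\<phi> u = restrict t ?I"
      using bij by (metis bij_betw_def imageE)
    have c: "t n \<in> carrier M" "u \<in> carrier M" "\<pi> u = \<zero>\<^bsub>M\<^esub>"
      using submodule_in_carrier[OF D tn] u(1) by (auto simp: C)
    let ?x = "t n \<oplus>\<^bsub>M\<^esub> u"
    have \<pi>x: "\<pi> ?x = t n" using hom(2) c \<pi>(3)[OF tn] by simp
    have "\<rho> ?x = u" unfolding \<rho>_def \<pi>x using c by (simp add: a_minus_def M.a_comm[of "t n" u] M.a_assoc M.r_neg)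
    hence "?\<psi>' ?x = t"
      using \<pi>x u(2) PiE_arb[OF t] by (auto simp: fun_eq_iff less_Suc_eq)
    thus ?thesis using M.a_closed[OF c(1,2)] by (intro image_eqI[of t ?\<psi>' ?x]) simp_all
  qed
  hence "?\<psi>' ` carrier M = carrier (direct_sum_module {..<Suc n} N)" using carr by blast
  ultimately show ?thesis unfolding module_iso_def bij_betw_def \<rho>_def by blast
qed

text \<open>Each D i is an injective envelope of the simple S i. All pieces stay submodules of M in
  its own type, so splitting can be repeated; only the finished decomposition is moved to the type
  prescribed by \<open>finitely_cogenerated\<close>.\<close>

definition injective_decomposition ::
    "('r, 'x) ring_scheme \<Rightarrow> ('r, 'm, 'y) module_scheme \<Rightarrow> nat \<Rightarrow> (nat \<Rightarrow> 'm set) \<Rightarrow> (nat \<Rightarrow> 'm set) \<Rightarrow>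
      ('m \<Rightarrow> nat \<Rightarrow> 'm) \<Rightarrow> bool"
  where "injective_decomposition R M n S D \<phi> \<longleftrightarrow>
    (\<forall>i<n. submodule (D i) R M \<and> injective_module R (M\<lparr>carrier := D i\<rparr>) \<and>
      simple_module R (M\<lparr>carrier := S i\<rparr>) \<and> essential_submodule R (M\<lparr>carrier := D i\<rparr>) (S i)) \<and>
    \<phi> \<in> module_iso R M (direct_sum_module {..<n} (\<lambda>i. M\<lparr>carrier := D i\<rparr>))"

text \<open>The empty direct sum has a single element, the function that is undefined everywhere;
  hence the constant isomorphism.\<close>

lemma injective_decomposition_zero:
  assumes "module R M" "carrier M = {\<zero>\<^bsub>M\<^esub>}"
  shows "injective_decomposition R M 0 S D (\<lambda>_ _. undefined)"
  using assms
  by (auto simp: injective_decomposition_def module_iso_def module_hom_def bij_betw_def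
      carrier_direct_sum_module direct_sum_module_simps)

lemma injective_decomposition_Suc:
  assumes M: "module R M" and D: "submodule D R M" "injective_module R (M\<lparr>carrier := D\<rparr>)"
    and S: "simple_module R (M\<lparr>carrier := S\<rparr>)" "essential_submodule R (M\<lparr>carrier := D\<rparr>) S"
    and \<pi>: "\<pi> \<in> module_hom R M M" "\<pi> ` carrier M = D" "\<And>d. d \<in> D \<Longrightarrow> \<pi> d = d"
    and C: "C = {x \<in> carrier M. \<pi> x = \<zero>\<^bsub>M\<^esub>}"
    and dec: "injective_decomposition R (M\<lparr>carrier := C\<rparr>) n S' D' \<phi>"
  shows "\<exists>\<phi>. injective_decomposition R M (Suc n) (S'(n := S)) (D'(n := D)) \<phi>"
proof -
  interpret module R M by fact
  have subC: "submodule C R M" unfolding C by (rule submodule_kernel[OF M M \<pi>(1)])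
  \<comment> \<open>The update at n is invisible to a sum over indices below n.\<close>
  have "direct_sum_module {..<n} (\<lambda>i. M\<lparr>carrier := D' i\<rparr>) =
      direct_sum_module {..<n} (\<lambda>i. M\<lparr>carrier := (D'(n := D)) i\<rparr>)"
    by (auto simp: direct_sum_module_def intro!: Collect_cong PiE_cong restrict_ext ext cong: PiE_cong)
  hence "\<phi> \<in> module_iso R (M\<lparr>carrier := C\<rparr>)
      (direct_sum_module {..<n} (\<lambda>i. M\<lparr>carrier := (D'(n := D)) i\<rparr>))"
    using dec by (simp add: injective_decomposition_def)
  from direct_sum_Suc_iso[OF M D(1) \<pi> C this]
  obtain \<psi> where "\<psi> \<in> module_iso R M
      (direct_sum_module {..<Suc n} (\<lambda>i. M\<lparr>carrier := (D'(n := D)) i\<rparr>))" by auto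
  moreover have "submodule (D' i) R M" if "i < n" for i
    using dec that submodule_restrict_iff[OF subC] by (auto simp: injective_decomposition_def)
  ultimately have "injective_decomposition R M (Suc n) (S'(n := S)) (D'(n := D)) \<psi>"
    using dec D S by (auto simp: injective_decomposition_def less_Suc_eq)
  thus ?thesis by blast
qed

text \<open>Minimal counterexample: among the injective submodules without a decomposition take a
  minimal C. Splitting off the envelope of a simple submodule leaves a smaller injective C', which
  does decompose.\<close>

lemma injective_artinian_decomposition:
  assumes art: "artinian_module R (ring_module R)"
    and inj: "injective_module R E" and artE: "artinian_module R E"
  shows "\<exists>n S D \<phi>. injective_decomposition R E n S D \<phi>"
proof (rule ccontr)
  assume none: "\<not> ?thesis"
  have E: "module R E" using inj by (simp add: injective_module_def)
  interpret module R E by fact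
  let ?F = "{C. submodule C R E \<and> injective_module R (E\<lparr>carrier := C\<rparr>) \<and>
    \<not> (\<exists>n S D \<phi>. injective_decomposition R (E\<lparr>carrier := C\<rparr>) n S D \<phi>)}"
  have EF: "carrier E \<in> ?F" using carrier_is_submodule inj none by simp
  obtain C where C: "C \<in> ?F" and min: "\<And>L. \<lbrakk>L \<in> ?F; L \<subseteq> C\<rbrakk> \<Longrightarrow> L = C"
    by (rule artinian_module_minimal[OF artE EF]) auto
  define M where "M = E\<lparr>carrier := C\<rparr>"
  have subC: "submodule C R E" and injM: "injective_module R M"
    and noM: "\<And>n S D \<phi>. \<not> injective_decomposition R M n S D \<phi>"
    using C by (auto simp: M_def)
  have M: "module R M" using injM by (simp add: injective_module_def)
  interpret M: module R M by fact
  have upd: "M\<lparr>carrier := H\<rparr> = E\<lparr>carrier := H\<rparr>" for H by (simp add: M_def)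
  have "carrier M \<noteq> {\<zero>\<^bsub>M\<^esub>}" using injective_decomposition_zero[OF M] noM by blast
  then obtain x0 where x0: "x0 \<in> carrier M" "x0 \<notin> {\<zero>\<^bsub>M\<^esub>}" using M.zero_closed by blast
  \<comment> \<open>For the zero submodule this gives y with maximal annihilator, which makes R y
    simple.\<close>
  obtain y A where y: "y \<in> carrier M" "y \<notin> {\<zero>\<^bsub>M\<^esub>}" and A: "invertible_outside R A"
    and Ay: "\<And>a. a \<in> A \<Longrightarrow> a \<odot>\<^bsub>M\<^esub> y \<in> {\<zero>\<^bsub>M\<^esub>}"
    by (rule M.obtain_maximal_annihilator[OF art M.zero_submodule x0]) blast
  have yA: "y \<in> annihilated_part M A" using y Ay by (simp add: annihilated_part_def)
  define S where "S = {r \<odot>\<^bsub>M\<^esub> y | r. r \<in> carrier R}"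
  have subS: "submodule S R M" and yS: "y \<in> S"
    unfolding S_def using M.submodule_cyclic[OF y(1)] by blast+
  have simple: "simple_module R (M\<lparr>carrier := S\<rparr>)"
    unfolding simple_module_def M.submodule_restrict_iff[OF subS]
  proof (intro conjI allI impI)
    fix H assume H: "submodule H R M \<and> H \<subseteq> S"
    show "H = {\<zero>\<^bsub>M\<lparr>carrier := S\<rparr>\<^esub>} \<or> H = carrier (M\<lparr>carrier := S\<rparr>)"
    proof (cases "H = {\<zero>\<^bsub>M\<^esub>}")
      case False
      then obtain z where z: "z \<in> H" "z \<noteq> \<zero>\<^bsub>M\<^esub>" using H M.submodule_zero by blast
      then obtain r where r: "r \<in> carrier R" "z = r \<odot>\<^bsub>M\<^esub> y" using H by (auto simp: S_def)
      have "r \<notin> A" using Ay r z by blast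
      then obtain s where "s \<in> carrier R" "s \<odot>\<^bsub>M\<^esub> z = y"
        using M.annihilated_part_recover[OF A yA r(1)] r(2) by blast
      hence "y \<in> H" using M.submodule_smult[of H s z] H z by auto
      hence "S \<subseteq> H" using M.submodule_smult H by (auto simp: S_def)
      thus ?thesis using H by auto
    qed simp
  qed (use M.module_restrict[OF subS] yS y(2) in auto)
  obtain D \<pi> where D: "submodule D R M" "S \<subseteq> D" and \<pi>: "\<pi> \<in> module_hom R M M" "\<pi> ` carrier M = D"
    "\<And>d. d \<in> D \<Longrightarrow> \<pi> d = d" and ess: "essential_submodule R (M\<lparr>carrier := D\<rparr>) S"
    by (rule injective_module_splits[OF injM subS]) blast
  define C' where "C' = {x \<in> carrier M. \<pi> x = \<zero>\<^bsub>M\<^esub>}"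
  have subC': "submodule C' R M" unfolding C'_def by (rule submodule_kernel[OF M M \<pi>(1)])
  note hom = module_homD[OF \<pi>(1)]
  have \<pi>D: "\<pi> x \<in> D" if "x \<in> carrier M" for x using that \<pi>(2) by blast
  \<comment> \<open>The complementary projection retracts M onto the kernel of \<pi>.\<close>
  have "injective_module R (M\<lparr>carrier := C'\<rparr>)"
  proof (rule injective_module_retract[OF injM subC'])
    show "(\<lambda>x. x \<ominus>\<^bsub>M\<^esub> \<pi> x) \<in> module_hom R M M"
      using hom by (intro module_homI)
        (simp_all add: a_minus_def M.M.minus_add M.M.a_ac M.smult_r_distr M.smult_r_minus)
    show "(\<lambda>x. x \<ominus>\<^bsub>M\<^esub> \<pi> x) ` carrier M \<subseteq> C'"
    proof (intro image_subsetI)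
      fix x assume x: "x \<in> carrier M"
      have "\<pi> (x \<ominus>\<^bsub>M\<^esub> \<pi> x) = \<pi> x \<ominus>\<^bsub>M\<^esub> \<pi> (\<pi> x)"
        using module_hom_minus[OF M M \<pi>(1) x] hom(1)[OF x] by blast
      also have "\<dots> = \<zero>\<^bsub>M\<^esub>" using \<pi>(3)[OF \<pi>D[OF x]] hom(1)[OF x] by (simp add: a_minus_def M.M.r_neg)
      finally show "x \<ominus>\<^bsub>M\<^esub> \<pi> x \<in> C'" using x hom(1)[OF x] by (simp add: C'_def)
    qed
    show "d \<ominus>\<^bsub>M\<^esub> \<pi> d = d" if "d \<in> C'" for d using that by (simp add: C'_def a_minus_def)
  qed
  moreover have "C' \<subseteq> C" "submodule C' R E"
    using subC' submodule_restrict_iff[OF subC] by (auto simp: M_def)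
  moreover have "C' \<noteq> C"
  proof
    assume "C' = C"
    hence "\<pi> y = \<zero>\<^bsub>M\<^esub>" using y(1) by (auto simp: C'_def M_def)
    thus False using \<pi>(3)[of y] D(2) yS y(2) by auto
  qed
  ultimately obtain n S' D' \<phi> where dec: "injective_decomposition R (M\<lparr>carrier := C'\<rparr>) n S' D' \<phi>"
    using min[of C'] by (auto simp: upd)
  have "injective_module R (M\<lparr>carrier := D\<rparr>)"
    by (rule injective_module_retract[OF injM D(1) \<pi>(1)]) (use \<pi> in auto)
  from injective_decomposition_Suc[OF M D(1) this simple ess \<pi> C'_def dec] show False using noM by blast
qed

section \<open>Changing the carrier type\<close>

lemma module_iso_compose:
  assumes "f \<in> module_iso R L M" "g \<in> module_iso R M N"
  shows "(\<lambda>x. g (f x)) \<in> module_iso R L N"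
  using assms module_hom_compose[of f R L M g N] bij_betw_trans[of f _ _ g]
  by (auto simp: module_iso_def comp_def)

lemma injective_module_iso:
  assumes inj: "injective_module R M" and N: "module R N" and h: "h \<in> module_iso R M N"
  shows "injective_module R N"
  unfolding injective_module_def
proof (intro conjI allI impI N)
  have M: "module R M" using inj by (simp add: injective_module_def)
  have hom: "h \<in> module_hom R M N" and bij: "bij_betw h (carrier M) (carrier N)"
    using h by (auto simp: module_iso_def)
  let ?k = "inv_into (carrier M) h"
  have k: "?k \<in> module_hom R N M" using module_iso_inv[OF M N h] by (simp add: module_iso_def)
  fix A B :: "('a, 'a) module" and f g
  assume *: "module R A \<and> module R B \<and> f \<in> module_hom R A B \<and> inj_on f (carrier A) \<and>
    g \<in> module_hom R A N"
  have "(\<lambda>x. ?k (g x)) \<in> module_hom R A M" using module_hom_compose[OF _ k] * by blast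
  then obtain l where l: "l \<in> module_hom R B M" "\<forall>x\<in>carrier A. l (f x) = ?k (g x)"
    using * inj unfolding injective_module_def by blast
  have "h (l (f x)) = g x" if "x \<in> carrier A" for x
  proof -
    have "g x \<in> carrier N" using * that by (auto simp: module_hom_def)
    thus ?thesis using l(2) that bij by (simp add: bij_betw_def f_inv_into_f)
  qed
  thus "\<exists>h\<in>module_hom R B N. \<forall>x\<in>carrier A. h (f x) = g x"
    using module_hom_compose[OF l(1) hom] by (intro bexI[of _ "\<lambda>x. h (l x)"]) auto
qed

lemma submodule_vimage_image:
  assumes "h \<in> module_iso R M N" "K \<subseteq> carrier N"
  shows "h ` {x \<in> carrier M. h x \<in> K} = K"
  using assms by (auto simp: module_iso_def bij_betw_def)

lemma simple_module_iso:
  assumes simple: "simple_module R M" and N: "module R N" and h: "h \<in> module_iso R M N"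
  shows "simple_module R N"
proof -
  have M: "module R M" using simple by (simp add: simple_module_def)
  interpret N: module R N by fact
  have hom: "h \<in> module_hom R M N" and bij: "bij_betw h (carrier M) (carrier N)"
    using h by (auto simp: module_iso_def)
  have h0: "h \<zero>\<^bsub>M\<^esub> = \<zero>\<^bsub>N\<^esub>" by (rule module_hom_zero[OF M N hom])
  have im: "h ` carrier M = carrier N" using bij by (simp add: bij_betw_def)
  have "carrier N \<noteq> {\<zero>\<^bsub>N\<^esub>}"
  proof
    assume "carrier N = {\<zero>\<^bsub>N\<^esub>}"
    hence eq: "h x = h \<zero>\<^bsub>M\<^esub>" if "x \<in> carrier M" for x using im h0 that by auto
    have zero: "\<zero>\<^bsub>M\<^esub> \<in> carrier M" using module.submodule_zero[OF M module.carrier_is_submodule[OF M]] .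
    have "x = \<zero>\<^bsub>M\<^esub>" if "x \<in> carrier M" for x
      using inj_onD[OF bij_betw_imp_inj_on[OF bij] eq[OF that] that zero] .
    hence "carrier M = {\<zero>\<^bsub>M\<^esub>}" using zero by blast
    thus False using simple by (simp add: simple_module_def)
  qed
  moreover have "H = {\<zero>\<^bsub>N\<^esub>} \<or> H = carrier N" if H: "submodule H R N" for H
  proof -
    let ?L = "{x \<in> carrier M. h x \<in> H}"
    have "submodule ?L R M" by (rule submodule_vimage[OF M N hom H])
    hence "?L = {\<zero>\<^bsub>M\<^esub>} \<or> ?L = carrier M" using simple by (simp add: simple_module_def)
    hence "h ` ?L = h ` {\<zero>\<^bsub>M\<^esub>} \<or> h ` ?L = h ` carrier M" by (elim disjE) simp_all
    thus ?thesis using submodule_vimage_image[OF h N.submoduleE(1)[OF H]] h0 im by simp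
  qed
  ultimately show ?thesis using N by (simp add: simple_module_def)
qed

lemma essential_submodule_iso:
  assumes M: "module R M" and N: "module R N" and h: "h \<in> module_iso R M N"
    and ess: "essential_submodule R M H"
  shows "essential_submodule R N (h ` H)"
  unfolding essential_submodule_def
proof (intro conjI allI impI)
  interpret M: module R M by fact
  interpret N: module R N by fact
  have hom: "h \<in> module_hom R M N" and bij: "bij_betw h (carrier M) (carrier N)"
    using h by (auto simp: module_iso_def)
  have H: "submodule H R M" using ess by (simp add: essential_submodule_def)
  show "submodule (h ` H) R N" by (rule submodule_image[OF M N hom H])
  have h0: "h \<zero>\<^bsub>M\<^esub> = \<zero>\<^bsub>N\<^esub>" by (rule module_hom_zero[OF M N hom])
  fix K assume K: "submodule K R N \<and> K \<noteq> {\<zero>\<^bsub>N\<^esub>}"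
  let ?L = "{x \<in> carrier M. h x \<in> K}"
  have L: "submodule ?L R M" by (rule submodule_vimage[OF M N hom]) (use K in blast)
  have KL: "h ` ?L = K" by (rule submodule_vimage_image[OF h]) (use K N.submoduleE(1) in blast)
  hence "?L \<noteq> {\<zero>\<^bsub>M\<^esub>}" using K h0 by (metis image_empty image_insert)
  hence "H \<inter> ?L \<noteq> {\<zero>\<^bsub>M\<^esub>}" using ess L by (simp add: essential_submodule_def)
  moreover have "\<zero>\<^bsub>M\<^esub> \<in> H \<inter> ?L" using M.submodule_zero[OF H] M.submodule_zero[OF L] by blast
  ultimately obtain x where x: "x \<in> H" "x \<in> carrier M" "h x \<in> K" "x \<noteq> \<zero>\<^bsub>M\<^esub>" by auto
  have "h x \<noteq> \<zero>\<^bsub>N\<^esub>" using x(2,4) h0 bij by (metis M.zero_closed bij_betw_def inj_onD)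
  thus "h ` H \<inter> K \<noteq> {\<zero>\<^bsub>N\<^esub>}" using x by blast
qed

text \<open>Transport of structure. Decoding inverts \<iota> on the whole type and not on the
  carrier, so the copies of a module and of its submodules share their operations.\<close>

definition image_module :: "('m \<Rightarrow> 'n) \<Rightarrow> ('r, 'm, 'y) module_scheme \<Rightarrow> ('r, 'n) module"
  where "image_module \<iota> M = \<lparr>carrier = \<iota> ` carrier M, mult = undefined, one = undefined,
    zero = \<iota> \<zero>\<^bsub>M\<^esub>, add = (\<lambda>a b. \<iota> (inv_into UNIV \<iota> a \<oplus>\<^bsub>M\<^esub> inv_into UNIV \<iota> b)), smult = (\<lambda>r a. \<iota> (r \<odot>\<^bsub>M\<^esub> inv_into UNIV \<iota> a))\<rparr>"

lemma image_module_simps: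
  "carrier (image_module \<iota> M) = \<iota> ` carrier M" "zero (image_module \<iota> M) = \<iota> \<zero>\<^bsub>M\<^esub>"
  "inj \<iota> \<Longrightarrow> \<iota> x \<oplus>\<^bsub>image_module \<iota> M\<^esub> \<iota> y = \<iota> (x \<oplus>\<^bsub>M\<^esub> y)"
  "inj \<iota> \<Longrightarrow> r \<odot>\<^bsub>image_module \<iota> M\<^esub> \<iota> x = \<iota> (r \<odot>\<^bsub>M\<^esub> x)"
  by (simp_all add: image_module_def)

lemma module_image_module:
  assumes M: "module R M" and \<iota>: "inj \<iota>"
  shows "module R (image_module \<iota> M)"
proof (rule moduleI)
  interpret module R M by fact
  show "cring R" by (rule R.is_cring)
  show "abelian_group (image_module \<iota> M)"
  proof (rule abelian_groupI)
    show "\<exists>y\<in>carrier (image_module \<iota> M). y \<oplus>\<^bsub>image_module \<iota> M\<^esub> x = \<zero>\<^bsub>image_module \<iota> M\<^esub>"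
      if x: "x \<in> carrier (image_module \<iota> M)" for x
    proof -
      obtain m where "m \<in> carrier M" "x = \<iota> m" using x by (auto simp: image_module_simps)
      thus ?thesis using \<iota> M.l_neg
        by (intro bexI[of _ "\<iota> (\<ominus>\<^bsub>M\<^esub> m)"]) (auto simp: image_module_simps)
    qed
  qed (use \<iota> in \<open>auto simp: image_module_simps M.a_ac\<close>)
qed (use assms in \<open>auto simp: image_module_simps module.smult_closed module.smult_one
       module.smult_l_distr module.smult_r_distr module.smult_assoc1\<close>)

lemma image_module_iso:
  assumes "inj \<iota>"
  shows "\<iota> \<in> module_iso R M (image_module \<iota> M)"
  using assms
  by (auto simp: module_iso_def module_hom_def image_module_simps bij_betw_def inj_on_def)

lemma direct_sum_image_module_iso:
  assumes "finite I" and \<iota>: "inj \<iota>"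
  shows "(\<lambda>t. \<lambda>i\<in>I. \<iota> (t i)) \<in>
    module_iso R (direct_sum_module I N) (direct_sum_module I (\<lambda>i. image_module \<iota> (N i)))"
proof -
  let ?h = "\<lambda>t. \<lambda>i\<in>I. \<iota> (t i)"
  have "?h \<in> module_hom R (direct_sum_module I N) (direct_sum_module I (\<lambda>i. image_module \<iota> (N i)))"
    using assms
    by (intro module_homI)
      (auto simp: carrier_direct_sum_module direct_sum_module_simps image_module_simps
        intro!: restrict_ext)
  moreover have "inj_on ?h (\<Pi>\<^sub>E i\<in>I. carrier (N i))"
  proof
    fix s t assume st: "s \<in> (\<Pi>\<^sub>E i\<in>I. carrier (N i))" "t \<in> (\<Pi>\<^sub>E i\<in>I. carrier (N i))" "?h s = ?h t"
    have "s i = t i" if "i \<in> I" for i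
      using fun_cong[OF st(3), of i] that \<iota> by (simp add: inj_eq)
    thus "s = t" using PiE_ext[OF st(1,2)] by blast
  qed
  moreover have "(\<Pi>\<^sub>E i\<in>I. \<iota> ` carrier (N i)) \<subseteq> ?h ` (\<Pi>\<^sub>E i\<in>I. carrier (N i))"
  proof
    fix t assume t: "t \<in> (\<Pi>\<^sub>E i\<in>I. \<iota> ` carrier (N i))"
    let ?s = "\<lambda>i\<in>I. inv_into UNIV \<iota> (t i)"
    have s: "inv_into UNIV \<iota> (t i) \<in> carrier (N i) \<and> \<iota> (inv_into UNIV \<iota> (t i)) = t i" if "i \<in> I" for i
      using PiE_mem[OF t that] \<iota> by auto
    have "t = ?h ?s" using s PiE_arb[OF t] by (auto simp: fun_eq_iff)
    moreover have "?s \<in> (\<Pi>\<^sub>E i\<in>I. carrier (N i))" using s by auto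
    ultimately show "t \<in> ?h ` (\<Pi>\<^sub>E i\<in>I. carrier (N i))" by (rule image_eqI)
  qed
  ultimately show ?thesis
    using assms(1) by (auto simp: module_iso_def bij_betw_def carrier_direct_sum_module image_module_simps)
qed

text \<open>Being injective, E is its own envelope. It remains to move E, the summands and their
  simple submodules into the prescribed type.\<close>

lemma finite_length_imp_finitely_cogenerated:
  fixes R :: "('r, 'x) ring_scheme" and E :: "('r, 'e, 'y) module_scheme"
  assumes art: "artinian_module R (ring_module R)"
    and inj: "injective_module R E" and len: "finite_length_module R E"
  shows "finitely_cogenerated R E"
proof -
  have E: "module R E" using inj by (simp add: injective_module_def)
  interpret module R E by fact
  obtain n S D \<phi> where dec: "injective_decomposition R E n S D \<phi>"
    using injective_artinian_decomposition[OF art inj finite_length_imp_artinian[OF len]] by blast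
  define \<iota> :: "'e \<Rightarrow> ('r, 'e) envelope_carrier" where "\<iota> = (\<lambda>x. {Inr (Inl x)})"
  have \<iota>: "inj \<iota>" by (auto simp: \<iota>_def inj_def)
  let ?T = "\<lambda>H. image_module \<iota> (E\<lparr>carrier := H\<rparr>)"
  let ?N = "image_module \<iota> E"
  have N: "module R ?N" by (rule module_image_module[OF E \<iota>])
  have iso: "\<iota> \<in> module_iso R E ?N" by (rule image_module_iso[OF \<iota>])
  have "essential_submodule R E (carrier E)"
    using carrier_is_submodule submoduleE(1) by (auto simp: essential_submodule_def Int_absorb1)
  hence env: "injective_envelope R E ?N \<iota>"
    using E injective_module_iso[OF inj N iso] iso essential_submodule_iso[OF E N iso, of "carrier E"]
    by (simp add: injective_envelope_def module_iso_def bij_betw_def)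
  have summand: "simple_module R (?T (S i)) \<and> injective_envelope R (?T (S i)) (?T (D i)) (\<lambda>x. x)"
    if "i < n" for i
  proof -
    have D: "submodule (D i) R E" "injective_module R (E\<lparr>carrier := D i\<rparr>)"
      and S: "simple_module R (E\<lparr>carrier := S i\<rparr>)" "essential_submodule R (E\<lparr>carrier := D i\<rparr>) (S i)"
      using dec that by (auto simp: injective_decomposition_def)
    have Smod: "module R (E\<lparr>carrier := S i\<rparr>)" using S by (simp add: simple_module_def)
    have SD: "S i \<subseteq> D i"
      using S(2) submodule_restrict_iff[OF D(1)] by (auto simp: essential_submodule_def)
    note Dmod = module_restrict[OF D(1)]
    note TS = module_image_module[OF Smod \<iota>] and TD = module_image_module[OF Dmod \<iota>]
    have "simple_module R (?T (S i))" by (rule simple_module_iso[OF S(1) TS image_module_iso[OF \<iota>]])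
    moreover have "injective_module R (?T (D i))"
      by (rule injective_module_iso[OF D(2) TD image_module_iso[OF \<iota>]])
    moreover have "essential_submodule R (?T (D i)) (\<iota> ` S i)"
      by (rule essential_submodule_iso[OF Dmod TD image_module_iso[OF \<iota>] S(2)])
    \<comment> \<open>The two copies have the same operations, so the inclusion of S i in D i
      becomes the identity function.\<close>
    moreover have "(\<lambda>x. x) \<in> module_hom R (?T (S i)) (?T (D i))"
      using SD by (auto simp: module_hom_def image_module_def)
    ultimately show ?thesis
      using TS by (simp add: injective_envelope_def image_module_simps)
  qed
  \<comment> \<open>Decode by the inverse of \<iota>, decompose by \<phi>, then encode each
    coordinate by \<iota>.\<close>
  have sum: "module_iso R ?N (direct_sum_module {..<n} (\<lambda>i. ?T (D i))) \<noteq> {}"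
    using module_iso_compose[OF module_iso_compose[OF module_iso_inv[OF E N iso], of \<phi>]
        direct_sum_image_module_iso[OF _ \<iota>]] dec
    unfolding injective_decomposition_def by blast
  show ?thesis
    unfolding finitely_cogenerated_def
    by (rule exI[of _ ?N], rule exI[of _ \<iota>], rule exI[of _ n], rule exI[of _ "\<lambda>i. ?T (S i)"],
        rule exI[of _ "\<lambda>i. ?T (D i)"], rule exI[of _ "\<lambda>_ x. x"])
      (intro conjI[OF env] conjI[OF _ sum] allI impI summand)
qed

theorem theorem3p5:
  fixes R :: "('r, 'x) ring_scheme" and E :: "('r, 'e, 'y) module_scheme"
  assumes "artinian_cring R" and "\<one>\<^bsub>R\<^esub> \<noteq> \<zero>\<^bsub>R\<^esub>"
    and "injective_module R E"
  shows "(hopfian R E \<longleftrightarrow> cohopfian R E) \<and>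
         (hopfian R E \<longleftrightarrow> finitely_generated_module R E) \<and>
         (hopfian R E \<longleftrightarrow> finite_length_module R E) \<and>
         (hopfian R E \<longleftrightarrow> noetherian_module R E) \<and>
         (hopfian R E \<longleftrightarrow> artinian_module R E) \<and>
         (hopfian R E \<longleftrightarrow> finitely_cogenerated R E)"
proof -
  note inj = assms(3)
  have E: "module R E" using inj by (simp add: injective_module_def)
  interpret module R E by fact
  note art = artinian_cring.artinian_ring_module[OF assms(1)]
  have "finite_length_module R E" if "cohopfian R E"
    using finite_length_if_annihilated_parts[OF art
        cohopfian_imp_annihilated_part_finite_length[OF inj that]] .
  moreover have "finite_length_module R E" if "noetherian_module R E"
    using finite_length_if_annihilated_parts[OF art
        noetherian_imp_annihilated_part_finite_length[OF that]] .
  \<comment> \<open>The implications close up as (1) -> (2) -> (4) -> (5) -> (1), then (4) -> (3) ->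
    (6) -> (2), and (4) <-> (7).\<close>
  ultimately show ?thesis
    using injective_hopfian_imp_cohopfian[OF inj] noetherian_imp_hopfian[OF E]
      artinian_imp_cohopfian[OF E] finitely_generated_imp_artinian[OF art]
      finite_length_imp_noetherian finite_length_imp_artinian finite_length_imp_finitely_generated
      finitely_cogenerated_imp_finite_length[OF art]
      finite_length_imp_finitely_cogenerated[OF art inj]
    by blast
qed

end
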